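(* Let $\mathcal C_{\mathcal B}$ be a shock manifold with profiles $W(z,q)$ as in the context, and let $q\in\mathcal C_{\mathcal B}$ (near the base point $\underline q$). If the standard uniform Evans condition holds at $q$, then the modified uniform Evans condition holds at $q$.
   Context: Setting (Laplacian viscosity). $N,d\ge1$, $A_0=I$, and $A_1,\dots,A_d$ are $C^\infty$ maps from a connected open set $\mathcal U^*\subset\mathbb R^N$ to $\mathbb R^{N\times N}$; $\mathcal U_\pm\subset\mathcal U^*$ are connected open sets such that for $u\in\mathcal U_+\cup\mathcal U_-$, $\xi\in\mathbb R^d\setminus\{0\}$ all eigenvalues of $\sum_{j=1}^d\xi_jA_j(u)$ are real. $\mathcal A_d(u,s,h)=A_d(u)-sA_0(u)-\sum_{j=1}^{d-1}h_jA_j(u)$ for $(s,h)\in\mathbb R\times\mathbb R^{d-1}$. Shock manifold. For some integer $0\le k\le N+1$, $\mathcal C_{\mathcal B}\subset\mathcal U_+\times\mathcal U_-\times\mathbb R^d$ is a connected $C^\infty$ submanifold of dimension $N+d-k$; for $q=(p_+,p_-,s,h)\in\mathcal C_{\mathcal B}$ the matrices $\mathcal A_d(p_\pm,s,h)$ are invertible and (number of negative eigenvalues of $\mathcal A_d(p_+,s,h)$)+(number of positive eigenvalues of $\mathcal A_d(p_-,s,h)$)$=N+1-k$. $W:\mathbb R\times\mathcal C_{\mathcal B}\to\mathcal U^*$ is $C^\infty$ and $W(\cdot,q)$ is a nonconstant solution of $(1+|h|^2)W''=\mathcal A_d(W,s,h)W'$ on $\mathbb R$ with $\lim_{z\to\pm\infty}W=p_\pm$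 ($'=\partial_z$). Base point: $\underline q=(\underline p_+,\underline p_-,0,0)\in\mathcal C_{\mathcal B}$, $\underline w=W(\cdot,\underline q)$; $q$ is taken in a sufficiently small neighborhood of $\underline q$. Frequencies. For $\zeta=(\tau,\gamma,\eta)\in\mathbb R\times[0,\infty)\times\mathbb R^{d-1}\setminus\{0\}$ write $\zeta=\rho\hat\zeta$, $\rho=|\zeta|$, $\hat\zeta\in\overline S^d_+=\{|\hat\zeta|=1,\hat\gamma\ge0\}$. With $W=W(z,q)$ put $$\mathcal L(z,q,\zeta,\partial_z)u=-(1+|h|^2)u''+\Big(\mathcal A_d(W,s,h)+2\sum_{j<d}h_ji\eta_j\Big)u'+(\partial_w\mathcal A_d(W,s,h)u)W'+(i\tau+\gamma)A_0(W)u+\sum_{j<d}i\eta_jA_j(W)u+|\eta|^2u,$$ $$\mathcal L_1(z,q,\zeta)=(i\tau+\gamma)A_0(W)W'+\sum_{j<d}i\eta_jA_j(W)W'+2\sum_{j<d}h_ji\eta_jW''+|\eta|^2W',\quad c_0(\zeta)=i\tau+\gamma+|\eta|^2,$$ and write $\mathcal L_1=\rho\check{\mathcal L}_1(z,q,\hat\zeta,\rho)$, $c_0=\rho\check c_0(\hat\zeta,\rho)$. For subspaces $E,F\subset\mathbb C^D$ with $\dim E+\dim F=D$, $\det(E,F)$ is the determinant formed from orthonormal bases of $E$ and $F$. Standard Evans function: $E_\pm(q,\hat\zeta,\rho)\subset\mathbb C^{2N}$ is the ($N$-dimensional) space of $(u(0),u'(0))$ for bounded solutions of $\mathcal Lu=0$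 on $\pm z\ge0$; $D_s(q,\hat\zeta,\rho)=\det(E_-\times E_+,\{(U,U):U\in\mathbb C^{2N}\})$. Standard uniform Evans condition at $q$: there are $c,\rho_0>0$ with $|D_s(q,\hat\zeta,\rho)|\ge c\rho$ for $\hat\zeta\in\overline S^d_+$, $0<\rho\le\rho_0$, and $D_s(q,\hat\zeta,\rho)\ne0$ for $\hat\zeta\in\overline S^d_+$, $\rho>0$. Modified Evans function: $\widetilde{\mathbb E}(q,\hat\zeta,\rho)$ is the space of $(U^-_0,U^+_0,\phi)\in\mathbb C^{2N}\times\mathbb C^{2N}\times\mathbb C$, $U_0^\pm=(u_0^\pm,v_0^\pm)$, such that the solutions of $\mathcal Lu^\pm-\phi\check{\mathcal L}_1=0$ on $\pm z\ge0$ with $u^\pm(0)=u_0^\pm$, $\partial_zu^\pm(0)=v_0^\pm$ are bounded; $\ker\widetilde\Gamma(q,\hat\zeta,\rho)$ is the space of such triples with $U_0^-=U_0^+$ and $\underline w_z(0)\cdot u_0^++\check c_0(\hat\zeta,\rho)\phi=0$. $\widetilde D(q,\hat\zeta,\rho)=\det(\widetilde{\mathbb E},\ker\widetilde\Gamma)$, a $(4N+1)\times(4N+1)$ determinant. Modified uniform Evans condition at $q$: there are $c,\rho_0>0$ with $|\widetilde D(q,\hat\zeta,\rho)|\ge c$ for $\hat\zeta\in\overline S^d_+$, $0<\rho\le\rho_0$, and $\widetilde D(q,\hat\zeta,\rho)\ne0$ for $\hat\zeta\in\overline S^d_+$, $\rho>0$. *)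

theory Defs
  imports "HOL-Analysis.Analysis" "HOL-Computational_Algebra.Polynomial"
begin

fun Ck_on :: "nat \<Rightarrow> 'a::euclidean_space set \<Rightarrow> ('a \<Rightarrow> 'b::real_normed_vector) \<Rightarrow> bool" where
  "Ck_on 0 S f \<longleftrightarrow> continuous_on S f"
| "Ck_on (Suc k) S f \<longleftrightarrow>
     (\<forall>x\<in>S. f differentiable (at x)) \<and> (\<forall>v. Ck_on k S (\<lambda>x. frechet_derivative f (at x) v))"

text \<open>Intended for open \<open>S\<close> only.\<close>
definition smooth_on :: "'a::euclidean_space set \<Rightarrow> ('a \<Rightarrow> 'b::real_normed_vector) \<Rightarrow> bool" where
  "smooth_on S f \<longleftrightarrow> (\<forall>k. Ck_on k S f)"

text \<open>For maps on a set that need not be open, in particular an embedded submanifold: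
  locally the restriction of a smooth map on an open set of the ambient space.\<close>
definition smooth_rel :: "'a::euclidean_space set \<Rightarrow> ('a \<Rightarrow> 'b::real_normed_vector) \<Rightarrow> bool" where
  "smooth_rel S f \<longleftrightarrow>
     (\<forall>x\<in>S. \<exists>V g. open V \<and> x \<in> V \<and> smooth_on V g \<and> (\<forall>y\<in>S \<inter> V. g y = f y))"

text \<open>Embedded, not merely immersed: \<open>\<Phi>\<close> is a slice chart.\<close>
definition smooth_submanifold :: "nat \<Rightarrow> 'a::euclidean_space set \<Rightarrow> bool" where
  "smooth_submanifold m C \<longleftrightarrow>
     (\<forall>x\<in>C. \<exists>V V' \<Phi> \<Psi> L. open V \<and> x \<in> V \<and> open (V' :: 'a set) \<and>
        homeomorphism V V' \<Phi> \<Psi> \<and> smooth_on V \<Phi> \<and> smooth_on V' \<Psi> \<and>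
        subspace L \<and> dim L = m \<and> \<Phi> ` (C \<inter> V) = V' \<inter> L)"

definition cvec :: "real^'n \<Rightarrow> complex^'n" where
  "cvec x = (\<chi> i. complex_of_real (x $ i))"

definition cmat :: "real^'n^'m \<Rightarrow> complex^'n^'m" where
  "cmat M = (\<chi> i j. complex_of_real (M $ i $ j))"

definition is_eigenvalue :: "real^'n^'n \<Rightarrow> complex \<Rightarrow> bool" where
  "is_eigenvalue M c \<longleftrightarrow> (\<exists>v. v \<noteq> 0 \<and> cmat M *v v = c *s v)"

definition charpoly :: "real^'n^'n \<Rightarrow> real poly" where
  "charpoly M = det (\<chi> i j. (if i = j then [:0, 1:] else 0) - [:M $ i $ j:])"

text \<open>Eigenvalues are counted with algebraic multiplicity. The counts are used only for matrices
  all of whose eigenvalues are real.\<close>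
definition num_neg_eigenvalues :: "real^'n^'n \<Rightarrow> nat" where
  "num_neg_eigenvalues M = (\<Sum>x | poly (charpoly M) x = 0 \<and> x < 0. order x (charpoly M))"

definition num_pos_eigenvalues :: "real^'n^'n \<Rightarrow> nat" where
  "num_pos_eigenvalues M = (\<Sum>x | poly (charpoly M) x = 0 \<and> x > 0. order x (charpoly M))"

definition vjoin :: "complex^'a \<Rightarrow> complex^'b \<Rightarrow> complex^('a + 'b)" where
  "vjoin x y = (\<chi> i. case i of Inl a \<Rightarrow> x $ a | Inr b \<Rightarrow> y $ b)"

definition hermitian :: "complex^'m \<Rightarrow> complex^'m \<Rightarrow> complex" where
  "hermitian x y = (\<Sum>i\<in>UNIV. x $ i * cnj (y $ i))"

definition cols_onb :: "complex^'m^'m \<Rightarrow> 'm set \<Rightarrow> (complex^'m) set \<Rightarrow> bool" where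
  "cols_onb M I E \<longleftrightarrow>
     (\<forall>i\<in>I. \<forall>j\<in>I. hermitian (column i M) (column j M) = (if i = j then 1 else 0)) \<and>
     vec.span ((\<lambda>i. column i M) ` I) = E"

text \<open>The determinant formed from orthonormal bases of two complex subspaces of complementary
  dimensions; the bases are the columns of \<open>M\<close> in \<open>I\<close> and in \<open>- I\<close>. A different choice of bases
  multiplies the value by a number of modulus 1, so only the modulus (and vanishing) is
  meaningful.\<close>
definition det_pair :: "(complex^'m) set \<Rightarrow> (complex^'m) set \<Rightarrow> complex" where
  "det_pair E F = det (SOME M. \<exists>I. cols_onb M I E \<and> cols_onb M (- I) F)"

text \<open>The space dimension is \<open>d = CARD('d)\<close>, and \<open>l :: 'd\<close> is the last index \<open>d\<close>, the direction
  normal to the shock. With \<open>\<real>\<^sup>d\<^sup>-\<^sup>1\<close> indexed by \<open>- {l}\<close> (possibly empty), a pair \<open>(s, h)\<close> in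
  \<open>\<real> \<times> \<real>\<^sup>d\<^sup>-\<^sup>1\<close> is the vector \<open>\<sigma> :: real^'d\<close> with \<open>\<sigma> $ l = s\<close> and \<open>\<sigma> $ j = h\<^sub>j\<close> for \<open>j \<noteq> l\<close>.
  Likewise a frequency \<open>(\<tau>, \<gamma>, \<eta>)\<close> is \<open>(\<gamma>, x) :: real \<times> real^'d\<close> with \<open>x $ l = \<tau>\<close> and
  \<open>x $ j = \<eta>\<^sub>j\<close> for \<open>j \<noteq> l\<close>. Both identifications are isometric. A point \<open>q\<close> of the shock
  manifold is \<open>(p\<^sub>+, p\<^sub>-, \<sigma>)\<close>.\<close>

type_synonym ('n, 'd) shock = "(real^'n) \<times> (real^'n) \<times> (real^'d)"
type_synonym 'd freq = "real \<times> (real^'d)"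

abbreviation sig :: "('n, 'd) shock \<Rightarrow> real^'d" where "sig q \<equiv> snd (snd q)"

definition normsq_tan :: "'d::finite \<Rightarrow> real^'d \<Rightarrow> real" where
  "normsq_tan l x = (\<Sum>j\<in>- {l}. (x $ j)\<^sup>2)"

definition A0 :: "real^'n \<Rightarrow> real^'n^'n" where
  "A0 w = mat 1"

definition Acal :: "'d::finite \<Rightarrow> ('d \<Rightarrow> real^'n \<Rightarrow> real^'n^'n) \<Rightarrow> real^'n \<Rightarrow> real^'d \<Rightarrow> real^'n^'n" where
  "Acal l A w \<sigma> = A l w - \<sigma> $ l *\<^sub>R A0 w - (\<Sum>j\<in>- {l}. \<sigma> $ j *\<^sub>R A j w)"

definition Wz :: "(real \<Rightarrow> ('n, 'd) shock \<Rightarrow> real^'n) \<Rightarrow> real \<Rightarrow> ('n, 'd) shock \<Rightarrow> real^'n" where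
  "Wz W z q = vector_derivative (\<lambda>y. W y q) (at z)"

definition Wzz :: "(real \<Rightarrow> ('n, 'd) shock \<Rightarrow> real^'n) \<Rightarrow> real \<Rightarrow> ('n, 'd) shock \<Rightarrow> real^'n" where
  "Wzz W z q = vector_derivative (\<lambda>y. Wz W y q) (at z)"

locale shock_manifold =
  fixes l :: "'d::finite"
    and A :: "'d \<Rightarrow> real^'n \<Rightarrow> real^'n^'n"
    and Us Up Um :: "(real^'n) set"
    and k :: nat
    and C :: "('n, 'd) shock set"
    and W :: "real \<Rightarrow> ('n, 'd) shock \<Rightarrow> real^'n"
    and q0 :: "('n, 'd) shock"
  assumes Us: "open Us" "connected Us"
    and Up: "open Up" "connected Up" "Up \<subseteq> Us"
    and Um: "open Um" "connected Um" "Um \<subseteq> Us"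
    and A_smooth: "\<And>j. smooth_on Us (A j)"
    and A_hyperbolic: "\<And>u \<xi> c. u \<in> Up \<union> Um \<Longrightarrow> \<xi> \<noteq> 0 \<Longrightarrow>
          is_eigenvalue (\<Sum>j\<in>UNIV. \<xi> $ j *\<^sub>R A j u) c \<Longrightarrow> c \<in> \<real>"
    and k_le: "k \<le> CARD('n) + 1"
    and C_subset: "C \<subseteq> Up \<times> Um \<times> UNIV"
    and C_connected: "connected C"
    and C_submanifold: "smooth_submanifold (CARD('n) + CARD('d) - k) C"
    and Acal_invertible: "\<And>pp pm \<sigma>. (pp, pm, \<sigma>) \<in> C \<Longrightarrow>
          invertible (Acal l A pp \<sigma>) \<and> invertible (Acal l A pm \<sigma>)"
    and eigenvalue_count: "\<And>pp pm \<sigma>. (pp, pm, \<sigma>) \<in> C \<Longrightarrow>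
          num_neg_eigenvalues (Acal l A pp \<sigma>) + num_pos_eigenvalues (Acal l A pm \<sigma>)
            = CARD('n) + 1 - k"
    and W_in: "\<And>z q. q \<in> C \<Longrightarrow> W z q \<in> Us"
    and W_smooth: "smooth_rel (UNIV \<times> C) (\<lambda>(z, q). W z q)"
    and W_nonconst: "\<And>q. q \<in> C \<Longrightarrow> \<not> (\<lambda>z. W z q) constant_on UNIV"
    and W_profile: "\<And>z q. q \<in> C \<Longrightarrow>
          (1 + normsq_tan l (sig q)) *\<^sub>R Wzz W z q = Acal l A (W z q) (sig q) *v Wz W z q"
    and W_limits: "\<And>pp pm \<sigma>. (pp, pm, \<sigma>) \<in> C \<Longrightarrow>
          ((\<lambda>z. W z (pp, pm, \<sigma>)) \<longlongrightarrow> pp) at_top \<and> ((\<lambda>z. W z (pp, pm, \<sigma>)) \<longlongrightarrow> pm) at_bot"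
    and q0: "q0 \<in> C" "sig q0 = 0"

definition dAcal :: "'d::finite \<Rightarrow> ('d \<Rightarrow> real^'n \<Rightarrow> real^'n^'n) \<Rightarrow> real^'n \<Rightarrow> real^'d \<Rightarrow>
    complex^'n \<Rightarrow> complex^'n^'n" where
  \<comment> \<open>the complex-linear extension of the differential of \<open>\<lambda>w. Acal l A w \<sigma>\<close>\<close>
  "dAcal l A w \<sigma> u = (\<chi> a b. \<Sum>m\<in>UNIV. u $ m *
     complex_of_real (frechet_derivative (\<lambda>y. Acal l A y \<sigma>) (at w) (axis m 1) $ a $ b))"

text \<open>\<open>Lop \<dots> u0 u1 u2\<close> is \<open>\<L>(z,q,\<zeta>,\<partial>\<^sub>z)u\<close> at \<open>z\<close> for a function with \<open>u = u0\<close>, \<open>u' = u1\<close>,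
  \<open>u'' = u2\<close> there.\<close>
definition Lop :: "'d::finite \<Rightarrow> ('d \<Rightarrow> real^'n \<Rightarrow> real^'n^'n) \<Rightarrow>
    (real \<Rightarrow> ('n, 'd) shock \<Rightarrow> real^'n) \<Rightarrow> ('n, 'd) shock \<Rightarrow> 'd freq \<Rightarrow>
    real \<Rightarrow> complex^'n \<Rightarrow> complex^'n \<Rightarrow> complex^'n \<Rightarrow> complex^'n" where
  "Lop l A W q \<zeta> z u0 u1 u2 =
     (let \<gamma> = fst \<zeta>; \<tau> = snd \<zeta> $ l; \<eta> = snd \<zeta>; \<sigma> = sig q; w = W z q in
      - ((1 + normsq_tan l \<sigma>) *\<^sub>R u2)
      + (cmat (Acal l A w \<sigma>) *v u1 + (2 * (\<Sum>j\<in>- {l}. \<sigma> $ j * \<i> * \<eta> $ j)) *s u1)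
      + dAcal l A w \<sigma> u0 *v cvec (Wz W z q)
      + (\<i> * \<tau> + \<gamma>) *s (cmat (A0 w) *v u0)
      + (\<Sum>j\<in>- {l}. (\<i> * \<eta> $ j) *s (cmat (A j w) *v u0))
      + normsq_tan l \<eta> *\<^sub>R u0)"

definition L1 :: "'d::finite \<Rightarrow> ('d \<Rightarrow> real^'n \<Rightarrow> real^'n^'n) \<Rightarrow>
    (real \<Rightarrow> ('n, 'd) shock \<Rightarrow> real^'n) \<Rightarrow> ('n, 'd) shock \<Rightarrow> 'd freq \<Rightarrow> real \<Rightarrow> complex^'n" where
  "L1 l A W q \<zeta> z =
     (let \<gamma> = fst \<zeta>; \<tau> = snd \<zeta> $ l; \<eta> = snd \<zeta>; \<sigma> = sig q; w = W z q;
          w1 = cvec (Wz W z q); w2 = cvec (Wzz W z q) in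
      (\<i> * \<tau> + \<gamma>) *s (cmat (A0 w) *v w1)
      + (\<Sum>j\<in>- {l}. (\<i> * \<eta> $ j) *s (cmat (A j w) *v w1))
      + (2 * (\<Sum>j\<in>- {l}. \<sigma> $ j * \<i> * \<eta> $ j)) *s w2
      + normsq_tan l \<eta> *\<^sub>R w1)"

definition c0 :: "'d::finite \<Rightarrow> 'd freq \<Rightarrow> complex" where
  "c0 l \<zeta> = \<i> * (snd \<zeta> $ l) + fst \<zeta> + normsq_tan l (snd \<zeta>)"

text \<open>The quotients by \<open>\<rho>\<close>; only \<open>\<rho> > 0\<close> is used below.\<close>
definition L1_check where
  "L1_check l A W q \<zeta>h \<rho> z = (1 / \<rho>) *\<^sub>R L1 l A W q (\<rho> *\<^sub>R \<zeta>h) z"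

definition c0_check :: "'d::finite \<Rightarrow> 'd freq \<Rightarrow> real \<Rightarrow> complex" where
  "c0_check l \<zeta>h \<rho> = c0 l (\<rho> *\<^sub>R \<zeta>h) / \<rho>"

text \<open>\<open>u\<close> solves \<open>\<L>u = f\<close> on the half-line \<open>S\<close> (derivatives at \<open>0\<close> are one-sided) and
  \<open>v = u'\<close>.\<close>
definition solves_on :: "real set \<Rightarrow> 'd::finite \<Rightarrow> ('d \<Rightarrow> real^'n \<Rightarrow> real^'n^'n) \<Rightarrow>
    (real \<Rightarrow> ('n, 'd) shock \<Rightarrow> real^'n) \<Rightarrow> ('n, 'd) shock \<Rightarrow> 'd freq \<Rightarrow>
    (real \<Rightarrow> complex^'n) \<Rightarrow> (real \<Rightarrow> complex^'n) \<Rightarrow> (real \<Rightarrow> complex^'n) \<Rightarrow> bool" where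
  "solves_on S l A W q \<zeta> f u v \<longleftrightarrow>
     (\<exists>a. \<forall>z\<in>S. (u has_vector_derivative v z) (at z within S) \<and>
               (v has_vector_derivative a z) (at z within S) \<and>
               Lop l A W q \<zeta> z (u z) (v z) (a z) = f z)"

definition half_sphere :: "'d::finite freq set" where
  "half_sphere = {\<zeta>h. norm \<zeta>h = 1 \<and> fst \<zeta>h \<ge> 0}"

definition Espace :: "real set \<Rightarrow> 'd::finite \<Rightarrow> ('d \<Rightarrow> real^'n \<Rightarrow> real^'n^'n) \<Rightarrow>
    (real \<Rightarrow> ('n, 'd) shock \<Rightarrow> real^'n) \<Rightarrow> ('n, 'd) shock \<Rightarrow> 'd freq \<Rightarrow> real \<Rightarrow>
    (complex^('n + 'n)) set" where
  "Espace S l A W q \<zeta>h \<rho> =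
     {vjoin (u 0) (v 0) | u v. solves_on S l A W q (\<rho> *\<^sub>R \<zeta>h) (\<lambda>_. 0) u v \<and> bounded (u ` S)}"

definition Ds :: "'d::finite \<Rightarrow> ('d \<Rightarrow> real^'n \<Rightarrow> real^'n^'n) \<Rightarrow>
    (real \<Rightarrow> ('n, 'd) shock \<Rightarrow> real^'n) \<Rightarrow> ('n, 'd) shock \<Rightarrow> 'd freq \<Rightarrow> real \<Rightarrow> complex" where
  "Ds l A W q \<zeta>h \<rho> = det_pair
     {vjoin x y | x y. x \<in> Espace {..0} l A W q \<zeta>h \<rho> \<and> y \<in> Espace {0..} l A W q \<zeta>h \<rho>}
     {vjoin U U | U. True}"

definition standard_uniform_evans where
  "standard_uniform_evans l A W q \<longleftrightarrow>
     (\<exists>c>0. \<exists>\<rho>0>0. \<forall>\<zeta>h\<in>half_sphere. \<forall>\<rho>. 0 < \<rho> \<and> \<rho> \<le> \<rho>0 \<longrightarrow> cmod (Ds l A W q \<zeta>h \<rho>) \<ge> c * \<rho>) \<and>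
     (\<forall>\<zeta>h\<in>half_sphere. \<forall>\<rho>>0. Ds l A W q \<zeta>h \<rho> \<noteq> 0)"

text \<open>A triple \<open>(U\<^sup>-, U\<^sup>+, \<phi>)\<close> is the vector \<open>vjoin (vjoin U\<^sup>- U\<^sup>+) (vec \<phi>)\<close> with
  \<open>vec \<phi> :: complex^unit\<close>.\<close>

definition Emod :: "'d::finite \<Rightarrow> ('d \<Rightarrow> real^'n \<Rightarrow> real^'n^'n) \<Rightarrow>
    (real \<Rightarrow> ('n, 'd) shock \<Rightarrow> real^'n) \<Rightarrow> ('n, 'd) shock \<Rightarrow> 'd freq \<Rightarrow> real \<Rightarrow>
    (complex^((('n + 'n) + ('n + 'n)) + unit)) set" where
  "Emod l A W q \<zeta>h \<rho> =
     {vjoin (vjoin (vjoin (um 0) (vm 0)) (vjoin (up 0) (vp 0))) (vec \<phi>) | um vm up vp \<phi>.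
        solves_on {..0} l A W q (\<rho> *\<^sub>R \<zeta>h) (\<lambda>z. \<phi> *s L1_check l A W q \<zeta>h \<rho> z) um vm \<and>
        bounded (um ` {..0}) \<and>
        solves_on {0..} l A W q (\<rho> *\<^sub>R \<zeta>h) (\<lambda>z. \<phi> *s L1_check l A W q \<zeta>h \<rho> z) up vp \<and>
        bounded (up ` {0..})}"

definition ker_Gamma_mod :: "'d::finite \<Rightarrow> (real \<Rightarrow> ('n, 'd) shock \<Rightarrow> real^'n) \<Rightarrow>
    ('n, 'd) shock \<Rightarrow> 'd freq \<Rightarrow> real \<Rightarrow> (complex^((('n + 'n) + ('n + 'n)) + unit)) set" where
  "ker_Gamma_mod l W q0 \<zeta>h \<rho> =
     {vjoin (vjoin (vjoin u v) (vjoin u v)) (vec \<phi>) | u v \<phi>.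
        (\<Sum>i\<in>UNIV. complex_of_real (Wz W 0 q0 $ i) * u $ i) + c0_check l \<zeta>h \<rho> * \<phi> = 0}"

definition Dmod :: "'d::finite \<Rightarrow> ('d \<Rightarrow> real^'n \<Rightarrow> real^'n^'n) \<Rightarrow>
    (real \<Rightarrow> ('n, 'd) shock \<Rightarrow> real^'n) \<Rightarrow> ('n, 'd) shock \<Rightarrow> ('n, 'd) shock \<Rightarrow>
    'd freq \<Rightarrow> real \<Rightarrow> complex" where
  "Dmod l A W q0 q \<zeta>h \<rho> = det_pair (Emod l A W q \<zeta>h \<rho>) (ker_Gamma_mod l W q0 \<zeta>h \<rho>)"

definition modified_uniform_evans where
  "modified_uniform_evans l A W q0 q \<longleftrightarrow>
     (\<exists>c>0. \<exists>\<rho>0>0. \<forall>\<zeta>h\<in>half_sphere. \<forall>\<rho>. 0 < \<rho> \<and> \<rho> \<le> \<rho>0 \<longrightarrow> cmod (Dmod l A W q0 q \<zeta>h \<rho>) \<ge> c) \<and>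
     (\<forall>\<zeta>h\<in>half_sphere. \<forall>\<rho>>0. Dmod l A W q0 q \<zeta>h \<rho> \<noteq> 0)"

end

theory Submission
  imports Defs "HOL-Computational_Algebra.Fundamental_Theorem_Algebra"
begin

text \<open>
  The derivative \<open>W'\<close> of the profile solves \<open>\<L> u = \<L>\<^sub>1\<close>, since differentiating the profile
  equation in \<open>z\<close> annihilates the part of \<open>\<L>\<close> that does not involve the frequency. Hence every
  bounded solution of the inhomogeneous equation is a bounded solution of the homogeneous one plus
  a multiple of \<open>W' / \<rho>\<close>. With \<open>X = (W'(0), W''(0))\<close> and \<open>E = E\<^sub>- \<times> E\<^sub>+\<close>, the modified space is
  \<open>E \<times> 0\<close> plus the line through \<open>\<psi> = (X, X, \<rho>)\<close>, while the kernel of the modified boundary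
  operator is the hyperplane \<open>\<beta> = 0\<close> in \<open>G\<close>, the diagonal times \<open>\<complex>\<close>, for a bounded functional
  \<open>\<beta>\<close> (\<open>bdry\<close>; see \<open>Emod_eq\<close> and \<open>ker_Gamma_eq\<close>). The two Evans determinants therefore differ in a
  single column, and \<open>det_pair_hyperplane\<close> gives, for every \<open>e\<close> in \<open>E\<close>,
  \<open>\<bar>\<beta> \<psi>\<bar> \<bar>D\<^sub>s\<bar> \<le> L \<bar>\<psi> - e\<bar> \<bar>D\<bar>\<close>, where \<open>D\<close> is the modified determinant and \<open>L\<close> bounds \<open>\<beta>\<close>.
  Here \<open>\<beta> \<psi> = w\<^sub>z(0) \<bullet> W'(0) + i \<tau> + \<gamma> + \<bar>\<eta>\<bar>\<^sup>2\<close> has real part bounded below, because \<open>W'(0)\<close> is close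
  to \<open>w\<^sub>z(0) \<noteq> 0\<close> near the base point. So \<open>D\<close> does not vanish where \<open>D\<^sub>s\<close> does not, and for small
  \<open>\<rho>\<close> the lower bound \<open>c \<rho>\<close> for \<open>D\<^sub>s\<close> becomes a constant lower bound for \<open>D\<close> as soon as \<open>E\<close>
  contains a point at distance \<open>O(\<rho>)\<close> from \<open>\<psi>\<close>.

  Such a point exists because \<open>W'\<close> decays exponentially and is a solution at frequency \<open>0\<close>
  (\<open>Espace_near_profile\<close>). In a space with a small exponential weight the limiting constant
  coefficient system is hyperbolic even at frequency \<open>0\<close>, so that \<open>W'\<close> persists under the
  \<open>O(\<rho>)\<close> change of the coefficients (\<open>bounded_solution_near\<close>).

  The determinant of a pair of subspaces is only meaningful when their dimensions add up, so one
  also has to show that \<open>E\<^sub>\<plusminus>\<close> has dimension \<open>N\<close> for \<open>\<rho> > 0\<close> (\<open>dim_Espace\<close>). The dimension of the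
  space of bounded solutions is unchanged by small perturbations of a hyperbolic constant matrix
  (\<open>bounded_data_dim_perturb\<close>: the operator \<open>d/dz - B\<close> on bounded functions is onto and its kernel
  moves bijectively). Hence it only depends on the limit matrix, and is constant along a homotopy
  of the limit matrices that switches off \<open>A\<^sub>j\<close>; hyperbolicity of the first-order part together with
  the Laplacian keeps the spectrum off the imaginary axis (\<open>hyperbolic_side\<close>). At the end of the
  homotopy there is one scalar quadratic equation with one root on each side.
\<close>

section \<open>Orthonormal families in Hermitian space\<close>

lemma hermitian_add_left: "hermitian (x + y) z = hermitian x z + hermitian y z"
  by (simp add: hermitian_def distrib_right sum.distrib)

lemma hermitian_add_right: "hermitian x (y + z) = hermitian x y + hermitian x z"
  by (simp add: hermitian_def distrib_left sum.distrib)

lemma hermitian_diff_left: "hermitian (x - y) z = hermitian x z - hermitian y z"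
  by (simp add: hermitian_def left_diff_distrib sum_subtractf)

lemma hermitian_scale_left: "hermitian (c *s x) y = c * hermitian x y"
  by (simp add: hermitian_def sum_distrib_left mult.assoc)

lemma hermitian_scale_right: "hermitian x (c *s y) = cnj c * hermitian x y"
  by (simp add: hermitian_def sum_distrib_left mult_ac)

lemma hermitian_zero: "hermitian 0 y = 0" "hermitian x 0 = 0"
  by (auto simp: hermitian_def)

lemma hermitian_sum_left: "hermitian (sum f I) y = (\<Sum>i\<in>I. hermitian (f i) y)"
  by (induct I rule: infinite_finite_induct) (auto simp: hermitian_add_left hermitian_zero)

lemma hermitian_commute: "hermitian y x = cnj (hermitian x y)"
  by (simp add: hermitian_def mult.commute)

lemma hermitian_self: "hermitian x x = complex_of_real ((norm x)\<^sup>2)"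
  by (simp add: hermitian_def norm_vec_def L2_set_def sum_nonneg flip: complex_norm_square)

lemma norm_scale: "norm (c *s x) = cmod c * norm (x :: complex^'n)"
  by (simp add: norm_vec_def norm_mult L2_set_right_distrib)

lemma scaleR_eq_scale: "r *\<^sub>R x = complex_of_real r *s (x :: complex^'n)"
  by (simp add: vec_eq_iff scaleR_conv_of_real[where 'a=complex] del: real_scaleR_def)

definition ortho :: "('i \<Rightarrow> complex^'m) \<Rightarrow> 'i set \<Rightarrow> bool" where
  "ortho f I \<longleftrightarrow> (\<forall>i\<in>I. \<forall>j\<in>I. hermitian (f i) (f j) = (if i = j then 1 else 0))"

definition proj :: "('i \<Rightarrow> complex^'m) \<Rightarrow> 'i set \<Rightarrow> complex^'m \<Rightarrow> complex^'m" where
  "proj f I x = (\<Sum>i\<in>I. hermitian x (f i) *s f i)"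

lemma orthoD: "ortho f I \<Longrightarrow> i \<in> I \<Longrightarrow> j \<in> I \<Longrightarrow> hermitian (f i) (f j) = (if i = j then 1 else 0)"
  by (simp add: ortho_def)

lemma proj_in_span: "proj f I x \<in> vec.span (f ` I)"
  unfolding proj_def by (intro vec.span_sum vec.span_scale vec.span_base) auto

lemma hermitian_sub_proj:
  assumes "ortho f I" "finite I" "j \<in> I"
  shows "hermitian (x - proj f I x) (f j) = 0"
proof -
  have "hermitian (proj f I x) (f j) = (\<Sum>i\<in>I. hermitian x (f i) * (if i = j then 1 else 0))"
    unfolding proj_def hermitian_sum_left hermitian_scale_left
    using assms by (intro sum.cong) (auto simp: orthoD)
  also have "\<dots> = (\<Sum>i\<in>I. if i = j then hermitian x (f i) else 0)"
    by (intro sum.cong) auto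
  also have "\<dots> = hermitian x (f j)"
    using assms(2,3) by (subst sum.delta) auto
  finally show ?thesis by (simp add: hermitian_diff_left)
qed

lemma hermitian_span_zero:
  assumes "\<And>i. i \<in> I \<Longrightarrow> hermitian y (f i) = 0" "z \<in> vec.span (f ` I)"
  shows "hermitian y z = 0"
  using assms(2)
proof (induct rule: vec.span_induct_alt)
  case base
  then show ?case by (simp add: hermitian_zero)
next
  case (step c x y)
  then show ?case using assms(1) by (auto simp: hermitian_add_right hermitian_scale_right)
qed

lemma proj_of_span:
  assumes "ortho f I" "finite I" "x \<in> vec.span (f ` I)"
  shows "proj f I x = x"
proof -
  have "x - proj f I x \<in> vec.span (f ` I)"
    using assms proj_in_span by (intro vec.span_diff) auto
  then have "hermitian (x - proj f I x) (x - proj f I x) = 0"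
    by (rule hermitian_span_zero[rotated]) (auto intro: hermitian_sub_proj assms)
  then show ?thesis by (simp add: hermitian_self)
qed

lemma pythagoras:
  assumes "hermitian x y = 0"
  shows "(norm (x + y))\<^sup>2 = (norm x)\<^sup>2 + (norm y)\<^sup>2"
proof -
  have "hermitian y x = 0" using assms hermitian_commute[of y x] by simp
  then have "complex_of_real ((norm (x + y))\<^sup>2) = complex_of_real ((norm x)\<^sup>2 + (norm y)\<^sup>2)"
    unfolding hermitian_self[symmetric] of_real_add
    by (simp add: hermitian_add_left hermitian_add_right assms)
  then show ?thesis by (simp only: of_real_eq_iff)
qed

lemma norm_sub_proj_le:
  assumes "ortho f I" "finite I" "e \<in> vec.span (f ` I)"
  shows "norm (x - proj f I x) \<le> norm (x - e)"
proof -
  have "proj f I x - e \<in> vec.span (f ` I)"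
    using assms proj_in_span by (intro vec.span_diff) auto
  then have "hermitian (x - proj f I x) (proj f I x - e) = 0"
    by (rule hermitian_span_zero[rotated]) (auto intro: hermitian_sub_proj assms)
  from pythagoras[OF this]
  have "(norm (x - proj f I x))\<^sup>2 \<le> (norm (x - e))\<^sup>2" by simp
  then show ?thesis by (rule power2_le_imp_le) simp
qed

lemma ortho_inj: assumes "ortho f I" shows "inj_on f I"
proof (rule inj_onI)
  fix x y assume a: "x \<in> I" "y \<in> I" "f x = f y"
  have "hermitian (f x) (f x) = 1" using orthoD[OF assms a(1) a(1)] by simp
  then have "hermitian (f x) (f y) = 1" using a by simp
  then show "x = y" using orthoD[OF assms a(1,2)] by (auto split: if_splits)
qed

lemma ortho_independent:
  assumes "ortho f I" "finite I"
  shows "vec.independent (f ` I)"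
proof (rule vec.independent_if_scalars_zero)
  show "finite (f ` I)" using assms by simp
next
  fix c x assume c: "(\<Sum>x\<in>f ` I. c x *s x) = 0" and x: "x \<in> f ` I"
  then obtain j where j: "j \<in> I" "x = f j" by auto
  have "(\<Sum>x\<in>f ` I. c x *s x) = (\<Sum>i\<in>I. c (f i) *s f i)"
    by (rule sum.reindex_cong[OF ortho_inj[OF assms(1)]]) auto
  then have "0 = hermitian (\<Sum>i\<in>I. c (f i) *s f i) (f j)" using c by (simp add: hermitian_zero)
  also have "\<dots> = (\<Sum>i\<in>I. c (f i) * (if i = j then 1 else 0))"
    unfolding hermitian_sum_left hermitian_scale_left
    using assms j by (intro sum.cong) (auto simp: orthoD)
  also have "\<dots> = (\<Sum>i\<in>I. if i = j then c (f i) else 0)"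
    by (intro sum.cong) auto
  also have "\<dots> = c (f j)"
    using assms(2) j(1) by (subst sum.delta) auto
  finally show "c x = 0" using j by simp
qed

lemma ortho_dim:
  assumes "ortho f I" "finite I"
  shows "vec.dim (vec.span (f ` I)) = card I"
  using vec.dim_span_eq_card_independent[OF ortho_independent[OF assms]]
    card_image[OF ortho_inj[OF assms(1)]] by simp

lemma ortho_extend:
  fixes f :: "'i \<Rightarrow> complex^'m"
  assumes "ortho f I" "n \<notin> I" and y: "\<And>i. i \<in> I \<Longrightarrow> hermitian y (f i) = 0" "y \<noteq> 0"
  shows "ortho (f(n := complex_of_real (1 / norm y) *s y)) (insert n I)"
proof -
  let ?e = "complex_of_real (1 / norm y) *s y"
  have 1: "hermitian ?e ?e = 1"
  proof -
    have "norm ?e = 1" using y(2) by (simp add: norm_scale norm_divide)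
    then show ?thesis by (simp only: hermitian_self) simp
  qed
  have 2: "hermitian ?e (f i) = 0" if "i \<in> I" for i
    using y that by (simp add: hermitian_scale_left)
  have 3: "hermitian (f i) ?e = 0" if "i \<in> I" for i
    using 2[OF that] hermitian_commute[of "f i" ?e] by simp
  show ?thesis
    unfolding ortho_def using assms(1,2) 1 2 3 by (auto simp: ortho_def simp del: of_real_divide)
qed

text \<open>Gram--Schmidt.\<close>

lemma orthonormal_basis_exists:
  fixes E :: "(complex^'m) set"
  assumes E: "vec.subspace E"
  obtains f :: "nat \<Rightarrow> complex^'m"
  where "ortho f {..<vec.dim E}" "vec.span (f ` {..<vec.dim E}) = E"
proof -
  have "n \<le> vec.dim E \<Longrightarrow> \<exists>f :: nat \<Rightarrow> complex^'m. ortho f {..<n} \<and> f ` {..<n} \<subseteq> E" for n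
  proof (induct n)
    case 0
    then show ?case by (auto simp: ortho_def)
  next
    case (Suc n)
    then obtain f :: "nat \<Rightarrow> complex^'m" where f: "ortho f {..<n}" "f ` {..<n} \<subseteq> E" by auto
    let ?S = "vec.span (f ` {..<n})"
    have S: "?S \<subseteq> E" using f E by (simp add: vec.span_minimal)
    have "vec.dim ?S = n" using ortho_dim[OF f(1)] by simp
    then have "?S \<noteq> E" using Suc.prems by auto
    then obtain x where x: "x \<in> E" "x \<notin> ?S" using S by auto
    define y where "y = x - proj f {..<n} x"
    have p: "proj f {..<n} x \<in> ?S" by (rule proj_in_span)
    have "y \<noteq> 0" using p x unfolding y_def by auto
    moreover have "y \<in> E" unfolding y_def using p S x E by (auto intro: vec.subspace_diff)
    ultimately have "ortho (f(n := complex_of_real (1 / norm y) *s y)) {..<Suc n}"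
      using f(1) hermitian_sub_proj[OF f(1)] ortho_extend[OF f(1), of n y]
      unfolding y_def lessThan_Suc by auto
    moreover have "(f(n := complex_of_real (1 / norm y) *s y)) ` {..<Suc n} \<subseteq> E"
      using f(2) \<open>y \<in> E\<close> E by (auto simp: less_Suc_eq intro: vec.subspace_scale)
    ultimately show ?case by blast
  qed
  then obtain f :: "nat \<Rightarrow> complex^'m"
    where f: "ortho f {..<vec.dim E}" "f ` {..<vec.dim E} \<subseteq> E" by blast
  have "vec.span (f ` {..<vec.dim E}) \<subseteq> E" using f E by (simp add: vec.span_minimal)
  moreover have "vec.dim (vec.span (f ` {..<vec.dim E})) = vec.dim E"
    using ortho_dim[OF f(1)] by simp
  ultimately have "vec.span (f ` {..<vec.dim E}) = E"
    using E by (metis vec.subspace_dim_equal vec.subspace_span order_refl)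
  then show ?thesis using that f by blast
qed

section \<open>The determinant of a pair of subspaces\<close>

lemma cols_onb_iff: "cols_onb M I E \<longleftrightarrow> ortho (\<lambda>i. column i M) I \<and> vec.span ((\<lambda>i. column i M) ` I) = E"
  by (simp add: cols_onb_def ortho_def)

lemma cols_onb_columns:
  fixes h :: "nat \<Rightarrow> complex^'m" and p :: "'m \<Rightarrow> nat"
  assumes "bij_betw p I J" "ortho h J" "vec.span (h ` J) = E"
  shows "cols_onb (\<chi> r c. h (p c) $ r) I E"
proof -
  have c: "column i (\<chi> r c. h (p c) $ r) = h (p i)" for i
    by (simp add: column_def vec_eq_iff)
  have "(\<lambda>i. h (p i)) ` I = h ` J"
    using assms(1) by (metis bij_betw_imp_surj_on image_image)
  moreover have "ortho (\<lambda>i. h (p i)) I"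
    using assms(1,2) unfolding ortho_def bij_betw_def inj_on_def by fastforce
  ultimately show ?thesis using assms(3) by (simp add: cols_onb_iff c)
qed

lemma cmod_det_unitary:
  fixes Q :: "complex^'m^'m"
  assumes "\<And>j k. hermitian (column j Q) (column k Q) = (if j = k then 1 else 0)"
  shows "cmod (det Q) = 1"
proof -
  define R :: "complex^'m^'m" where "R = (\<chi> i j. cnj (Q $ j $ i))"
  have "(R ** Q) $ j $ k = (mat 1 :: complex^'m^'m) $ j $ k" for j k
  proof -
    have "(R ** Q) $ j $ k = hermitian (column k Q) (column j Q)"
      by (simp add: R_def matrix_matrix_mult_def hermitian_def column_def mult.commute)
    then show ?thesis by (auto simp: assms mat_def)
  qed
  then have "R ** Q = mat 1" by (simp add: vec_eq_iff)
  then have 1: "det R * det Q = 1" by (metis det_mul det_I)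
  have "det R = det (\<chi> i j. cnj (transpose Q $ i $ j))" by (simp add: R_def transpose_def)
  also have "\<dots> = cnj (det (transpose Q))"
    by (simp add: det_def)
  finally have "det R = cnj (det Q)" by simp
  then have "cmod (det Q) * cmod (det Q) = 1"
    using 1 by (metis complex_mod_cnj norm_mult norm_one)
  then show ?thesis using norm_ge_zero[of "det Q"]
    by (simp add: square_eq_1_iff)
qed

text \<open>The transition matrix between two choices of bases is unitary, so the modulus does not
  depend on the choice.\<close>

lemma cmod_det_cols_onb_unique:
  fixes M M' :: "complex^'m^'m"
  assumes M: "cols_onb M I E" "cols_onb M (- I) F"
    and M': "cols_onb M' I' E" "cols_onb M' (- I') F"
  shows "cmod (det M) = cmod (det M')"
proof -
  let ?f = "\<lambda>i. column i M" and ?g = "\<lambda>i. column i M'"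
  define Q :: "complex^'m^'m" where
    "Q = (\<chi> i j. if i \<in> I \<longleftrightarrow> j \<in> I' then hermitian (?g j) (?f i) else 0)"
  define B where "B j = (if j \<in> I' then I else - I)" for j
  have B: "i \<in> B j \<longleftrightarrow> (i \<in> I \<longleftrightarrow> j \<in> I')" for i j by (auto simp: B_def)
  have oB: "ortho ?f (B j)" and gB: "?g j \<in> vec.span (?f ` B j)" for j
  proof -
    show "ortho ?f (B j)" using M by (auto simp: B_def cols_onb_iff)
    have "?g j \<in> vec.span (?g ` (if j \<in> I' then I' else - I'))" by (intro vec.span_base) auto
    then show "?g j \<in> vec.span (?f ` B j)" using M M' by (auto simp: B_def cols_onb_iff split: if_splits)
  qed
  have exp: "?g j = (\<Sum>i\<in>UNIV. Q $ i $ j *s ?f i)" for j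
  proof -
    have "?g j = proj ?f (B j) (?g j)" using proj_of_span[OF oB _ gB] by simp
    also have "\<dots> = (\<Sum>i\<in>UNIV. if i \<in> B j then hermitian (?g j) (?f i) *s ?f i else 0)"
      unfolding proj_def by (simp add: sum.If_cases)
    also have "\<dots> = (\<Sum>i\<in>UNIV. Q $ i $ j *s ?f i)"
      by (intro sum.cong) (auto simp: Q_def B)
    finally show ?thesis .
  qed
  have "M' = M ** Q"
  proof -
    have "M' $ r $ c = (M ** Q) $ r $ c" for r c
    proof -
      have "M' $ r $ c = ?g c $ r" by (simp add: column_def)
      also have "\<dots> = (\<Sum>i\<in>UNIV. Q $ i $ c * M $ r $ i)"
        by (subst exp) (simp add: column_def)
      finally show ?thesis by (simp add: matrix_matrix_mult_def mult.commute)
    qed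
    then show ?thesis by (simp add: vec_eq_iff)
  qed
  moreover have "cmod (det Q) = 1"
  proof (rule cmod_det_unitary)
    fix j k
    show "hermitian (column j Q) (column k Q) = (if j = k then 1 else 0)"
    proof (cases "j \<in> I' \<longleftrightarrow> k \<in> I'")
      case True
      then have BB: "B j = B k" by (auto simp: B_def)
      have "hermitian (?g j) (?g k) = hermitian (proj ?f (B j) (?g j)) (?g k)"
        using proj_of_span[OF oB _ gB] by simp
      also have "\<dots> = (\<Sum>i\<in>B j. hermitian (?g j) (?f i) * cnj (hermitian (?g k) (?f i)))"
        unfolding proj_def hermitian_sum_left hermitian_scale_left
        by (intro sum.cong refl) (metis hermitian_commute)
      also have "\<dots> = (\<Sum>i\<in>UNIV. if i \<in> B j then hermitian (?g j) (?f i) * cnj (hermitian (?g k) (?f i)) else 0)"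
        by (simp add: sum.If_cases)
      also have "\<dots> = hermitian (column j Q) (column k Q)"
        unfolding hermitian_def[of "column j Q"] using True
        by (intro sum.cong) (auto simp: Q_def column_def B)
      finally have "hermitian (column j Q) (column k Q) = hermitian (?g j) (?g k)" ..
      also have "\<dots> = (if j = k then 1 else 0)"
        using True M' orthoD[of ?g I' j k] orthoD[of ?g "-I'" j k]
        by (cases "j \<in> I'") (auto simp: cols_onb_iff)
      finally show ?thesis .
    next
      case False
      have z: "Q $ i $ j * cnj (Q $ i $ k) = 0" for i using False by (auto simp: Q_def)
      show ?thesis using False unfolding hermitian_def column_def by (auto simp: z)
    qed
  qed
  ultimately show ?thesis by (simp add: det_mul norm_mult)
qed

lemma cmod_det_pair:
  assumes "cols_onb M I E" "cols_onb M (- I) F"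
  shows "cmod (det_pair E F) = cmod (det M)"
proof -
  define P where "P M \<longleftrightarrow> (\<exists>I. cols_onb M I E \<and> cols_onb M (- I) F)" for M
  have "P M" using assms by (auto simp: P_def)
  then have "P (SOME M. P M)" by (rule someI)
  then obtain J where "cols_onb (SOME M. P M) J E" "cols_onb (SOME M. P M) (- J) F"
    by (auto simp: P_def)
  then have "cmod (det (SOME M. P M)) = cmod (det M)"
    using cmod_det_cols_onb_unique assms by blast
  then show ?thesis by (simp add: det_pair_def P_def)
qed

lemma bij_to_initial_segment:
  obtains p :: "'m::finite \<Rightarrow> nat" where "bij_betw p UNIV {..<CARD('m)}"
  using ex_bij_betw_finite_nat[of "UNIV :: 'm set"] by (auto simp: lessThan_atLeast0)

text \<open>An orthonormal basis of \<open>E\<close> followed by one of \<open>F\<close>, listed as one sequence \<open>h\<close>; \<open>p\<close> enumerates the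
  index type.\<close>

lemma cols_onb_split:
  fixes h :: "nat \<Rightarrow> complex^'m"
  assumes p: "bij_betw p UNIV {..<CARD('m)}" and a: "a \<le> CARD('m)"
    and "ortho h {..<a}" "ortho h {a..<CARD('m)}"
  shows "cols_onb (\<chi> r c. h (p c) $ r) {c. p c < a} (vec.span (h ` {..<a}))"
    and "cols_onb (\<chi> r c. h (p c) $ r) (- {c. p c < a}) (vec.span (h ` {a..<CARD('m)}))"
proof -
  have b1: "bij_betw p {c. p c < a} {..<a}" and b2: "bij_betw p (- {c. p c < a}) {a..<CARD('m)}"
  proof -
    have i: "inj_on p A" for A using p by (meson bij_betw_imp_inj_on inj_on_subset subset_UNIV)
    have s: "range p = {..<CARD('m)}" using p by (simp add: bij_betw_def)
    have "p ` {c. p c < a} = {..<a}"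
    proof (intro equalityI subsetI)
      fix n assume "n \<in> {..<a}"
      then have "n \<in> range p" using a s by auto
      then show "n \<in> p ` {c. p c < a}" using \<open>n \<in> {..<a}\<close> by auto
    qed auto
    moreover have "p ` (- {c. p c < a}) = {a..<CARD('m)}"
    proof (intro equalityI subsetI)
      fix n assume "n \<in> {a..<CARD('m)}"
      then have "n \<in> range p" using s by auto
      then show "n \<in> p ` (- {c. p c < a})" using \<open>n \<in> {a..<CARD('m)}\<close> by auto
    next
      fix n assume "n \<in> p ` (- {c. p c < a})"
      then obtain c where "n = p c" "\<not> p c < a" by auto
      moreover have "p c < CARD('m)" using s by auto
      ultimately show "n \<in> {a..<CARD('m)}" by auto
    qed
    ultimately show "bij_betw p {c. p c < a} {..<a}" "bij_betw p (- {c. p c < a}) {a..<CARD('m)}"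
      using i by (auto simp: bij_betw_def)
  qed
  show "cols_onb (\<chi> r c. h (p c) $ r) {c. p c < a} (vec.span (h ` {..<a}))"
    by (rule cols_onb_columns[OF b1]) (use assms in auto)
  show "cols_onb (\<chi> r c. h (p c) $ r) (- {c. p c < a}) (vec.span (h ` {a..<CARD('m)}))"
    by (rule cols_onb_columns[OF b2]) (use assms in auto)
qed

lemma ortho_shift:
  "ortho g {..<b} \<Longrightarrow> ortho (\<lambda>n. if n < a then f n else g (n - a)) {a..<a + (b :: nat)}"
  unfolding ortho_def by fastforce

lemma shift_image: "(\<lambda>n. if n < a then f n else g (n - a)) ` {a..<a + b} = g ` {..<(b::nat)}"
proof (intro equalityI subsetI)
  fix x assume "x \<in> g ` {..<b}"
  then obtain n where "n < b" "x = g n" by auto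
  then show "x \<in> (\<lambda>n. if n < a then f n else g (n - a)) ` {a..<a + b}"
    by (intro image_eqI[where x = "n + a"]) auto
next
  fix x assume "x \<in> (\<lambda>n. if n < a then f n else g (n - a)) ` {a..<a + b}"
  then show "x \<in> g ` {..<b}" by force
qed

text \<open>Complementary dimensions guarantee that the choice in \<open>det_pair\<close> is not vacuous.\<close>

lemma cols_onb_exists:
  fixes E F :: "(complex^'m) set"
  assumes "vec.subspace E" "vec.subspace F" "vec.dim E + vec.dim F = CARD('m)"
  shows "\<exists>M I. cols_onb M I E \<and> cols_onb M (- I) F"
proof -
  obtain f g where f: "ortho f {..<vec.dim E}" "vec.span (f ` {..<vec.dim E}) = E"
    and g: "ortho g {..<vec.dim F}" "vec.span (g ` {..<vec.dim F}) = F"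
    using orthonormal_basis_exists assms by metis
  obtain p :: "'m \<Rightarrow> nat" where p: "bij_betw p UNIV {..<CARD('m)}" using bij_to_initial_segment .
  let ?a = "vec.dim E"
  let ?h = "\<lambda>n. if n < ?a then f n else g (n - ?a)"
  have 1: "ortho ?h {..<?a}" using f(1) by (auto simp: ortho_def)
  have 2: "ortho ?h {?a..<CARD('m)}" using ortho_shift[OF g(1), of ?a f] assms(3) by simp
  have 3: "?h ` {..<?a} = f ` {..<?a}" by (intro image_cong) auto
  have 4: "?h ` {?a..<CARD('m)} = g ` {..<vec.dim F}"
    using shift_image[of ?a f g "vec.dim F"] assms(3) by simp
  show ?thesis using cols_onb_split[OF p _ 1 2] f(2) g(2) assms(3) 3 4 by auto
qed

lemma det_replace_column:
  fixes g :: "'m \<Rightarrow> complex^'m" and j0 :: 'm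
  defines "D \<equiv> \<lambda>x. det (\<chi> r c. (if c = j0 then x else g c) $ r)"
  shows det_replace_column_scale: "D (k *s x) = k * D x"
    and det_replace_column_add: "z \<in> vec.span (g ` (- {j0})) \<Longrightarrow> D (x + z) = D x"
proof -
  have D: "D x = det (\<chi> c. if c = j0 then x else g c)" for x
  proof -
    have "(\<chi> r c. (if c = j0 then x else g c) $ r) = transpose (\<chi> c. if c = j0 then x else g c)"
      by (simp add: transpose_def vec_eq_iff)
    then show ?thesis by (simp add: D_def)
  qed
  show "D (k *s x) = k * D x" unfolding D using det_row_mul[of j0 k "\<lambda>_. x" g] by simp
  assume z: "z \<in> vec.span (g ` (- {j0}))"
  define M :: "complex^'m^'m" where "M = (\<chi> c. if c = j0 then x else g c)"
  have r: "row j M = (if j = j0 then x else g j)" for j by (simp add: M_def row_def vec_eq_iff)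
  have "{row j M |j. j \<noteq> j0} = g ` (- {j0})" by (auto simp: r)
  then have "z \<in> vec.span {row j M |j. j \<noteq> j0}" using z by simp
  from det_row_span[OF this]
  have "det (\<chi> k. if k = j0 then x + z else row k M) = det M" by (simp only: r simp_thms if_True)
  moreover have "(\<chi> k. if k = j0 then x + z else row k M) = (\<chi> k. if k = j0 then x + z else g k)"
    unfolding r by (auto simp: r vec_eq_iff)
  ultimately show "D (x + z) = D x" unfolding D M_def by simp
qed

text \<open>Choose an orthonormal basis of \<open>G\<close> that consists of one of the hyperplane \<open>K\<close> and the unit normal
  \<open>n\<close> of \<open>K\<close>. Passing from \<open>(E, G)\<close> to \<open>(E + \<complex>\<psi>, K)\<close> then replaces the single column \<open>n\<close> by
  the direction of \<open>y\<close>, the part of \<open>\<psi>\<close> orthogonal to \<open>E\<close>. As \<open>\<psi> = y\<close> modulo \<open>E\<close> and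
  \<open>\<psi> = \<bar>\<nu>\<bar> n\<close> modulo \<open>K\<close>, the ratio of the determinants is \<open>\<bar>\<nu>\<bar> / \<bar>y\<bar>\<close>, where
  \<open>\<bar>\<beta> \<psi>\<bar> = \<bar>\<beta> \<nu>\<bar> \<le> L \<bar>\<nu>\<bar>\<close> and \<open>\<bar>y\<bar> \<le> \<bar>\<psi> - e0\<bar>\<close>.\<close>

lemma det_pair_hyperplane:
  fixes E G :: "(complex^'m) set" and \<psi> e0 :: "complex^'m" and \<beta> :: "complex^'m \<Rightarrow> complex"
  assumes E: "vec.subspace E" and G: "vec.subspace G" and dims: "vec.dim E + vec.dim G = CARD('m)"
    and \<psi>: "\<psi> \<in> G" "\<beta> \<psi> \<noteq> 0" and e0: "e0 \<in> E"
    and \<beta>: "\<And>x y. \<beta> (x + y) = \<beta> x + \<beta> y" "\<And>c x. \<beta> (c *s x) = c * \<beta> x"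
    and L: "\<And>g. g \<in> G \<Longrightarrow> cmod (\<beta> g) \<le> L * norm g"
  shows "cmod (\<beta> \<psi>) * cmod (det_pair E G) \<le>
    L * norm (\<psi> - e0) * cmod (det_pair {e + c *s \<psi> | e c. e \<in> E} {g \<in> G. \<beta> g = 0})"
proof -
  define K where "K = {g \<in> G. \<beta> g = 0}"
  have \<beta>0: "\<beta> 0 = 0" using \<beta>(2)[of 0 0] by simp
  have K: "vec.subspace K"
    using G unfolding K_def vec.subspace_def by (auto simp: \<beta> \<beta>0)
  obtain f where f: "ortho f {..<vec.dim E}" "vec.span (f ` {..<vec.dim E}) = E"
    using orthonormal_basis_exists[OF E] by metis
  define a where "a = vec.dim E"
  obtain k where k: "ortho k {..<vec.dim K}" "vec.span (k ` {..<vec.dim K}) = K"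
    using orthonormal_basis_exists[OF K] by metis
  define b where "b = vec.dim K"
  note f = f[folded a_def] and k = k[folded b_def]
  define pK where "pK = proj k {..<b} \<psi>"
  define \<nu> where "\<nu> = \<psi> - pK"
  define n where "n = complex_of_real (1 / norm \<nu>) *s \<nu>"
  have pK: "pK \<in> K" unfolding pK_def using proj_in_span k(2) by metis
  have \<nu>0: "\<nu> \<noteq> 0" using pK \<psi> by (auto simp: \<nu>_def K_def)
  have \<nu>n: "\<nu> = complex_of_real (norm \<nu>) *s n" using \<nu>0 by (simp add: n_def)
  have \<nu>G: "\<nu> \<in> G" using \<psi> pK G by (auto simp: \<nu>_def K_def intro: vec.subspace_diff)
  have nG: "n \<in> G" unfolding n_def using \<nu>G G by (rule vec.subspace_scale[rotated])
  define k' where "k' = k(b := n)"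
  have k': "ortho k' {..<Suc b}"
    unfolding k'_def n_def lessThan_Suc
    using hermitian_sub_proj[OF k(1)] \<nu>0 by (intro ortho_extend k) (auto simp: \<nu>_def pK_def)
  have k'_img: "k' ` {..<b} = k ` {..<b}" "k' ` {..<Suc b} = insert n (k ` {..<b})"
    by (auto simp: k'_def less_Suc_eq)
  have k'_span: "vec.span (k' ` {..<Suc b}) = G"
  proof
    have "k ` {..<b} \<subseteq> K" using k(2) vec.span_superset[of "k ` {..<b}"] by simp
    then show "vec.span (k' ` {..<Suc b}) \<subseteq> G"
      unfolding k'_img using nG G by (intro vec.span_minimal) (auto simp: K_def)
    show "G \<subseteq> vec.span (k' ` {..<Suc b})"
    proof
      fix g assume g: "g \<in> G"
      define r where "r = \<beta> g / \<beta> \<psi>"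
      have m: "\<beta> (g - r *s \<psi>) = 0"
      proof -
        have "\<beta> ((g - r *s \<psi>) + r *s \<psi>) = \<beta> (g - r *s \<psi>) + r * \<beta> \<psi>" by (simp only: \<beta>)
        then show ?thesis using \<psi>(2) by (simp add: r_def)
      qed
      let ?S = "vec.span (k' ` {..<Suc b})"
      have KS: "K \<subseteq> ?S"
        unfolding k(2)[symmetric] k'_img by (intro vec.span_mono) auto
      have "g - r *s \<psi> \<in> K"
        using m g \<psi> G by (auto simp: K_def intro: vec.subspace_diff vec.subspace_scale)
      moreover have "n \<in> ?S" unfolding k'_img by (simp add: vec.span_base)
      then have "\<nu> \<in> ?S" using \<nu>n vec.span_scale by metis
      then have "\<nu> + pK \<in> ?S" using pK KS by (intro vec.span_add) auto
      then have "\<psi> \<in> ?S" by (simp add: \<nu>_def)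
      ultimately have "(g - r *s \<psi>) + r *s \<psi> \<in> ?S"
        using KS by (intro vec.span_add vec.span_scale) auto
      then show "g \<in> ?S" by simp
    qed
  qed
  have "vec.dim G = Suc b" using ortho_dim[OF k'] k'_span by simp
  then have card: "Suc b + a = CARD('m)" using dims by (simp add: a_def)
  define h where "h i = (if i < Suc b then k' i else f (i - Suc b))" for i
  have h1: "ortho h {..<Suc b}" using k' by (auto simp: ortho_def h_def)
  have h2: "ortho h {Suc b..<CARD('m)}" using ortho_shift[OF f(1), of "Suc b" k'] card by (simp add: h_def[abs_def])
  have h3: "h ` {..<Suc b} = k' ` {..<Suc b}" by (intro image_cong) (auto simp: h_def)
  have h4: "h ` {Suc b..<CARD('m)} = f ` {..<a}"
    using shift_image[of "Suc b" k' f a] card by (simp add: h_def[abs_def])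
  have hb: "h b = n" by (simp add: h_def k'_def)
  obtain p :: "'m \<Rightarrow> nat" where p: "bij_betw p UNIV {..<CARD('m)}" using bij_to_initial_segment .
  have "b \<in> range p" using p card by (auto simp: bij_betw_def)
  then obtain j0 where j0: "p j0 = b" by auto
  have pinj: "p c = b \<longleftrightarrow> c = j0" for c using p j0 by (metis bij_betw_def inj_eq)
  define D where "D x = det (\<chi> r c. (if c = j0 then x else h (p c)) $ r)" for x
  note D_scale = det_replace_column_scale[of j0 _ _ "\<lambda>c. h (p c)", folded D_def]
  note D_add = det_replace_column_add[of _ "\<lambda>c. h (p c)" j0, folded D_def]
  have others: "(\<lambda>c. h (p c)) ` (- {j0}) = k ` {..<b} \<union> f ` {..<a}"
  proof -
    have "p ` (- {j0}) = {..<CARD('m)} - {b}"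
      using p j0 by (auto simp: bij_betw_def inj_on_def)
    then have "(\<lambda>c. h (p c)) ` (- {j0}) = h ` ({..<CARD('m)} - {b})"
      by (metis image_image)
    also have "{..<CARD('m)} - {b} = {..<b} \<union> {Suc b..<CARD('m)}" using card by auto
    also have "h ` \<dots> = h ` {..<b} \<union> f ` {..<a}" using h4 by (simp add: image_Un)
    also have "h ` {..<b} = k ` {..<b}" by (intro image_cong) (auto simp: h_def k'_def)
    finally show ?thesis .
  qed
  have EG: "cmod (det_pair E G) = cmod (D n)"
  proof -
    have "(\<chi> r c. (if c = j0 then n else h (p c)) $ r) = (\<chi> r c. h (p c) $ r)"
      by (auto simp: vec_eq_iff j0 hb)
    then have "D n = det (\<chi> r c. h (p c) $ r)" by (simp add: D_def)
    moreover note cols_onb_split[OF p _ h1 h2]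
    ultimately show ?thesis
      using cmod_det_pair[of "\<chi> r c. h (p c) $ r" "- {c. p c < Suc b}" E G] card
      by (simp add: h3 h4 k'_span f(2))
  qed
  define pE where "pE = proj f {..<a} \<psi>"
  define y where "y = \<psi> - pE"
  have pE: "pE \<in> E" unfolding pE_def using proj_in_span f(2) by metis
  have kf: "K \<subseteq> vec.span ((\<lambda>c. h (p c)) ` (- {j0}))" "E \<subseteq> vec.span ((\<lambda>c. h (p c)) ` (- {j0}))"
    unfolding others f(2)[symmetric] k(2)[symmetric] by (intro vec.span_mono; auto)+
  have Dy: "D y = complex_of_real (norm \<nu>) * D n"
  proof -
    have "D y = D (\<psi> + (- 1) *s pE)" by (simp add: y_def)
    also have "\<dots> = D \<psi>" using kf pE by (intro D_add vec.span_scale) auto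
    also have "\<dots> = D (\<nu> + pK)" by (simp add: \<nu>_def)
    also have "\<dots> = D \<nu>" using kf pK by (intro D_add) auto
    also have "\<dots> = complex_of_real (norm \<nu>) * D n" by (subst \<nu>n) (rule D_scale)
    finally show ?thesis .
  qed
  have y_le: "norm y \<le> norm (\<psi> - e0)"
    unfolding y_def pE_def using f e0 by (intro norm_sub_proj_le) auto
  have l_le: "cmod (\<beta> \<psi>) \<le> L * norm \<nu>"
  proof -
    have "\<beta> \<psi> = \<beta> (\<nu> + pK)" by (simp add: \<nu>_def)
    also have "\<dots> = \<beta> \<nu>" using pK by (simp only: \<beta>) (simp add: K_def)
    finally show ?thesis using L[OF \<nu>G] by simp
  qed
  have L0: "L \<ge> 0"
  proof (rule ccontr)
    assume "\<not> L \<ge> 0"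
    then have "L * norm \<nu> \<le> 0" by (simp add: mult_nonpos_nonneg)
    then have "cmod (\<beta> \<psi>) \<le> 0" using l_le by linarith
    then show False using \<psi>(2) by simp
  qed
  have *: "norm \<nu> * cmod (D n) \<le> norm (\<psi> - e0) * cmod (det_pair {e + c *s \<psi> | e c. e \<in> E} K)"
  proof (cases "y = 0")
    case True
    then have "D y = 0" using D_scale[of 0 0] by simp
    then show ?thesis using Dy \<nu>0 by simp
  next
    case False
    define e where "e = complex_of_real (1 / norm y) *s y"
    have ye: "y = complex_of_real (norm y) *s e" using False by (simp add: e_def)
    have yf: "hermitian y (h i) = 0" if "i \<in> {Suc b..<CARD('m)}" for i
      using that card hermitian_sub_proj[OF f(1)] by (auto simp: y_def pE_def h_def)
    have o: "ortho (h(b := e)) {b..<CARD('m)}"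
    proof -
      have "{b..<CARD('m)} = insert b {Suc b..<CARD('m)}" using card by auto
      then show ?thesis unfolding e_def using yf False ortho_extend[OF h2, of b y] by simp
    qed
    have o': "ortho (h(b := e)) {..<b}" using k' by (auto simp: ortho_def h_def)
    have img': "(h(b := e)) ` {..<b} = k ` {..<b}" by (intro image_cong) (auto simp: h_def k'_def)
    have img: "(h(b := e)) ` {b..<CARD('m)} = insert e (f ` {..<a})"
    proof -
      have "{b..<CARD('m)} = insert b {Suc b..<CARD('m)}" using card by auto
      moreover have "(h(b := e)) ` {Suc b..<CARD('m)} = h ` {Suc b..<CARD('m)}"
        by (intro image_cong) auto
      ultimately show ?thesis using h4 by (metis fun_upd_same image_insert)
    qed
    have sp: "vec.span (insert e (f ` {..<a})) = {e + c *s \<psi> | e c. e \<in> E}"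
    proof (intro equalityI subsetI)
      fix x assume "x \<in> vec.span (insert e (f ` {..<a}))"
      then obtain c where c: "x - c *s e \<in> E" unfolding vec.span_insert f(2) by auto
      let ?d = "c * complex_of_real (1 / norm y)"
      have "x = (x - c *s e - ?d *s pE) + ?d *s \<psi>"
        by (simp add: e_def y_def vec.scale_right_diff_distrib)
      moreover have "x - c *s e - ?d *s pE \<in> E"
        by (rule vec.subspace_diff[OF E c vec.subspace_scale[OF E pE]])
      ultimately show "x \<in> {e + c *s \<psi> | e c. e \<in> E}" by blast
    next
      fix x assume "x \<in> {e + c *s \<psi> | e c. e \<in> E}"
      then obtain e' c where x: "x = e' + c *s \<psi>" "e' \<in> E" by auto
      have "x - (c * norm y) *s e = e' + c *s pE"
      proof -
        have "(c * norm y) *s e = c *s y" using ye by (metis vec.scale_scale)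
        then show ?thesis by (simp add: x(1) y_def vec.scale_right_diff_distrib)
      qed
      also have "\<dots> \<in> E" using x pE E by (intro vec.subspace_add vec.subspace_scale) auto
      finally show "x \<in> vec.span (insert e (f ` {..<a}))" unfolding vec.span_insert f(2) by blast
    qed
    have "(\<chi> r c. (if c = j0 then e else h (p c)) $ r) = (\<chi> r c. (h(b := e)) (p c) $ r)"
      by (auto simp: vec_eq_iff pinj)
    then have De: "D e = det (\<chi> r c. (h(b := e)) (p c) $ r)" by (simp add: D_def)
    have "cmod (det_pair {e + c *s \<psi> | e c. e \<in> E} K) = cmod (D e)"
      using cols_onb_split[OF p _ o' o] card unfolding De img img' sp k(2)
      by (intro cmod_det_pair[where I = "- {c. p c < b}"]) auto
    moreover have "D y = complex_of_real (norm y) * D e" by (subst ye) (rule D_scale)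
    then have "norm \<nu> * cmod (D n) = norm y * cmod (D e)"
      using Dy by (metis norm_mult norm_of_real abs_norm_cancel)
    ultimately show ?thesis using y_le by (simp add: mult_right_mono)
  qed
  have "cmod (\<beta> \<psi>) * cmod (det_pair E G) \<le> L * norm \<nu> * cmod (D n)"
    unfolding EG using l_le by (intro mult_right_mono) auto
  also have "\<dots> \<le> L * (norm (\<psi> - e0) * cmod (det_pair {e + c *s \<psi> | e c. e \<in> E} K))"
    using mult_left_mono[OF * L0] by (simp add: mult.assoc)
  finally show ?thesis by (simp add: K_def mult.assoc)
qed

text \<open>If the columns of \<open>M\<close> are bases of \<open>E\<close> and \<open>F\<close>, those of \<open>bordered M\<close> are bases of \<open>E \<times> 0\<close> and
  \<open>F \<times> \<complex>\<close>.\<close>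

definition bordered :: "complex^'m^'m \<Rightarrow> complex^('m + unit)^('m + unit)" where
  "bordered M = (\<chi> i j. case i of
      Inl a \<Rightarrow> (case j of Inl b \<Rightarrow> M $ a $ b | Inr _ \<Rightarrow> 0)
    | Inr _ \<Rightarrow> (case j of Inl _ \<Rightarrow> 0 | Inr _ \<Rightarrow> 1))"

text \<open>Only the permutations that fix the new index contribute to the Leibniz formula.\<close>

lemma det_bordered: "det (bordered M) = det (M :: complex^'m^'m)"
proof -
  let ?P = "{p. p permutes (UNIV :: ('m + unit) set)}"
  let ?Q = "{p. p permutes (UNIV :: 'm set)}"
  let ?h = "map_permutation UNIV Inl :: ('m \<Rightarrow> 'm) \<Rightarrow> 'm + unit \<Rightarrow> 'm + unit"
  let ?t = "\<lambda>p. of_int (sign p) * (\<Prod>i\<in>UNIV. bordered M $ i $ p i)"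
  have h1: "?h p (Inl i) = Inl (p i)" and h2: "?h p (Inr u) = Inr u" for p i u
    by (auto simp: map_permutation_apply) (auto simp: map_permutation_def restrict_id_def)
  have hP: "?h p permutes UNIV" if "p permutes UNIV" for p
  proof -
    have "?h p permutes range Inl"
      using that by (intro map_permutation_permutes) (auto simp: bij_betw_def)
    then show ?thesis by (rule permutes_subset) auto
  qed
  have UN: "(UNIV :: ('m + unit) set) = insert (Inr ()) (range Inl)"
    by (auto simp: UNIV_sum)
  have inj: "inj_on ?h ?Q"
  proof (rule inj_onI)
    fix p q assume "?h p = ?h q"
    then have "Inl (p i) = (Inl (q i) :: 'm + unit)" for i using h1 by metis
    then show "p = q" by auto
  qed
  have "sum ?t ?P = sum ?t (?h ` ?Q)"
  proof (rule sum.mono_neutral_right)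
    show "finite ?P" by (simp add: finite_permutations)
    show "?h ` ?Q \<subseteq> ?P" using hP by auto
    show "\<forall>p\<in>?P - ?h ` ?Q. ?t p = 0"
    proof
      fix p assume p: "p \<in> ?P - ?h ` ?Q"
      show "?t p = 0"
      proof (cases "p (Inr ()) = Inr ()")
        case True
        have pp: "bij p" using p permutes_bij by auto
        have "\<exists>b. p (Inl a) = Inl b" for a
          using pp True by (metis (full_types) Inl_Inr_False bij_def injD old.unit.exhaust sum.exhaust)
        then obtain q where q: "\<And>a. p (Inl a) = Inl (q a)" by metis
        have "inj q" using pp q by (metis Inl_inject bij_def inj_def)
        then have "q permutes UNIV"
          by (intro bij_imp_permutes) (auto simp: bij_def finite_UNIV_inj_surj)
        moreover have "p x = ?h q x" for x
          by (cases x) (auto simp: h1 h2 q True)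
        then have "p = ?h q" by blast
        ultimately show ?thesis using p by blast
      next
        case False
        then obtain b where "p (Inr ()) = Inl b" by (cases "p (Inr ())") auto
        then have "bordered M $ Inr () $ p (Inr ()) = 0" by (simp add: bordered_def)
        then have "(\<Prod>i\<in>UNIV. bordered M $ i $ p i) = 0" by (intro prod_zero) auto
        then show ?thesis by simp
      qed
    qed
  qed
  also have "\<dots> = (\<Sum>q\<in>?Q. ?t (?h q))" using inj by (simp add: sum.reindex)
  also have "\<dots> = (\<Sum>q\<in>?Q. of_int (sign q) * (\<Prod>i\<in>UNIV. M $ i $ q i))"
  proof (rule sum.cong)
    fix q assume q: "q \<in> ?Q"
    have "(\<Prod>i\<in>UNIV. bordered M $ i $ ?h q i) = (\<Prod>i\<in>range Inl. bordered M $ i $ ?h q i)"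
      unfolding UN by (subst prod.insert) (auto simp: h2 bordered_def)
    also have "\<dots> = (\<Prod>i\<in>UNIV. M $ i $ q i)"
      by (subst prod.reindex) (auto simp: h1 bordered_def)
    finally show "?t (?h q) = of_int (sign q) * (\<Prod>i\<in>UNIV. M $ i $ q i)"
      using q by (simp add: sign_map_permutation)
  qed auto
  finally show ?thesis by (simp add: det_def)
qed

lemma vjoin_nth [simp]: "vjoin x y $ Inl a = x $ a" "vjoin x y $ Inr b = y $ b"
  by (simp_all add: vjoin_def)

lemma vjoin_eq_iff [simp]: "vjoin x y = vjoin x' y' \<longleftrightarrow> x = x' \<and> y = y'"
  unfolding vec_eq_iff by (metis (no_types, lifting) sum.exhaust vjoin_nth)

lemma vec_eq_vjoin:
  fixes x y :: "complex^('a::finite + 'b::finite)"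
  assumes "\<And>a. x $ Inl a = y $ Inl a" "\<And>b. x $ Inr b = y $ Inr b"
  shows "x = y"
  unfolding vec_eq_iff using assms by (metis sum.exhaust)

lemma vjoin_add: "vjoin x y + vjoin x' y' = vjoin (x + x') (y + y')"
  by (rule vec_eq_vjoin) auto

lemma vjoin_diff: "vjoin x y - vjoin x' y' = vjoin (x - x') (y - y')"
  by (rule vec_eq_vjoin) auto

lemma vjoin_scale: "c *s vjoin x y = vjoin (c *s x) (c *s y)"
  by (rule vec_eq_vjoin) auto

lemma vjoin_zero [simp]: "vjoin 0 0 = 0"
  by (rule vec_eq_vjoin) auto

lemma vjoin_exhaust: obtains x y where "v = vjoin x y"
proof
  show "v = vjoin (\<chi> a. v $ Inl a) (\<chi> b. v $ Inr b)" by (rule vec_eq_vjoin) auto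
qed

lemma sum_UNIV_sum: "(\<Sum>i\<in>(UNIV :: ('a::finite + 'b::finite) set). f i) =
    (\<Sum>a\<in>UNIV. f (Inl a)) + (\<Sum>b\<in>UNIV. f (Inr b))"
  by (simp add: UNIV_Plus_UNIV[symmetric] sum.Plus del: UNIV_Plus_UNIV)

lemma hermitian_vjoin: "hermitian (vjoin x y) (vjoin x' y') = hermitian x x' + hermitian y y'"
  by (simp add: hermitian_def sum_UNIV_sum)

lemma norm_vjoin_sq: "(norm (vjoin x y))\<^sup>2 = (norm x)\<^sup>2 + (norm y)\<^sup>2"
proof -
  have "complex_of_real ((norm (vjoin x y))\<^sup>2) = complex_of_real ((norm x)\<^sup>2 + (norm y)\<^sup>2)"
    by (simp only: hermitian_self[symmetric] hermitian_vjoin of_real_add)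
  then show ?thesis by (simp only: of_real_eq_iff)
qed

lemma norm_vjoin_le: "norm (vjoin x y) \<le> norm x + norm y"
  by (rule power2_le_imp_le) (auto simp: norm_vjoin_sq power2_sum)

lemma norm_le_vjoin: "norm x \<le> norm (vjoin x y)" "norm y \<le> norm (vjoin x y)"
  by (rule power2_le_imp_le; simp add: norm_vjoin_sq)+

lemma subspace_vjoin:
  assumes "vec.subspace E" "vec.subspace F"
  shows "vec.subspace {vjoin x y | x y. x \<in> E \<and> y \<in> F}"
  unfolding vec.subspace_def
proof (intro conjI ballI allI)
  show "0 \<in> {vjoin x y |x y. x \<in> E \<and> y \<in> F}"
    using assms vec.subspace_0 by (metis (mono_tags, lifting) mem_Collect_eq vjoin_zero)
qed (use assms in \<open>auto simp: vjoin_add vjoin_scale vec.subspace_add vec.subspace_scale\<close>)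

lemma dim_vjoin:
  assumes E: "vec.subspace E" and F: "vec.subspace F"
  shows "vec.dim {vjoin x y | x y. x \<in> E \<and> y \<in> F} = vec.dim E + vec.dim F"
proof -
  obtain f where f: "ortho f {..<vec.dim E}" "vec.span (f ` {..<vec.dim E}) = E"
    using orthonormal_basis_exists[OF E] by metis
  obtain g where g: "ortho g {..<vec.dim F}" "vec.span (g ` {..<vec.dim F}) = F"
    using orthonormal_basis_exists[OF F] by metis
  let ?a = "vec.dim E" and ?b = "vec.dim F"
  let ?h = "\<lambda>i. case i of Inl i \<Rightarrow> vjoin (f i) 0 | Inr j \<Rightarrow> vjoin 0 (g j)"
  let ?I = "{..<?a} <+> {..<?b}"
  have o: "ortho ?h ?I"
    unfolding ortho_def
    by (auto simp: hermitian_vjoin hermitian_zero orthoD[OF f(1)] orthoD[OF g(1)] split: if_split_asm)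
  interpret l: Vector_Spaces.linear "(*s)" "(*s)" "\<lambda>x. vjoin x 0"
    by unfold_locales (auto simp: vjoin_add vjoin_scale vec.scale_right_distrib vec.scale_left_distrib)
  interpret r: Vector_Spaces.linear "(*s)" "(*s)" "\<lambda>x. vjoin 0 x"
    by unfold_locales (auto simp: vjoin_add vjoin_scale vec.scale_right_distrib vec.scale_left_distrib)
  have "?h ` ?I = (\<lambda>x. vjoin x 0) ` f ` {..<?a} \<union> (\<lambda>x. vjoin 0 x) ` g ` {..<?b}"
    by (force simp: Plus_def)
  then have "vec.span (?h ` ?I) = {x + y |x y. x \<in> (\<lambda>x. vjoin x 0) ` E \<and> y \<in> (\<lambda>x. vjoin 0 x) ` F}"
    by (simp add: vec.span_Un l.span_image r.span_image f(2) g(2))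
  also have "\<dots> = {vjoin x y | x y. x \<in> E \<and> y \<in> F}"
    by (force simp: vjoin_add)
  finally show ?thesis using ortho_dim[OF o] by (simp add: card_Plus)
qed

lemma cols_onb_bordered:
  fixes M :: "complex^'m^'m"
  assumes E: "cols_onb M I E" and F: "cols_onb M (- I) F"
  shows "cols_onb (bordered M) (Inl ` I) {vjoin e 0 | e. e \<in> E}"
    and "cols_onb (bordered M) (- (Inl ` I)) {vjoin f c | f c. f \<in> F}"
proof -
  have cl: "column (Inl c) (bordered M) = vjoin (column c M) 0" for c
    by (rule vec_eq_vjoin) (auto simp: column_def bordered_def)
  have cr: "column (Inr u) (bordered M) = vjoin 0 (vec 1)" for u
    by (rule vec_eq_vjoin) (auto simp: column_def bordered_def)
  let ?f = "\<lambda>i. column i M" and ?g = "\<lambda>i. column i (bordered M)"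
  interpret l: Vector_Spaces.linear "(*s)" "(*s)" "\<lambda>x. vjoin x (0 :: complex^unit)"
    by unfold_locales (auto simp: vjoin_add vjoin_scale vec.scale_right_distrib vec.scale_left_distrib)
  have img: "?g ` Inl ` J = (\<lambda>x. vjoin x 0) ` ?f ` J" for J
    by (simp add: image_image cl)
  have C: "- (Inl ` I) = insert (Inr ()) (Inl ` (- I))"
  proof (rule set_eqI)
    fix x :: "'m + unit"
    show "x \<in> - (Inl ` I) \<longleftrightarrow> x \<in> insert (Inr ()) (Inl ` (- I))" by (cases x) auto
  qed
  have oE: "ortho ?f I" "vec.span (?f ` I) = E" and oF: "ortho ?f (- I)" "vec.span (?f ` (- I)) = F"
    using E F by (auto simp: cols_onb_iff)
  have v1: "hermitian (vec 1 :: complex^unit) (vec 1) = 1" by (simp add: hermitian_def UNIV_unit)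
  show "cols_onb (bordered M) (Inl ` I) {vjoin e 0 | e. e \<in> E}"
    unfolding cols_onb_iff img l.span_image oE(2) using oE(1)
    by (auto simp: ortho_def cl hermitian_vjoin hermitian_zero)
  have "ortho ?g (- (Inl ` I))"
    unfolding C using oF(1) by (auto simp: ortho_def cl cr hermitian_vjoin hermitian_zero v1[simplified])
  moreover have "vec.span (?g ` (- (Inl ` I))) = {vjoin f c | f c. f \<in> F}"
  proof -
    have "vec.span (?g ` (- (Inl ` I))) = {x. \<exists>k. x - k *s vjoin 0 (vec 1) \<in> (\<lambda>x. vjoin x 0) ` F}"
      unfolding C image_insert vec.span_insert img l.span_image oF(2) cr ..
    also have "\<dots> = {vjoin f c | f c. f \<in> F}"
    proof (intro equalityI subsetI)
      fix x assume "x \<in> {x. \<exists>k. x - k *s vjoin 0 (vec 1) \<in> (\<lambda>x. vjoin x 0) ` F}"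
      then obtain k f where "x - k *s vjoin 0 (vec 1) = vjoin f 0" "f \<in> F" by auto
      moreover then have "x = vjoin f 0 + k *s vjoin 0 (vec 1)" by (metis diff_add_cancel)
      ultimately show "x \<in> {vjoin f c | f c. f \<in> F}" by (auto simp: vjoin_scale vjoin_add)
    next
      fix x assume "x \<in> {vjoin f (c :: complex^unit) | f c. f \<in> F}"
      then obtain f c where x: "x = vjoin f c" "f \<in> F" by auto
      have "c = (c $ ()) *s vec 1" by (simp add: vec_eq_iff)
      then have "x - (c $ ()) *s vjoin 0 (vec 1) = vjoin f 0"
        unfolding x(1) vjoin_scale vjoin_diff by simp
      then show "x \<in> {x. \<exists>k. x - k *s vjoin 0 (vec 1) \<in> (\<lambda>x. vjoin x 0) ` F}" using x(2) by blast
    qed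
    finally show ?thesis .
  qed
  ultimately show "cols_onb (bordered M) (- (Inl ` I)) {vjoin f c | f c. f \<in> F}"
    by (simp add: cols_onb_iff)
qed

text \<open>Comparison of dimensions along an injective linear relation. Initial data of corresponding
  solutions are related in this way without a map being given on the whole space.\<close>

lemma dim_le_by_relation:
  fixes E :: "(complex^'m) set" and F :: "(complex^'k) set"
  assumes E: "vec.subspace E" and F: "vec.subspace F"
    and ex: "\<And>x. x \<in> E \<Longrightarrow> \<exists>y\<in>F. R x y"
    and add: "\<And>x y x' y'. R x y \<Longrightarrow> R x' y' \<Longrightarrow> R (x + x') (y + y')"
    and scale: "\<And>c x y. R x y \<Longrightarrow> R (c *s x) (c *s y)"
    and zero: "\<And>x. R x 0 \<Longrightarrow> x = 0"
  shows "vec.dim E \<le> vec.dim F"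
proof -
  obtain B where B: "B \<subseteq> E" "vec.independent B" "E \<subseteq> vec.span B" "card B = vec.dim E"
    using vec.basis_exists[of E] by auto
  have spB: "vec.span B = E" using B E vec.span_minimal by blast
  obtain g where g: "\<And>x. x \<in> E \<Longrightarrow> g x \<in> F \<and> R x (g x)" using ex by metis
  obtain h where h: "Vector_Spaces.linear (*s) (*s) h" "\<And>x. x \<in> B \<Longrightarrow> h x = g x"
    using vec.linear_independent_extend[OF B(2), of g] by auto
  interpret h: Vector_Spaces.linear "(*s)" "(*s)" h by (rule h)
  have hF: "h x \<in> F \<and> R x (h x)" if "x \<in> vec.span B" for x
    using that
  proof (induct rule: vec.span_induct_alt)
    case base
    have "R 0 (g 0)" using g vec.subspace_0[OF E] by auto
    from scale[OF this, of 0] show ?case using F by (simp add: vec.subspace_0)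
  next
    case (step c x y)
    then show ?case using g[of x] h(2)[of x] B(1) F
      by (auto simp: h.add h.scale intro!: add scale vec.subspace_add vec.subspace_scale)
  qed
  have "inj_on h E"
  proof (rule inj_onI)
    fix x y assume xy: "x \<in> E" "y \<in> E" "h x = h y"
    then have "R (x - y) (h (x - y))" using hF[of "x - y"] spB E vec.subspace_diff by blast
    then have "x - y = 0" using xy by (intro zero) (simp add: h.diff)
    then show "x = y" by simp
  qed
  then have "vec.dim E = vec.dim (h ` E)"
    using vec.dim_image_eq[OF h(1), of E] spB by (metis vec.span_span)
  also have "\<dots> \<le> vec.dim F" using hF spB by (intro vec.dim_subset) auto
  finally show ?thesis .
qed

section \<open>Linear systems on the half-line\<close>

lemma norm_matvec_le: "norm (B *v x) \<le> norm B * norm x" for B :: "complex^'n^'m"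
proof -
  have row: "cmod ((B *v x) $ i) \<le> norm (B $ i) * norm x" for i
  proof -
    have "cmod ((B *v x) $ i) \<le> (\<Sum>j\<in>UNIV. cmod (B $ i $ j * x $ j))"
      unfolding matrix_vector_mult_def by (simp add: norm_sum)
    also have "\<dots> = (\<Sum>j\<in>UNIV. \<bar>cmod (B $ i $ j)\<bar> * \<bar>cmod (x $ j)\<bar>)"
      by (simp add: norm_mult)
    also have "\<dots> \<le> norm (B $ i) * norm x"
      unfolding norm_vec_def by (rule L2_set_mult_ineq)
    finally show ?thesis .
  qed
  have "norm (B *v x) \<le> L2_set (\<lambda>i. norm (B $ i) * norm x) UNIV"
    unfolding norm_vec_def[of "B *v x"] by (intro L2_set_mono row) auto
  also have "\<dots> = norm B * norm x"
    by (simp add: norm_vec_def[of B] L2_set_left_distrib)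
  finally show ?thesis .
qed

lemma matvec_scaleR: "(r *\<^sub>R B) *v x = r *\<^sub>R (B *v x)" "B *v (r *\<^sub>R x) = r *\<^sub>R (B *v x)"
  for B :: "complex^'n^'m"
  by (auto simp: vec_eq_iff matrix_vector_mult_def scaleR_sum_right)

lemma bounded_bilinear_matvec: "bounded_bilinear ((*v) :: complex^'n^'m \<Rightarrow> complex^'n \<Rightarrow> complex^'m)"
proof
  show "\<exists>K. \<forall>a b. norm (a *v b :: complex^'m) \<le> norm a * norm (b :: complex^'n) * K"
    by (rule exI[of _ 1]) (simp add: norm_matvec_le)
qed (auto simp: matrix_vector_right_distrib matrix_vector_mult_add_rdistrib matvec_scaleR)

lemma bounded_bilinear_scale: "bounded_bilinear ((*s) :: complex \<Rightarrow> complex^'m \<Rightarrow> complex^'m)"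
proof
  show "\<exists>K. \<forall>a b. norm (a *s b :: complex^'m) \<le> norm a * norm b * K"
    by (rule exI[of _ 1]) (simp add: norm_scale)
qed (auto simp: vec.scale_left_distrib vec.scale_right_distrib vec_eq_iff)

lemmas continuous_on_matvec [continuous_intros] = bounded_bilinear.continuous_on[OF bounded_bilinear_matvec]
lemmas continuous_on_scale [continuous_intros] = bounded_bilinear.continuous_on[OF bounded_bilinear_scale]
lemmas has_vector_derivative_scale = bounded_bilinear.has_vector_derivative[OF bounded_bilinear_scale]

lemma matvec_scale: "B *v (c *s x) = c *s (B *v x)" for B :: "complex^'n^'m"
  by (simp add: matrix_vector_mult_def vec_eq_iff sum_distrib_left mult_ac)

lemma mat_matvec: "mat c *v x = c *s x" for x :: "complex^'n"
  by (auto simp: matrix_vector_mult_def mat_def vec_eq_iff if_distrib[of "\<lambda>u. u * _"] cong: if_cong)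

lemma has_vector_derivative_const_scale:
  fixes U :: "real \<Rightarrow> complex^'m"
  assumes "(U has_vector_derivative U') F"
  shows "((\<lambda>z. c *s U z) has_vector_derivative c *s U') F"
  using bounded_linear.has_vector_derivative[OF bounded_bilinear.bounded_linear_right[OF bounded_bilinear_scale] assms] .

definition ode :: "(real \<Rightarrow> complex^'m^'m) \<Rightarrow> (real \<Rightarrow> complex^'m) \<Rightarrow> (real \<Rightarrow> complex^'m) \<Rightarrow> bool" where
  "ode B f U \<longleftrightarrow> (\<forall>z\<ge>0. (U has_vector_derivative B z *v U z + f z) (at z within {0..}))"

abbreviation sol :: "(real \<Rightarrow> complex^'m^'m) \<Rightarrow> (real \<Rightarrow> complex^'m) \<Rightarrow> bool" where
  "sol B \<equiv> ode B (\<lambda>_. 0)"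

definition bdd_cont :: "(real \<Rightarrow> 'a::real_normed_vector) \<Rightarrow> bool" where
  "bdd_cont f \<longleftrightarrow> continuous_on {0..} f \<and> bounded (f ` {0..})"

definition bounded_data :: "(real \<Rightarrow> complex^'m^'m) \<Rightarrow> (complex^'m) set" where
  "bounded_data B = {U 0 | U. sol B U \<and> bounded (U ` {0..})}"

lemma bounded_half_line_iff: "bounded (f ` {0::real..}) \<longleftrightarrow> (\<exists>M. \<forall>z\<ge>0. norm (f z) \<le> M)"
  by (auto simp: bounded_iff)

lemma odeD: "ode B f U \<Longrightarrow> z \<ge> 0 \<Longrightarrow> (U has_vector_derivative B z *v U z + f z) (at z within {0..})"
  by (simp add: ode_def)

lemma ode_continuous: "ode B f U \<Longrightarrow> continuous_on {0..} U"
  unfolding continuous_on_eq_continuous_within using odeD has_vector_derivative_continuous by force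

lemma ode_add_scale:
  assumes "ode B f U" "ode B g V"
  shows "ode B (\<lambda>z. f z + c *s g z) (\<lambda>z. U z + c *s V z)"
  unfolding ode_def
proof (intro allI impI)
  fix z :: real assume "z \<ge> 0"
  from has_vector_derivative_add[OF odeD[OF assms(1) this]
      has_vector_derivative_const_scale[OF odeD[OF assms(2) this], of c]]
  show "((\<lambda>z. U z + c *s V z) has_vector_derivative
      B z *v (U z + c *s V z) + (f z + c *s g z)) (at z within {0..})"
    by (simp add: matrix_vector_right_distrib matvec_scale vec.scale_right_distrib algebra_simps)
qed

lemma sol_add: "sol B U \<Longrightarrow> sol B V \<Longrightarrow> sol B (\<lambda>z. U z + V z)"
  using ode_add_scale[of B "\<lambda>_. 0" U "\<lambda>_. 0" V 1] by simp

lemma sol_scale: "sol B U \<Longrightarrow> sol B (\<lambda>z. c *s U z)"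
  using ode_add_scale[of B "\<lambda>_. 0" "\<lambda>_. 0" "\<lambda>_. 0" U c] by (simp add: ode_def)

lemma sol_zero: "sol B (\<lambda>_. 0)" by (simp add: ode_def)

lemma bounded_add_scale:
  fixes f g :: "'i \<Rightarrow> complex^'n"
  assumes "bounded (f ` S)" "bounded (g ` S)"
  shows "bounded ((\<lambda>z. f z + c *s g z) ` S)"
proof -
  obtain M N where "\<forall>z\<in>S. norm (f z) \<le> M" "\<forall>z\<in>S. norm (g z) \<le> N"
    using assms unfolding bounded_iff by auto
  then have "\<forall>z\<in>S. norm (f z + c *s g z) \<le> M + cmod c * N"
    by (auto simp: norm_scale intro!: norm_triangle_mono mult_left_mono)
  then show ?thesis unfolding bounded_iff by blast
qed

lemma bounded_half_line_scale:
  fixes f :: "real \<Rightarrow> complex^'m"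
  assumes "bounded (f ` {0..})"
  shows "bounded ((\<lambda>z. c *s f z) ` {0..})"
  using bounded_add_scale[of "\<lambda>_. 0" _ f c] assms by (simp add: image_constant_conv)

lemma bdd_cont_add_scale:
  fixes f g :: "real \<Rightarrow> complex^'m"
  shows "bdd_cont f \<Longrightarrow> bdd_cont g \<Longrightarrow> bdd_cont (\<lambda>z. f z + c *s g z)"
  by (auto simp: bdd_cont_def intro!: continuous_intros bounded_add_scale)

lemma subspace_bounded_data: "vec.subspace (bounded_data B)"
  unfolding vec.subspace_def
proof (intro conjI ballI allI)
  show "0 \<in> bounded_data B"
    unfolding bounded_data_def using sol_zero by (intro CollectI exI[of _ "\<lambda>_. 0"]) (auto simp: image_constant_conv)
next
  fix x y assume "x \<in> bounded_data B" "y \<in> bounded_data B"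
  then obtain U V where "sol B U" "bounded (U ` {0..})" "x = U 0" "sol B V" "bounded (V ` {0..})" "y = V 0"
    by (auto simp: bounded_data_def)
  then show "x + y \<in> bounded_data B"
    unfolding bounded_data_def using bounded_add_scale[of U _ V 1] sol_add[of B U V]
    by (intro CollectI exI[of _ "\<lambda>z. U z + V z"]) auto
next
  fix c x assume "x \<in> bounded_data B"
  then obtain U where "sol B U" "bounded (U ` {0..})" "x = U 0" by (auto simp: bounded_data_def)
  then show "c *s x \<in> bounded_data B"
    unfolding bounded_data_def using bounded_half_line_scale[of U c] sol_scale[of B U c]
    by (intro CollectI exI[of _ "\<lambda>z. c *s U z"]) auto
qed

text \<open>Gronwall, in both directions of time. A bounded inhomogeneity is absorbed in \<open>M\<close>: since
  \<open>2 \<bar>U\<bar> M \<le> \<bar>U\<bar>\<^sup>2 + M\<^sup>2\<close>, the function \<open>exp (- 3 K z) (\<bar>U\<bar>\<^sup>2 + M\<^sup>2)\<close> decreases and the one with the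
  opposite exponent increases.\<close>

lemma gronwall:
  fixes U :: "real \<Rightarrow> 'a::real_inner"
  assumes U: "\<And>z. z \<ge> 0 \<Longrightarrow> (U has_vector_derivative U' z) (at z within {0..})"
    and K: "\<And>z. 0 \<le> z \<Longrightarrow> z \<le> b \<Longrightarrow> norm (U' z) \<le> K * (norm (U z) + M)" and M: "M \<ge> 0" and K0: "K \<ge> 0"
    and st: "0 \<le> s" "s \<le> b" "0 \<le> t" "t \<le> b"
  shows "(norm (U s))\<^sup>2 + M\<^sup>2 \<le> exp (3 * K * \<bar>s - t\<bar>) * ((norm (U t))\<^sup>2 + M\<^sup>2)"
proof -
  define g where "g z = U z \<bullet> U z + M\<^sup>2" for z
  define g' where "g' z = 2 * (U z \<bullet> U' z)" for z
  have g: "(g has_real_derivative g' z) (at z within {0..})" if "z \<ge> 0" for z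
  proof -
    have "((\<lambda>z. U z \<bullet> U z) has_vector_derivative U z \<bullet> U' z + U' z \<bullet> U z) (at z within {0..})"
      using bounded_bilinear.has_vector_derivative[OF bounded_bilinear_inner U[OF that] U[OF that]] .
    then show ?thesis unfolding g_def[abs_def] g'_def has_real_derivative_iff_has_vector_derivative
      by (auto intro!: derivative_eq_intros simp: inner_commute)
  qed
  have g'_le: "\<bar>g' z\<bar> \<le> 3 * K * g z" if "0 \<le> z" "z \<le> b" for z
  proof -
    have "\<bar>U z \<bullet> U' z\<bar> \<le> norm (U z) * (K * (norm (U z) + M))"
      using Cauchy_Schwarz_ineq2[of "U z" "U' z"] mult_left_mono[OF K[OF that], of "norm (U z)"] by simp
    moreover have "2 * (norm (U z) * M) \<le> (norm (U z))\<^sup>2 + M\<^sup>2"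
      using sum_squares_bound[of "norm (U z)" M] by simp
    then have "K * (2 * (norm (U z) * M)) \<le> K * ((norm (U z))\<^sup>2 + M\<^sup>2)" using K0 by (rule mult_left_mono)
    moreover have "K * M\<^sup>2 \<ge> 0" using K0 by simp
    ultimately show ?thesis
      unfolding g'_def g_def dot_square_norm by (simp add: abs_mult power2_eq_square algebra_simps)
  qed
  have mono: "exp (- (3 * K) * v) * g v \<le> exp (- (3 * K) * u) * g u \<and>
              exp (3 * K * u) * g u \<le> exp (3 * K * v) * g v" if uv: "0 \<le> u" "u < v" "v \<le> b" for u v
  proof
    have cont: "continuous_on {u..v} g"
    proof (rule continuous_on_subset)
      show "continuous_on {0..} g"
        using g by (auto simp: continuous_on_eq_continuous_within intro: DERIV_continuous)
    qed (use uv in auto)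
    have d: "(g has_real_derivative g' z) (at z)" if "u < z" for z
      using g[of z] that uv at_within_interior[of z "{0..}"] by (simp add: interior_real_atLeast)
    have "- (exp (- (3 * K) * u) * g u) \<le> - (exp (- (3 * K) * v) * g v)"
    proof (rule DERIV_nonneg_imp_increasing_open[OF less_imp_le[OF uv(2)]])
      fix x assume x: "u < x" "x < v"
      have "((\<lambda>x. - (exp (- (3 * K) * x) * g x)) has_real_derivative
          (exp (- (3 * K) * x) * (3 * K * g x - g' x))) (at x)"
        by (rule derivative_eq_intros refl d x)+ (simp add: algebra_simps)
      moreover have "exp (- (3 * K) * x) * (3 * K * g x - g' x) \<ge> 0" using g'_le[of x] x uv by auto
      ultimately show "\<exists>y. ((\<lambda>x. - (exp (- (3 * K) * x) * g x)) has_real_derivative y) (at x) \<and> 0 \<le> y"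
        by blast
    qed (intro continuous_intros cont)
    then show "exp (- (3 * K) * v) * g v \<le> exp (- (3 * K) * u) * g u" by simp
    show "exp (3 * K * u) * g u \<le> exp (3 * K * v) * g v"
    proof (rule DERIV_nonneg_imp_increasing_open[OF less_imp_le[OF uv(2)]])
      fix x assume x: "u < x" "x < v"
      have "((\<lambda>x. exp (3 * K * x) * g x) has_real_derivative
          (exp (3 * K * x) * (3 * K * g x + g' x))) (at x)"
        by (rule derivative_eq_intros refl d x)+ (simp add: algebra_simps)
      moreover have "exp (3 * K * x) * (3 * K * g x + g' x) \<ge> 0" using g'_le[of x] x uv by auto
      ultimately show "\<exists>y. ((\<lambda>x. exp (3 * K * x) * g x) has_real_derivative y) (at x) \<and> 0 \<le> y"
        by blast
    qed (intro continuous_intros cont)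
  qed
  have "g s \<le> exp (3 * K * \<bar>s - t\<bar>) * g t"
  proof (cases s t rule: linorder_cases)
    case less
    have "exp (3 * K * s) * g s \<le> exp (3 * K * t) * g t" using mono[of s t] less st by auto
    then have "exp (- (3 * K * s)) * (exp (3 * K * s) * g s) \<le> exp (- (3 * K * s)) * (exp (3 * K * t) * g t)"
      by (rule mult_left_mono) simp
    then show ?thesis using less
      by (simp add: mult.assoc[symmetric] exp_add[symmetric] right_diff_distrib)
  next
    case greater
    have "exp (- (3 * K) * s) * g s \<le> exp (- (3 * K) * t) * g t" using mono[of t s] greater st by auto
    then have "exp (3 * K * s) * (exp (- (3 * K) * s) * g s) \<le> exp (3 * K * s) * (exp (- (3 * K) * t) * g t)"
      by (rule mult_left_mono) simp
    then show ?thesis using greater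
      by (simp add: mult.assoc[symmetric] exp_add[symmetric] right_diff_distrib)
  qed simp
  then show ?thesis by (simp add: g_def dot_square_norm)
qed

lemma sol_zero_propagates:
  assumes U: "sol B U" and B: "continuous_on {0..} B" and s: "s \<ge> 0" "U s = 0" and t: "t \<ge> 0"
  shows "U t = 0"
proof -
  let ?b = "max s t"
  have "compact (B ` {0..?b})"
    by (rule compact_continuous_image) (auto intro: continuous_on_subset[OF B])
  then obtain K where K: "\<And>z. z \<in> {0..?b} \<Longrightarrow> norm (B z) \<le> K"
    using compact_imp_bounded bounded_iff by (metis (no_types, lifting) imageI)
  then have K0: "K \<ge> 0" using norm_ge_zero[of "B s"] s t by (meson atLeastAtMost_iff max.cobounded1 order_trans)
  have "(norm (U t))\<^sup>2 + 0\<^sup>2 \<le> exp (3 * K * \<bar>t - s\<bar>) * ((norm (U s))\<^sup>2 + 0\<^sup>2)"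
  proof (rule gronwall[where b = ?b])
    show "(U has_vector_derivative B z *v U z) (at z within {0..})" if "z \<ge> 0" for z
      using odeD[OF U that] by simp
    show "norm (B z *v U z) \<le> K * (norm (U z) + 0)" if "0 \<le> z" "z \<le> ?b" for z
      using norm_matvec_le[of "B z" "U z"] mult_right_mono[OF K[of z] norm_ge_zero[of "U z"]] that by simp
  qed (use s t K0 in auto)
  then show ?thesis using s by simp
qed

lemma sol_unique:
  assumes "sol B U" "sol B V" "continuous_on {0..} B" "s \<ge> 0" "U s = V s" "t \<ge> 0"
  shows "U t = V t"
proof -
  have "sol B (\<lambda>z. U z + (- 1) *s V z)" using ode_add_scale[OF assms(1,2), of "- 1"] by simp
  from sol_zero_propagates[OF this assms(3,4) _ assms(6)] assms(5) show ?thesis by simp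
qed

section \<open>Bounded inversion for constant coefficients\<close>

lemma exp_weighted_integral:
  fixes \<phi> :: "real \<Rightarrow> complex"
  assumes \<phi>: "continuous_on {0..} \<phi>" and M: "\<And>z. z \<ge> 0 \<Longrightarrow> cmod (\<phi> z) \<le> M"
    and r: "Re r > 0" and z: "z \<ge> 0"
  shows "(\<lambda>t. exp (- r * of_real t) * \<phi> t) integrable_on {z..}"
    and "cmod (integral {z..} (\<lambda>t. exp (- r * of_real t) * \<phi> t)) \<le> M * (exp (- Re r * z) / Re r)"
proof -
  have I: "((\<lambda>t. M * exp (- Re r * t)) has_integral M * (exp (- Re r * z) / Re r)) {z..}"
    by (intro has_integral_mult_right has_integral_exp_minus_to_infinity r)
  have b: "cmod (exp (- r * of_real t) * \<phi> t) \<le> M * exp (- Re r * t)" if "t \<in> {z..}" for t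
    using M[of t] that z mult_right_mono[OF M[of t], of "exp (- Re r * t)"]
    by (simp add: norm_mult norm_exp_eq_Re mult.commute)
  show int: "(\<lambda>t. exp (- r * of_real t) * \<phi> t) integrable_on {z..}"
  proof (rule measurable_bounded_by_integrable_imp_integrable)
    show "(\<lambda>t. M * exp (- Re r * t)) integrable_on {z..}" using I by (rule has_integral_integrable)
    show "cmod (exp (- r * of_real t) * \<phi> t) \<le> M * exp (- Re r * t)" if "t \<in> {z..}" for t
      by (rule b[OF that])
    show "(\<lambda>t. exp (- r * of_real t) * \<phi> t) \<in> borel_measurable (lebesgue_on {z..})"
      by (intro continuous_imp_measurable_on_sets_lebesgue continuous_intros continuous_on_subset[OF \<phi>])
        (use z in auto)
  qed auto
  show "cmod (integral {z..} (\<lambda>t. exp (- r * of_real t) * \<phi> t)) \<le> M * (exp (- Re r * z) / Re r)"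
    using integral_norm_bound_integral[OF int has_integral_integrable[OF I] b] by (simp only: integral_unique[OF I])
qed

lemma exp_weighted_integral_compact:
  fixes \<phi> :: "real \<Rightarrow> complex"
  assumes \<phi>: "continuous_on {0..} \<phi>" and M: "\<And>z. z \<ge> 0 \<Longrightarrow> cmod (\<phi> z) \<le> M"
    and r: "Re r < 0" and z: "z \<ge> 0"
  shows "(\<lambda>t. exp (- r * of_real t) * \<phi> t) integrable_on {0..z}"
    and "cmod (integral {0..z} (\<lambda>t. exp (- r * of_real t) * \<phi> t)) \<le> M * (exp (- Re r * z) / (- Re r))"
proof -
  have "((\<lambda>t. exp (- Re r * t)) has_integral exp (- Re r * z) / (- Re r) - exp (- Re r * 0) / (- Re r)) {0..z}"
    using r by (intro fundamental_theorem_of_calculus z)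
      (auto intro!: derivative_eq_intros simp: has_real_derivative_iff_has_vector_derivative[symmetric])
  then have I: "((\<lambda>t. M * exp (- Re r * t)) has_integral
      M * (exp (- Re r * z) / (- Re r) - exp (- Re r * 0) / (- Re r))) {0..z}"
    by (intro has_integral_mult_right)
  have M0: "M \<ge> 0" using M[of 0] norm_ge_zero[of "\<phi> 0"] by linarith
  have b: "cmod (exp (- r * of_real t) * \<phi> t) \<le> M * exp (- Re r * t)" if "t \<in> {0..z}" for t
    using M[of t] that z mult_right_mono[OF M[of t], of "exp (- Re r * t)"]
    by (simp add: norm_mult norm_exp_eq_Re mult.commute)
  show int: "(\<lambda>t. exp (- r * of_real t) * \<phi> t) integrable_on {0..z}"
    by (intro integrable_continuous_real continuous_intros continuous_on_subset[OF \<phi>]) auto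
  have "cmod (integral {0..z} (\<lambda>t. exp (- r * of_real t) * \<phi> t)) \<le>
      M * (exp (- Re r * z) / (- Re r) - exp (- Re r * 0) / (- Re r))"
    using integral_norm_bound_integral[OF int has_integral_integrable[OF I] b] by (simp only: integral_unique[OF I])
  also have "\<dots> \<le> M * (exp (- Re r * z) / (- Re r))"
    using r M0 by (intro mult_left_mono) (auto simp: field_simps)
  finally show "cmod (integral {0..z} (\<lambda>t. exp (- r * of_real t) * \<phi> t)) \<le> M * (exp (- Re r * z) / (- Re r))" .
qed

lemma integral_atMost_derivative:
  fixes f :: "real \<Rightarrow> complex"
  assumes f: "continuous_on {0..} f" and z: "z \<ge> 0"
  shows "((\<lambda>u. integral {0..u} f) has_vector_derivative f z) (at z within {0..})"
proof -
  have "((\<lambda>u. integral {0..u} f) has_vector_derivative f z) (at z within {0..z + 1})"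
    using z by (intro integral_has_vector_derivative continuous_on_subset[OF f]) auto
  moreover have "at z within {0..z + 1} = at z within {0..}"
    by (rule at_within_nhd[of _ "{..<z + 1}"]) auto
  ultimately show ?thesis by simp
qed

text \<open>The bounded solution operator of \<open>u' = r u + \<phi>\<close>: integrate forward from \<open>0\<close> in the stable
  case and backward from infinity in the unstable one.\<close>

definition resolvent :: "complex \<Rightarrow> (real \<Rightarrow> complex) \<Rightarrow> real \<Rightarrow> complex" where
  "resolvent r \<phi> z = (if Re r < 0 then exp (r * of_real z) * integral {0..z} (\<lambda>t. exp (- r * of_real t) * \<phi> t)
     else - (exp (r * of_real z) * integral {z..} (\<lambda>t. exp (- r * of_real t) * \<phi> t)))"

lemma resolvent_bound:
  assumes r: "Re r \<noteq> 0" and \<phi>: "continuous_on {0..} \<phi>" and M: "\<And>z. z \<ge> 0 \<Longrightarrow> cmod (\<phi> z) \<le> M" and z: "z \<ge> 0"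
  shows "cmod (resolvent r \<phi> z) \<le> M / \<bar>Re r\<bar>"
proof (cases "Re r < 0")
  case True
  have "cmod (resolvent r \<phi> z) = exp (Re r * z) * cmod (integral {0..z} (\<lambda>t. exp (- r * of_real t) * \<phi> t))"
    using True by (simp add: resolvent_def norm_mult norm_exp_eq_Re)
  also have "\<dots> \<le> exp (Re r * z) * (M * (exp (- Re r * z) / (- Re r)))"
    by (intro mult_left_mono exp_weighted_integral_compact assms True) auto
  also have "\<dots> = M / \<bar>Re r\<bar> * (exp (Re r * z) * exp (- Re r * z))" using True by simp
  also have "\<dots> = M / \<bar>Re r\<bar>" by (subst exp_add[symmetric]) simp
  finally show ?thesis .
next
  case False
  then have r0: "Re r > 0" using r by simp
  have "cmod (resolvent r \<phi> z) = exp (Re r * z) * cmod (integral {z..} (\<lambda>t. exp (- r * of_real t) * \<phi> t))"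
    using False by (simp add: resolvent_def norm_mult norm_exp_eq_Re)
  also have "\<dots> \<le> exp (Re r * z) * (M * (exp (- Re r * z) / Re r))"
    by (intro mult_left_mono exp_weighted_integral assms r0) auto
  also have "\<dots> = M / \<bar>Re r\<bar> * (exp (Re r * z) * exp (- Re r * z))" using r0 by simp
  also have "\<dots> = M / \<bar>Re r\<bar>" by (subst exp_add[symmetric]) simp
  finally show ?thesis .
qed

lemma resolvent_derivative:
  assumes r: "Re r \<noteq> 0" and \<phi>: "bdd_cont \<phi>" and z: "z \<ge> 0"
  shows "(resolvent r \<phi> has_vector_derivative r * resolvent r \<phi> z + \<phi> z) (at z within {0..})"
proof -
  let ?f = "\<lambda>t. exp (- r * of_real t) * \<phi> t"
  have c: "continuous_on {0..} \<phi>" using \<phi> by (simp add: bdd_cont_def)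
  obtain M where M: "\<And>z. z \<ge> 0 \<Longrightarrow> cmod (\<phi> z) \<le> M"
    using \<phi> by (auto simp: bdd_cont_def bounded_half_line_iff)
  define k where "k = (if Re r < 0 then 0 else integral {0..} ?f)"
  have eq: "resolvent r \<phi> y = exp (r * of_real y) * (integral {0..y} ?f - k)" if y: "y \<ge> 0" for y
  proof (cases "Re r < 0")
    case True then show ?thesis by (simp add: resolvent_def k_def)
  next
    case False
    then have r0: "Re r > 0" using r by simp
    have "(?f has_integral integral {0..y} ?f + integral {y..} ?f) ({0..y} \<union> {y..})"
    proof (rule has_integral_Un)
      show "(?f has_integral integral {0..y} ?f) {0..y}"
        by (intro integrable_integral integrable_continuous_real continuous_intros continuous_on_subset[OF c]) auto
      show "(?f has_integral integral {y..} ?f) {y..}"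
        by (rule integrable_integral, rule exp_weighted_integral(1)[OF c M r0 y])
      have "{0..y} \<inter> {y..} = {y}" using y by auto
      then show "negligible ({0..y} \<inter> {y..})" by simp
    qed
    moreover have "{0..y} \<union> {y..} = {0..}" using y by auto
    ultimately have "integral {0..} ?f = integral {0..y} ?f + integral {y..} ?f"
      by (simp add: integral_unique)
    then show ?thesis using False by (simp add: resolvent_def k_def algebra_simps)
  qed
  have e: "((\<lambda>y. exp (r * of_real y)) has_vector_derivative r * exp (r * of_real z)) (at z within {0..})"
    by (rule has_vector_derivative_real_field) (auto intro!: derivative_eq_intros)
  have i: "((\<lambda>y. integral {0..y} ?f - k) has_vector_derivative ?f z) (at z within {0..})"
  proof -
    have "continuous_on {0..} ?f" by (intro continuous_intros c)
    from has_vector_derivative_diff[OF integral_atMost_derivative[OF this z] has_vector_derivative_const[of k]]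
    show ?thesis by simp
  qed
  have e1: "exp (r * of_real z) * ?f z = \<phi> z"
    by (simp add: mult.assoc[symmetric] exp_add[symmetric])
  have "((\<lambda>y. exp (r * of_real y) * (integral {0..y} ?f - k)) has_vector_derivative
      r * resolvent r \<phi> z + \<phi> z) (at z within {0..})"
    using has_vector_derivative_mult[OF e i] by (simp only: e1 eq[OF z] mult.assoc add.commute)
  then show ?thesis
    by (rule has_vector_derivative_transform[rotated 2]) (use z eq in auto)
qed

lemma resolvent_bdd_cont:
  assumes r: "Re r \<noteq> 0" and \<phi>: "bdd_cont \<phi>"
  shows "bdd_cont (resolvent r \<phi>)"
proof -
  obtain M where M: "\<And>z. z \<ge> 0 \<Longrightarrow> cmod (\<phi> z) \<le> M"
    using \<phi> by (auto simp: bdd_cont_def bounded_half_line_iff)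
  have "continuous_on {0..} (resolvent r \<phi>)"
    unfolding continuous_on_eq_continuous_within
    using resolvent_derivative[OF assms] has_vector_derivative_continuous by force
  moreover have "bounded (resolvent r \<phi> ` {0..})"
    unfolding bounded_half_line_iff
  proof (intro exI allI impI)
    fix z :: real assume "z \<ge> 0"
    then show "cmod (resolvent r \<phi> z) \<le> M / \<bar>Re r\<bar>"
      using \<phi> by (intro resolvent_bound r M) (auto simp: bdd_cont_def)
  qed
  ultimately show ?thesis by (simp add: bdd_cont_def)
qed

lemma resolvent_linear:
  assumes r: "Re r \<noteq> 0" and f: "bdd_cont f" and g: "bdd_cont g" and z: "z \<ge> 0"
  shows "resolvent r (\<lambda>z. f z + c * g z) z = resolvent r f z + c * resolvent r g z"
proof -
  obtain M where M: "\<And>z. z \<ge> 0 \<Longrightarrow> cmod (f z) \<le> M"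
    using f by (auto simp: bdd_cont_def bounded_half_line_iff)
  obtain N where N: "\<And>z. z \<ge> 0 \<Longrightarrow> cmod (g z) \<le> N"
    using g by (auto simp: bdd_cont_def bounded_half_line_iff)
  have cf: "continuous_on {0..} f" and cg: "continuous_on {0..} g" using f g by (auto simp: bdd_cont_def)
  let ?e = "\<lambda>t. exp (- r * of_real t)"
  have "integral S (\<lambda>t. ?e t * (f t + c * g t)) = integral S (\<lambda>t. ?e t * f t) + c * integral S (\<lambda>t. ?e t * g t)"
    if "(\<lambda>t. ?e t * f t) integrable_on S" "(\<lambda>t. ?e t * g t) integrable_on S" for S
  proof -
    have "((\<lambda>t. ?e t * f t + c * (?e t * g t)) has_integral
        integral S (\<lambda>t. ?e t * f t) + c * integral S (\<lambda>t. ?e t * g t)) S"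
      by (intro has_integral_add has_integral_mult_right integrable_integral that)
    then show ?thesis by (simp add: integral_unique algebra_simps)
  qed
  then show ?thesis
    using exp_weighted_integral(1)[OF cf M _ z] exp_weighted_integral(1)[OF cg N _ z]
      exp_weighted_integral_compact(1)[OF cf M _ z] exp_weighted_integral_compact(1)[OF cg N _ z] r
    unfolding resolvent_def by (cases "Re r < 0") (auto simp: algebra_simps)
qed

definition eigenvalue :: "complex^'m^'m \<Rightarrow> complex \<Rightarrow> bool" where
  "eigenvalue B r \<longleftrightarrow> (\<exists>v. v \<noteq> 0 \<and> B *v v = r *s v)"

definition hyperbolic :: "complex^'m^'m \<Rightarrow> bool" where
  "hyperbolic B \<longleftrightarrow> (\<forall>r. eigenvalue B r \<longrightarrow> Re r \<noteq> 0)"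

text \<open>The commuting factors \<open>B - r\<close>, for \<open>r\<close> in the list, applied one after the other.\<close>

primrec annihilate :: "complex^'m^'m \<Rightarrow> complex list \<Rightarrow> complex^'m \<Rightarrow> complex^'m" where
  "annihilate B [] v = v"
| "annihilate B (r # rs) v = annihilate B rs (B *v v - r *s v)"

lemma annihilate_append: "annihilate B (rs @ ts) v = annihilate B ts (annihilate B rs v)"
  by (induct rs arbitrary: v) auto

lemma annihilate_commute: "annihilate B rs (B *v v - r *s v) = B *v annihilate B rs v - r *s annihilate B rs v"
proof (induct rs arbitrary: v)
  case (Cons t rs)
  have "B *v (B *v v - r *s v) - t *s (B *v v - r *s v) = B *v (B *v v - t *s v) - r *s (B *v v - t *s v)"
    by (simp add: matrix_vector_mult_diff_distrib matvec_scale vec.scale_right_diff_distrib algebra_simps mult.commute)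
  then show ?case unfolding annihilate.simps Cons[symmetric] by (simp only:)
qed simp

lemma exists_dependency:
  fixes f :: "nat \<Rightarrow> complex^'m"
  shows "\<exists>p :: complex poly. p \<noteq> 0 \<and> (\<Sum>i\<le>degree p. coeff p i *s f i) = 0"
proof (cases "inj_on f {..CARD('m)}")
  case True
  let ?S = "f ` {..CARD('m)}"
  have "card ?S > vec.dim ?S"
    using card_image[OF True] vec_dim_card[where 'a = complex and 'n = 'm] vec.dim_subset_UNIV[of ?S]
    by (metis card_atMost dim_subset_UNIV_cart_gen lessI order_le_less_trans)
  then have "vec.dependent ?S" using vec.dim_eq_card_independent[of ?S] by linarith
  then obtain u where u: "\<exists>v\<in>?S. u v \<noteq> 0" "(\<Sum>v\<in>?S. u v *s v) = 0"
    unfolding vec.dependent_finite[OF finite_imageI[OF finite_atMost]] by auto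
  define p where "p = Poly (map (\<lambda>i. u (f i)) [0..<Suc (CARD('m))])"
  have cp: "coeff p i = (if i \<le> CARD('m) then u (f i) else 0)" for i
    by (auto simp: p_def nth_default_def nth_append simp del: upt_Suc)
  have "p \<noteq> 0" using u(1) cp by (metis (no_types, lifting) atMost_iff coeff_0 image_iff)
  moreover have "(\<Sum>i\<le>degree p. coeff p i *s f i) = (\<Sum>i\<le>CARD('m). coeff p i *s f i)"
  proof (rule sum.mono_neutral_left)
    have "degree p \<le> CARD('m)" by (rule degree_le) (simp add: cp)
    then show "{..degree p} \<subseteq> {..CARD('m)}" by auto
    show "\<forall>i\<in>{..CARD('m)} - {..degree p}. coeff p i *s f i = 0"
      using coeff_eq_0[of p] by auto
  qed simp
  moreover have "(\<Sum>i\<le>CARD('m). coeff p i *s f i) = (\<Sum>v\<in>?S. u v *s v)"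
    by (subst sum.reindex[OF True]) (simp add: cp)
  ultimately show ?thesis using u by auto
next
  case False
  then obtain i j where ij: "i \<noteq> j" "f i = f j" by (auto simp: inj_on_def)
  have wlog: ?thesis if "i < j" "f i = f j" for i j
  proof -
    define p :: "complex poly" where "p = monom 1 j - monom 1 i"
    have cp: "coeff p n = (if n = j then 1 else 0) - (if n = i then 1 else 0)" for n by (simp add: p_def)
    have "coeff p j \<noteq> 0" using that by (simp add: cp)
    then have p0: "p \<noteq> 0" and "j \<le> degree p" by (auto intro: le_degree)
    have "(\<Sum>n\<le>degree p. coeff p n *s f n) =
        (\<Sum>n\<le>degree p. (if n = j then f n else 0)) - (\<Sum>n\<le>degree p. (if n = i then f n else 0))"
      unfolding cp sum_subtractf[symmetric] by (intro sum.cong) auto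
    also have "\<dots> = f j - f i" using that \<open>j \<le> degree p\<close> by simp
    finally show ?thesis using p0 that by (intro exI[of _ p]) simp
  qed
  show ?thesis using wlog[of i j] wlog[of j i] ij by (metis nat_neq_iff)
qed

text \<open>The vectors \<open>v, B v, B\<^sup>2 v, \<dots>\<close> are dependent, so a polynomial in \<open>B\<close> annihilates \<open>v\<close>, and it splits
  into linear factors.\<close>

lemma annihilate_exists:
  fixes v :: "complex^'m"
  shows "\<exists>rs. annihilate B rs v = 0"
proof -
  define f where "f v i = ((\<lambda>w. B *v w) ^^ i) v" for v :: "complex^'m" and i :: nat
  have f_Suc: "f v (Suc i) = f (B *v v) i" for v i by (simp add: f_def funpow_swap1)
  have f_diff: "f (v - w) i = f v i - f w i" for v w i
    by (induct i) (auto simp: f_def matrix_vector_mult_diff_distrib)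
  have f_scale: "f (c *s v) i = c *s f v i" for c v i
    by (induct i) (auto simp: f_def matvec_scale)
  define P where "P p v = (\<Sum>i\<le>degree p. coeff p i *s f v i)" for p v
  have P_ge: "P p v = (\<Sum>i\<le>n. coeff p i *s f v i)" if "n \<ge> degree p" for p v n
    unfolding P_def by (rule sum.mono_neutral_left) (use that coeff_eq_0[of p] in auto)
  have P_lin: "P ([:- r, 1:] * q) v = P q (B *v v - r *s v)" for r q v
  proof -
    let ?n = "degree q"
    have "degree ([:- r, 1:] * q) \<le> Suc ?n" using degree_mult_le[of "[:- r, 1:]" q] by simp
    then have "P ([:- r, 1:] * q) v = (\<Sum>i\<le>Suc ?n. coeff ([:- r, 1:] * q) i *s f v i)" by (rule P_ge)
    also have "\<dots> = (\<Sum>i\<le>Suc ?n. coeff (pCons 0 q) i *s f v i) - (\<Sum>i\<le>Suc ?n. r *s (coeff q i *s f v i))"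
    proof -
      have "coeff ([:- r, 1:] * q) i = coeff (pCons 0 q) i - r * coeff q i" for i
        by (simp add: mult_pCons_left)
      then show ?thesis
        by (simp only: sum_subtractf[symmetric] vec.scale_left_diff_distrib vec.scale_scale)
    qed
    also have "(\<Sum>i\<le>Suc ?n. coeff (pCons 0 q) i *s f v i) = (\<Sum>i\<le>?n. coeff q i *s f (B *v v) i)"
      by (subst sum.atMost_Suc_shift) (simp add: f_Suc)
    also have "(\<Sum>i\<le>Suc ?n. r *s (coeff q i *s f v i)) = (\<Sum>i\<le>?n. coeff q i *s (r *s f v i))"
      by (simp add: coeff_eq_0 mult.commute)
    finally show ?thesis
      unfolding P_def sum_subtractf[symmetric] f_diff f_scale vec.scale_right_diff_distrib .
  qed
  have main: "\<exists>rs. annihilate B rs v = 0" if "p \<noteq> 0" "P p v = 0" for p v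
    using that
  proof (induct "degree p" arbitrary: p v)
    case 0
    then obtain c where c: "p = [:c:]" by (metis degree_eq_zeroE)
    then have "c *s v = 0" using 0 by (simp add: P_def f_def)
    then have "annihilate B [] v = 0" using c 0 by simp
    then show ?case by blast
  next
    case (Suc n)
    then have "\<not> constant (poly p)" by (simp add: constant_degree)
    then obtain r where "poly p r = 0" using fundamental_theorem_of_algebra by blast
    then obtain q where q: "p = [:- r, 1:] * q" by (metis dvdE poly_eq_0_iff_dvd)
    then have q0: "q \<noteq> 0" using Suc by auto
    have "degree p = Suc (degree q)" unfolding q using q0 by (subst degree_mult_eq) auto
    then have "n = degree q" using Suc by simp
    moreover have "P q (B *v v - r *s v) = 0" using Suc.prems q P_lin by simp
    ultimately obtain rs where "annihilate B rs (B *v v - r *s v) = 0" using Suc.hyps(1) q0 by blast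
    then have "annihilate B (r # rs) v = 0" by simp
    then show ?case by blast
  qed
  obtain p where "p \<noteq> 0" "P p v = 0" using exists_dependency[of "f v"] by (auto simp: P_def)
  then show ?thesis by (rule main)
qed

text \<open>A shortest annihilating list consists of eigenvalues: its factors commute, so each of them
  may be applied last, to a vector that the other factors leave nonzero.\<close>

lemma annihilate_exists_eigenvalues:
  fixes v :: "complex^'m"
  shows "\<exists>rs. annihilate B rs v = 0 \<and> (\<forall>r\<in>set rs. eigenvalue B r)"
proof -
  obtain rs where rs: "annihilate B rs v = 0" "\<And>ts. annihilate B ts v = 0 \<Longrightarrow> length rs \<le> length ts"
    using ex_has_least_nat[of "\<lambda>rs. annihilate B rs v = 0" _ length] annihilate_exists[of B v] by auto
  have "eigenvalue B r" if "r \<in> set rs" for r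
  proof -
    from split_list[OF that] obtain xs ys where xy: "rs = xs @ r # ys" by auto
    let ?w = "annihilate B (xs @ ys) v"
    have "B *v ?w - r *s ?w = 0"
      using rs(1) unfolding xy by (simp add: annihilate_append annihilate_commute)
    moreover have "?w \<noteq> 0" using rs(2)[of "xs @ ys"] xy by auto
    ultimately show ?thesis unfolding eigenvalue_def by (metis eq_iff_diff_eq_0)
  qed
  then show ?thesis using rs(1) by blast
qed

text \<open>\<open>T\<close> solves \<open>U' = B0 U + \<phi> v\<close> linearly and boundedly in the scalar forcing \<open>\<phi>\<close>.\<close>

definition inverts_dir :: "complex^'m^'m \<Rightarrow> complex^'m \<Rightarrow> ((real \<Rightarrow> complex) \<Rightarrow> real \<Rightarrow> complex^'m) \<Rightarrow> real \<Rightarrow> bool" where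
  "inverts_dir B0 v T C \<longleftrightarrow> C \<ge> 0 \<and>
     (\<forall>\<phi>. bdd_cont \<phi> \<longrightarrow> ode (\<lambda>_. B0) (\<lambda>z. \<phi> z *s v) (T \<phi>) \<and>
        (\<forall>M. (\<forall>z\<ge>0. cmod (\<phi> z) \<le> M) \<longrightarrow> (\<forall>z\<ge>0. norm (T \<phi> z) \<le> C * M))) \<and>
     (\<forall>f g c. \<forall>z\<ge>0. bdd_cont f \<longrightarrow> bdd_cont g \<longrightarrow> T (\<lambda>z. f z + c * g z) z = T f z + c *s T g z)"

definition inverts :: "complex^'m^'m \<Rightarrow> ((real \<Rightarrow> complex^'m) \<Rightarrow> real \<Rightarrow> complex^'m) \<Rightarrow> real \<Rightarrow> bool" where
  "inverts B0 T C \<longleftrightarrow> C \<ge> 0 \<and>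
     (\<forall>f. bdd_cont f \<longrightarrow> ode (\<lambda>_. B0) f (T f) \<and>
        (\<forall>M. (\<forall>z\<ge>0. norm (f z) \<le> M) \<longrightarrow> (\<forall>z\<ge>0. norm (T f z) \<le> C * M))) \<and>
     (\<forall>f g c. \<forall>z\<ge>0. bdd_cont f \<longrightarrow> bdd_cont g \<longrightarrow> T (\<lambda>z. f z + c *s g z) z = T f z + c *s T g z)"

text \<open>The ansatz \<open>resolvent r \<phi> *s v\<close> solves the equation up to a forcing \<open>resolvent r \<phi>\<close> in the
  direction \<open>(B0 - r) v\<close>, which has one annihilating factor less than \<open>v\<close>.\<close>

lemma inverts_dir_step:
  fixes v :: "complex^'m"
  assumes T: "inverts_dir B0 (B0 *v v - r *s v) T C" and r: "Re r \<noteq> 0"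
  shows "inverts_dir B0 v (\<lambda>\<phi> z. resolvent r \<phi> z *s v + T (resolvent r \<phi>) z) ((norm v + C) / \<bar>Re r\<bar>)"
  unfolding inverts_dir_def
proof (intro conjI allI impI)
  show "(norm v + C) / \<bar>Re r\<bar> \<ge> 0" using T by (simp add: inverts_dir_def)
next
  fix \<phi> :: "real \<Rightarrow> complex" assume \<phi>: "bdd_cont \<phi>"
  have T': "ode (\<lambda>_. B0) (\<lambda>z. resolvent r \<phi> z *s (B0 *v v - r *s v)) (T (resolvent r \<phi>))"
    using T resolvent_bdd_cont[OF r \<phi>] by (simp add: inverts_dir_def)
  show "ode (\<lambda>_. B0) (\<lambda>z. \<phi> z *s v) (\<lambda>z. resolvent r \<phi> z *s v + T (resolvent r \<phi>) z)"
    unfolding ode_def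
  proof (intro allI impI)
    fix z :: real assume z: "z \<ge> 0"
    have "((\<lambda>z. resolvent r \<phi> z *s v) has_vector_derivative (r * resolvent r \<phi> z + \<phi> z) *s v) (at z within {0..})"
      using has_vector_derivative_scale[OF resolvent_derivative[OF r \<phi> z], of "\<lambda>_. v" 0] by simp
    from has_vector_derivative_add[OF this odeD[OF T' z]]
    show "((\<lambda>z. resolvent r \<phi> z *s v + T (resolvent r \<phi>) z) has_vector_derivative
        B0 *v (resolvent r \<phi> z *s v + T (resolvent r \<phi>) z) + \<phi> z *s v) (at z within {0..})"
      by (simp add: matrix_vector_right_distrib matvec_scale vec.scale_right_diff_distrib
          vec.scale_left_distrib algebra_simps)
  qed
  fix M z assume M: "\<forall>z\<ge>0. cmod (\<phi> z) \<le> M" and z: "(0 :: real) \<le> z"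
  have b: "cmod (resolvent r \<phi> y) \<le> M / \<bar>Re r\<bar>" if "y \<ge> 0" for y
    using \<phi> M that by (intro resolvent_bound r) (auto simp: bdd_cont_def)
  then have "norm (T (resolvent r \<phi>) z) \<le> C * (M / \<bar>Re r\<bar>)"
    using T resolvent_bdd_cont[OF r \<phi>] z unfolding inverts_dir_def by blast
  moreover have "norm (resolvent r \<phi> z *s v) \<le> (M / \<bar>Re r\<bar>) * norm v"
    unfolding norm_scale by (intro mult_right_mono b z) auto
  ultimately have "norm (resolvent r \<phi> z *s v + T (resolvent r \<phi>) z) \<le> (M / \<bar>Re r\<bar>) * norm v + C * (M / \<bar>Re r\<bar>)"
    by (intro norm_triangle_mono)
  then show "norm (resolvent r \<phi> z *s v + T (resolvent r \<phi>) z) \<le> (norm v + C) / \<bar>Re r\<bar> * M"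
    by (simp add: algebra_simps add_divide_distrib)
next
  fix f g :: "real \<Rightarrow> complex" and c z assume z: "(0 :: real) \<le> z" and fg: "bdd_cont f" "bdd_cont g"
  have rl: "resolvent r (\<lambda>z. f z + c * g z) y = resolvent r f y + c * resolvent r g y" if "y \<ge> 0" for y
    by (rule resolvent_linear[OF r fg that])
  have Tl: "T (\<lambda>z. f z + c * g z) z = T f z + c *s T g z" if "bdd_cont f" "bdd_cont g" for f g c
    using T that z by (simp add: inverts_dir_def)
  have loc: "T f z = T g z" if "bdd_cont f" "bdd_cont g" "\<And>y. y \<ge> 0 \<Longrightarrow> f y = g y" for f g
  proof -
    have bc: "bdd_cont (\<lambda>z. f z + (- 1) * g z)"
      using that(1,2) that(3) unfolding bdd_cont_def
      by (auto intro!: continuous_intros simp: bounded_half_line_iff)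
    have "\<forall>y\<ge>0. cmod (f y + (- 1) * g y) \<le> 0" using that(3) by simp
    then have "norm (T (\<lambda>z. f z + (- 1) * g z) z) \<le> C * 0"
      using T bc z unfolding inverts_dir_def by blast
    then show ?thesis using Tl[OF that(1,2), of "- 1"] by simp
  qed
  have lin: "bdd_cont (\<lambda>z. resolvent r f z + c * resolvent r g z)"
    using resolvent_bdd_cont[OF r fg(1)] resolvent_bdd_cont[OF r fg(2)] unfolding bdd_cont_def
  proof (intro conjI; elim conjE)
    assume "bounded (resolvent r f ` {0..})" "bounded (resolvent r g ` {0..})"
    then obtain M N where "\<forall>z\<ge>0. cmod (resolvent r f z) \<le> M" "\<forall>z\<ge>0. cmod (resolvent r g z) \<le> N"
      by (auto simp: bounded_half_line_iff)
    then have "\<forall>z\<ge>0. cmod (resolvent r f z + c * resolvent r g z) \<le> M + cmod c * N"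
      by (auto simp: norm_mult intro!: norm_triangle_mono mult_left_mono)
    then show "bounded ((\<lambda>z. resolvent r f z + c * resolvent r g z) ` {0..})" by (auto simp: bounded_half_line_iff)
  qed (auto intro!: continuous_intros)
  have fgc: "bdd_cont (\<lambda>z. f z + c * g z)"
  proof -
    obtain M N where "\<forall>z\<ge>0. cmod (f z) \<le> M" "\<forall>z\<ge>0. cmod (g z) \<le> N"
      using fg by (auto simp: bounded_half_line_iff bdd_cont_def)
    then have "\<forall>z\<ge>0. cmod (f z + c * g z) \<le> M + cmod c * N"
      by (auto simp: norm_mult intro!: norm_triangle_mono mult_left_mono)
    then show ?thesis using fg by (auto simp: bounded_half_line_iff bdd_cont_def intro!: continuous_intros)
  qed
  have "T (resolvent r (\<lambda>z. f z + c * g z)) z = T (\<lambda>z. resolvent r f z + c * resolvent r g z) z"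
    by (rule loc[OF resolvent_bdd_cont[OF r fgc] lin rl])
  also have "\<dots> = T (resolvent r f) z + c *s T (resolvent r g) z"
    by (intro Tl resolvent_bdd_cont r fg)
  finally show "resolvent r (\<lambda>z. f z + c * g z) z *s v + T (resolvent r (\<lambda>z. f z + c * g z)) z =
      resolvent r f z *s v + T (resolvent r f) z + c *s (resolvent r g z *s v + T (resolvent r g) z)"
    by (simp add: rl[OF z] vec.scale_right_distrib vec.scale_left_distrib)
qed

lemma inverts_dir_zero: "inverts_dir B0 0 (\<lambda>_ _. 0) 0"
  by (simp add: inverts_dir_def ode_def)

lemma inverts_dir_exists:
  assumes "annihilate B0 rs v = 0" "\<And>r. r \<in> set rs \<Longrightarrow> Re r \<noteq> 0"
  shows "\<exists>T C. inverts_dir B0 v T C"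
  using assms
proof (induct rs arbitrary: v)
  case Nil
  then show ?case using inverts_dir_zero by auto
next
  case (Cons r rs)
  have "\<exists>T C. inverts_dir B0 (B0 *v v - r *s v) T C"
    using Cons.prems by (intro Cons.hyps) auto
  then obtain T C where "inverts_dir B0 (B0 *v v - r *s v) T C" by blast
  then show ?case using inverts_dir_step[of B0 v r T C] Cons.prems by auto
qed

lemma inverts_of_dirs:
  fixes B0 :: "complex^'m^'m"
  assumes T: "\<And>i. inverts_dir B0 (axis i 1) (T i) (C i)"
  shows "inverts B0 (\<lambda>f z. \<Sum>i\<in>UNIV. T i (\<lambda>z. f z $ i) z) (\<Sum>i\<in>UNIV. C i)"
  unfolding inverts_def
proof (intro conjI allI impI)
  show "(\<Sum>i\<in>UNIV. C i) \<ge> 0" using T by (auto simp: inverts_dir_def intro: sum_nonneg)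
next
  fix f :: "real \<Rightarrow> complex^'m" assume f: "bdd_cont f"
  have fi: "bdd_cont (\<lambda>z. f z $ i)" for i
  proof -
    obtain M where "\<forall>z\<ge>0. norm (f z) \<le> M" using f by (auto simp: bounded_half_line_iff bdd_cont_def)
    then have "\<forall>z\<ge>0. cmod (f z $ i) \<le> M" using Finite_Cartesian_Product.norm_nth_le order_trans by blast
    then show ?thesis using f by (auto simp: bounded_half_line_iff bdd_cont_def intro!: continuous_intros)
  qed
  show "ode (\<lambda>_. B0) f (\<lambda>z. \<Sum>i\<in>UNIV. T i (\<lambda>z. f z $ i) z)"
    unfolding ode_def
  proof (intro allI impI)
    fix z :: real assume z: "z \<ge> 0"
    have "(T i (\<lambda>z. f z $ i) has_vector_derivative
        B0 *v T i (\<lambda>z. f z $ i) z + f z $ i *s axis i 1) (at z within {0..})" for i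
      using T[of i] fi[of i] odeD[OF _ z] by (auto simp: inverts_dir_def)
    then have "((\<lambda>z. \<Sum>i\<in>UNIV. T i (\<lambda>z. f z $ i) z) has_vector_derivative
        (\<Sum>i\<in>UNIV. B0 *v T i (\<lambda>z. f z $ i) z + f z $ i *s axis i 1)) (at z within {0..})"
      by (intro has_vector_derivative_sum)
    moreover have "(\<Sum>i\<in>UNIV. B0 *v T i (\<lambda>z. f z $ i) z + f z $ i *s axis i 1) =
        B0 *v (\<Sum>i\<in>UNIV. T i (\<lambda>z. f z $ i) z) + f z"
      by (simp add: sum.distrib basis_expansion vec.linear_sum[of "(*v) B0"] matrix_vector_mul_linear_gen)
    ultimately show "((\<lambda>z. \<Sum>i\<in>UNIV. T i (\<lambda>z. f z $ i) z) has_vector_derivative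
        B0 *v (\<Sum>i\<in>UNIV. T i (\<lambda>z. f z $ i) z) + f z) (at z within {0..})" by simp
  qed
  fix M z assume M: "\<forall>z\<ge>0. norm (f z) \<le> M" and z: "(0 :: real) \<le> z"
  have "norm (T i (\<lambda>z. f z $ i) z) \<le> C i * M" for i
  proof -
    have "\<forall>z\<ge>0. cmod (f z $ i) \<le> M" using M Finite_Cartesian_Product.norm_nth_le order_trans by blast
    then show ?thesis using T[of i] fi[of i] z unfolding inverts_dir_def by blast
  qed
  then have "norm (\<Sum>i\<in>UNIV. T i (\<lambda>z. f z $ i) z) \<le> (\<Sum>i\<in>UNIV. C i * M)"
    by (intro sum_norm_le)
  then show "norm (\<Sum>i\<in>UNIV. T i (\<lambda>z. f z $ i) z) \<le> (\<Sum>i\<in>UNIV. C i) * M"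
    by (simp add: sum_distrib_right)
next
  fix f g :: "real \<Rightarrow> complex^'m" and c z assume z: "(0 :: real) \<le> z" and fg: "bdd_cont f" "bdd_cont g"
  have fi: "bdd_cont (\<lambda>z. f z $ i)" if f: "bdd_cont f" for i and f :: "real \<Rightarrow> complex^'m"
  proof -
    obtain M where "\<forall>z\<ge>0. norm (f z) \<le> M" using f by (auto simp: bounded_half_line_iff bdd_cont_def)
    then have "\<forall>z\<ge>0. cmod (f z $ i) \<le> M" using Finite_Cartesian_Product.norm_nth_le order_trans by blast
    then show ?thesis using f by (auto simp: bounded_half_line_iff bdd_cont_def intro!: continuous_intros)
  qed
  have "T i (\<lambda>z. (f z + c *s g z) $ i) z = T i (\<lambda>z. f z $ i) z + c *s T i (\<lambda>z. g z $ i) z" for i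
    using T[of i] fi[OF fg(1)] fi[OF fg(2)] z by (simp add: inverts_dir_def)
  then show "(\<Sum>i\<in>UNIV. T i (\<lambda>z. (f z + c *s g z) $ i) z) =
      (\<Sum>i\<in>UNIV. T i (\<lambda>z. f z $ i) z) + c *s (\<Sum>i\<in>UNIV. T i (\<lambda>z. g z $ i) z)"
    by (simp add: sum.distrib vec.scale_sum_right)
qed

lemma hyperbolic_inverts:
  fixes B0 :: "complex^'m^'m"
  assumes "hyperbolic B0"
  obtains T C where "C > 0" "inverts B0 T C"
proof -
  have "\<exists>T C. inverts_dir B0 v T C" for v
    using annihilate_exists_eigenvalues[of B0 v] inverts_dir_exists assms unfolding hyperbolic_def by metis
  then have "\<forall>i. \<exists>TC. inverts_dir B0 (axis i 1) (fst TC) (snd TC)" by simp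
  then obtain TC where TC: "\<And>i. inverts_dir B0 (axis i 1) (fst (TC i)) (snd (TC i))"
    using choice by metis
  from inverts_of_dirs[OF TC] obtain T' C' where T': "inverts B0 T' C'" by blast
  have "inverts B0 T' (C' + 1)"
    unfolding inverts_def
  proof (intro conjI allI impI)
    fix f :: "real \<Rightarrow> complex^'m" and M z assume f: "bdd_cont f" "\<forall>z\<ge>0. norm (f z) \<le> M" "(0::real) \<le> z"
    have "M \<ge> 0" using f(2,3) norm_ge_zero order_trans by blast
    moreover have "norm (T' f z) \<le> C' * M" using T' f by (auto simp: inverts_def)
    ultimately show "norm (T' f z) \<le> (C' + 1) * M" by (simp add: distrib_right)
  qed (use T' in \<open>auto simp: inverts_def\<close>)
  moreover have "C' + 1 > 0" using T' by (simp add: inverts_def)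
  ultimately show ?thesis using that by blast
qed

lemma inverts_scalar:
  assumes "r > 0"
  obtains T where "inverts (mat (complex_of_real (- r)) :: complex^'m^'m) T (real CARD('m) / r)"
proof -
  let ?B = "mat (complex_of_real (- r)) :: complex^'m^'m"
  have "inverts_dir ?B (axis i 1) (\<lambda>\<phi> z. resolvent (complex_of_real (- r)) \<phi> z *s axis i 1 + 0) ((norm (axis i 1 :: complex^'m) + 0) / \<bar>Re (complex_of_real (- r))\<bar>)" for i :: 'm
    using inverts_dir_step[of ?B "axis i 1" "complex_of_real (- r)" "\<lambda>_ _. 0" 0] inverts_dir_zero[of ?B] assms
    by (simp add: mat_matvec)
  moreover have "norm (axis i 1 :: complex^'m) = 1" for i
  proof -
    have "hermitian (axis i 1 :: complex^'m) (axis i 1) = 1"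
      by (simp add: hermitian_def axis_def if_distrib cong: if_cong)
    then show ?thesis using norm_ge_zero[of "axis i 1 :: complex^'m"]
      unfolding hermitian_self of_real_eq_1_iff by (simp add: power2_eq_1_iff del: norm_ge_zero)
  qed
  ultimately have "inverts_dir ?B (axis i 1) (\<lambda>\<phi> z. resolvent (complex_of_real (- r)) \<phi> z *s axis i 1 + 0) (1 / r)" for i :: 'm
    using assms by simp
  from inverts_of_dirs[OF this] show ?thesis using that by simp
qed

section \<open>Bounded solutions under perturbation of the coefficients\<close>

text \<open>Turns the a priori estimate of a contraction into a bound: the supremum \<open>m\<close> of \<open>\<bar>f\<bar>\<close> satisfies
  \<open>m \<le> a + m / 2\<close>.\<close>

lemma half_bound:
  fixes f :: "real \<Rightarrow> 'a::real_normed_vector"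
  assumes "bounded (f ` {0..})"
    and step: "\<And>m y. (\<And>z. z \<ge> 0 \<Longrightarrow> norm (f z) \<le> m) \<Longrightarrow> y \<ge> 0 \<Longrightarrow> norm (f y) \<le> a + m / 2"
    and y: "y \<ge> 0"
  shows "norm (f y) \<le> 2 * a"
proof -
  define s where "s = (SUP z\<in>{0..}. norm (f z))"
  have bdd: "bdd_above ((\<lambda>z. norm (f z)) ` {0..})"
    using assms(1) by (auto simp: bounded_half_line_iff bdd_above_def)
  have le: "norm (f z) \<le> s" if "z \<ge> 0" for z
    unfolding s_def using bdd that by (intro cSUP_upper) auto
  have "s \<le> a + s / 2"
    unfolding s_def by (rule cSUP_least) (use step le in \<open>auto simp: s_def\<close>)
  then show ?thesis using le[OF y] by simp
qed

lemma inverts_cong: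
  assumes T: "inverts B0 T C" and fg: "bdd_cont f" "bdd_cont g" "\<And>y. y \<ge> 0 \<Longrightarrow> f y = g y" and z: "z \<ge> 0"
  shows "T f z = T g z"
proof -
  have "bdd_cont (\<lambda>z. f z + (- 1) *s g z)" using fg by (intro bdd_cont_add_scale)
  moreover have "\<forall>y\<ge>0. norm (f y + (- 1) *s g y) \<le> 0" using fg(3) by simp
  ultimately have "norm (T (\<lambda>z. f z + (- 1) *s g z) z) \<le> C * 0"
    using T z unfolding inverts_def by blast
  moreover have "T (\<lambda>z. f z + (- 1) *s g z) z = T f z + (- 1) *s T g z"
    using T fg z unfolding inverts_def by blast
  ultimately show ?thesis by simp
qed

lemma inverts_lin:
  "inverts B0 T C \<Longrightarrow> bdd_cont f \<Longrightarrow> bdd_cont g \<Longrightarrow> z \<ge> 0 \<Longrightarrow> T (\<lambda>z. f z + c *s g z) z = T f z + c *s T g z"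
  unfolding inverts_def by blast

lemma inverts_ode: "inverts B0 T C \<Longrightarrow> bdd_cont f \<Longrightarrow> ode (\<lambda>_. B0) f (T f)"
  unfolding inverts_def by blast

lemma inverts_bound:
  "inverts B0 T C \<Longrightarrow> bdd_cont f \<Longrightarrow> (\<And>z. z \<ge> 0 \<Longrightarrow> norm (f z) \<le> M) \<Longrightarrow> z \<ge> 0 \<Longrightarrow> norm (T f z) \<le> C * M"
  unfolding inverts_def by blast

lemma inverts_bdd_cont: assumes "inverts B0 T C" "bdd_cont f" shows "bdd_cont (T f)"
proof -
  obtain M where M: "\<forall>z\<ge>0. norm (f z) \<le> M" using assms by (auto simp: bdd_cont_def bounded_half_line_iff)
  then have "\<forall>z\<ge>0. norm (T f z) \<le> C * M" using assms inverts_bound by blast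
  then show ?thesis using ode_continuous[OF inverts_ode[OF assms]]
    by (auto simp: bdd_cont_def bounded_half_line_iff)
qed

lemma bdd_cont_matvec:
  fixes E :: "real \<Rightarrow> complex^'n^'m"
  assumes "continuous_on {0..} E" "\<And>z. z \<ge> 0 \<Longrightarrow> norm (E z) \<le> e" "bdd_cont U"
  shows "bdd_cont (\<lambda>t. E t *v U t)"
proof -
  obtain M where M: "\<forall>z\<ge>0. norm (U z) \<le> M" using assms by (auto simp: bdd_cont_def bounded_half_line_iff)
  have "norm (E z *v U z) \<le> e * M" if "z \<ge> 0" for z
    using norm_matvec_le[of "E z" "U z"] mult_mono[OF assms(2)[OF that], of "norm (U z)" M] M that
      order_trans[OF norm_ge_zero assms(2)[OF that]] by fastforce
  then show ?thesis using assms by (auto simp: bdd_cont_def bounded_half_line_iff intro!: continuous_intros)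
qed

text \<open>Banach's theorem on the bounded continuous functions on the real line. A function on the half-line
  is continued by the constant \<open>u 0\<close> to the left, which is what \<open>max 0\<close> does.\<close>

lemma perturbed_fixpoint:
  fixes B0 :: "complex^'m^'m"
  assumes T: "inverts B0 T C" and E: "continuous_on {0..} E" "\<And>z. z \<ge> 0 \<Longrightarrow> norm (E z) \<le> e" and e: "C * e \<le> 1 / 2"
    and V: "bdd_cont V"
  obtains U where "bdd_cont U" "\<And>z. z \<ge> 0 \<Longrightarrow> U z = V z + T (\<lambda>t. E t *v U t) z"
proof -
  have C0: "C \<ge> 0" using T by (simp add: inverts_def)
  have e0: "e \<ge> 0" using E(2)[of 0] norm_ge_zero[of "E 0"] by linarith
  define r where "r u z = apply_bcontfun u (max 0 z)" for u :: "real \<Rightarrow>\<^sub>C (complex^'m)" and z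
  have bc_r: "bdd_cont (r u)" for u
  proof -
    have "continuous_on {0..} (r u)"
      unfolding r_def by (intro continuous_on_compose2[OF continuous_on_apply_bcontfun[of UNIV]] continuous_intros) auto
    moreover have "\<forall>z\<ge>0. norm (r u z) \<le> norm u" unfolding r_def using norm_bounded by blast
    ultimately show ?thesis by (auto simp: bdd_cont_def bounded_half_line_iff)
  qed
  define P where "P u z = V (max 0 z) + T (\<lambda>t. E t *v r u t) (max 0 z)" for u z
  have bcE: "bdd_cont (\<lambda>t. E t *v r u t)" for u by (rule bdd_cont_matvec[OF E bc_r])
  have P: "P u \<in> bcontfun" for u
  proof -
    have TE: "bdd_cont (T (\<lambda>t. E t *v r u t))" by (rule inverts_bdd_cont[OF T bcE])
    then obtain M N where "\<forall>z\<ge>0. norm (V z) \<le> M" "\<forall>z\<ge>0. norm (T (\<lambda>t. E t *v r u t) z) \<le> N"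
      using V by (auto simp: bdd_cont_def bounded_half_line_iff)
    then have "norm (P u z) \<le> M + N" for z
      unfolding P_def by (intro norm_triangle_mono) auto
    moreover have "continuous_on UNIV (P u)"
    proof -
      have cm: "continuous_on UNIV (\<lambda>z. f (max 0 z))" if "bdd_cont f" for f :: "real \<Rightarrow> complex^'m"
      proof (rule continuous_on_compose2[where g = f])
        show "continuous_on {0..} f" using that by (simp add: bdd_cont_def)
        show "continuous_on UNIV (\<lambda>z::real. max 0 z)" by (intro continuous_intros)
      qed auto
      show ?thesis unfolding P_def by (intro continuous_on_add cm V TE)
    qed
    ultimately show ?thesis by (intro bcontfun_normI)
  qed
  have "\<exists>!u. Bcontfun (P u) = u"
  proof (rule banach_fix_type[of "1/2"])
    show "\<forall>u w. dist (Bcontfun (P u)) (Bcontfun (P w)) \<le> 1 / 2 * dist u w"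
    proof (intro allI)
      fix u w
      have "dist (P u z) (P w z) \<le> 1 / 2 * dist u w" for z
      proof -
        let ?z = "max 0 z"
        have "P u z - P w z = T (\<lambda>t. E t *v r u t) ?z + (- 1) *s T (\<lambda>t. E t *v r w t) ?z"
          by (simp add: P_def)
        also have "\<dots> = T (\<lambda>t. E t *v r u t + (- 1) *s (E t *v r w t)) ?z"
          by (rule inverts_lin[OF T bcE bcE, symmetric]) simp
        also have "norm \<dots> \<le> C * (e * dist u w)"
        proof (rule inverts_bound[OF T bdd_cont_add_scale[OF bcE bcE]])
          fix y :: real assume y: "y \<ge> 0"
          have "E y *v r u y + (- 1) *s (E y *v r w y) = E y *v (r u y - r w y)"
            by (simp add: matrix_vector_mult_diff_distrib)
          also have "norm \<dots> \<le> norm (E y) * dist (r u y) (r w y)"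
            unfolding dist_norm by (rule norm_matvec_le)
          also have "\<dots> \<le> e * dist u w"
            unfolding r_def using e0 by (intro mult_mono E y dist_bounded) auto
          finally show "norm (E y *v r u y + (- 1) *s (E y *v r w y)) \<le> e * dist u w" .
        qed simp
        also have "\<dots> \<le> 1 / 2 * dist u w"
          using mult_right_mono[OF e, of "dist u w"] by (simp add: mult.assoc)
        finally show ?thesis by (simp add: dist_norm)
      qed
      then show "dist (Bcontfun (P u)) (Bcontfun (P w)) \<le> 1 / 2 * dist u w"
        by (intro dist_bound) (simp add: Bcontfun_inverse P)
    qed
  qed auto
  then obtain u where "Bcontfun (P u) = u" by blast
  then have "apply_bcontfun u z = P u z" for z by (metis Bcontfun_inverse P)
  then have "r u z = V z + T (\<lambda>t. E t *v r u t) z" if "z \<ge> 0" for z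
    using that by (simp add: r_def[of u z] P_def)
  with bc_r that show ?thesis by blast
qed

lemma ode_perturb:
  assumes W: "ode (\<lambda>_. B0) (\<lambda>t. (B t - B0) *v U t + g t) W" and eq: "\<And>z. z \<ge> 0 \<Longrightarrow> U z = W z"
  shows "ode B g U"
  unfolding ode_def
proof (intro allI impI)
  fix z :: real assume z: "z \<ge> 0"
  have "(W has_vector_derivative B z *v U z + g z) (at z within {0..})"
    using odeD[OF W z] eq[OF z] by (simp add: matrix_vector_mult_diff_rdistrib)
  then show "(U has_vector_derivative B z *v U z + g z) (at z within {0..})"
    by (rule has_vector_derivative_transform[rotated 2]) (use z eq in auto)
qed

text \<open>The relation between a bounded solution \<open>U\<close> of the perturbed and \<open>V\<close> of the unperturbed
  system is \<open>V = U - T (B - B0) U\<close>. It is bijective since \<open>T (B - B0)\<close> has norm at most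
  \<open>1/2\<close>.\<close>

theorem bounded_data_dim_perturb:
  fixes B0 :: "complex^'m^'m"
  assumes T: "inverts B0 T C" and B: "continuous_on {0..} B" "\<And>z. z \<ge> 0 \<Longrightarrow> norm (B z - B0) \<le> e"
    and e: "C * e \<le> 1 / 2"
  shows "vec.dim (bounded_data B) = vec.dim (bounded_data (\<lambda>_. B0))"
proof -
  let ?E = "\<lambda>t. B t - B0"
  have E: "continuous_on {0..} ?E" by (intro continuous_intros B)
  have C0: "C \<ge> 0" using T by (simp add: inverts_def)
  have bcE: "bdd_cont (\<lambda>t. ?E t *v U t)" if "bdd_cont U" for U
    by (rule bdd_cont_matvec[OF E B(2) that])
  define rel where "rel U V \<longleftrightarrow> sol B U \<and> bdd_cont U \<and> sol (\<lambda>_. B0) V \<and> bdd_cont V \<and>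
    (\<forall>z\<ge>0. U z = V z + T (\<lambda>t. ?E t *v U t) z)" for U V
  define R where "R x y \<longleftrightarrow> (\<exists>U V. rel U V \<and> x = U 0 \<and> y = V 0)" for x y
  have relD: "sol B U" "bdd_cont U" "sol (\<lambda>_. B0) V" "bdd_cont V"
    "\<And>z. z \<ge> 0 \<Longrightarrow> U z = V z + T (\<lambda>t. ?E t *v U t) z" if "rel U V" for U V
    using that unfolding rel_def by blast+
  have lin: "rel (\<lambda>z. U z + c *s U' z) (\<lambda>z. V z + c *s V' z)" if "rel U V" "rel U' V'" for U V U' V' c
  proof -
    note r = relD[OF that(1)] and r' = relD[OF that(2)]
    have TT: "T (\<lambda>t. ?E t *v (U t + c *s U' t)) z = T (\<lambda>t. ?E t *v U t) z + c *s T (\<lambda>t. ?E t *v U' t) z"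
      if "z \<ge> 0" for z
      using inverts_lin[OF T bcE[OF r(2)] bcE[OF r'(2)] that, of c]
      by (simp add: matrix_vector_right_distrib matvec_scale)
    show ?thesis
      unfolding rel_def
    proof (intro conjI allI impI)
      show "sol B (\<lambda>z. U z + c *s U' z)" using ode_add_scale[OF r(1) r'(1), of c] by simp
      show "sol (\<lambda>_. B0) (\<lambda>z. V z + c *s V' z)" using ode_add_scale[OF r(3) r'(3), of c] by simp
      show "U z + c *s U' z = V z + c *s V' z + T (\<lambda>t. ?E t *v (U t + c *s U' t)) z" if "z \<ge> 0" for z
        unfolding TT[OF that] by (subst r(5)[OF that], subst r'(5)[OF that]) (simp add: vec.scale_right_distrib)
    qed (intro bdd_cont_add_scale r r')+
  qed
  have T_zero: "T (\<lambda>_. 0) z = 0" if "z \<ge> 0" for z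
    using inverts_bound[OF T _ _ that, of "\<lambda>_. 0" 0] by (simp add: bdd_cont_def image_constant_conv)
  have rel0: "rel (\<lambda>_. 0) (\<lambda>_. 0)"
    using T_zero by (simp add: rel_def sol_zero bdd_cont_def image_constant_conv)
  have add: "R (x + x') (y + y')" if "R x y" "R x' y'" for x y x' y'
  proof -
    from that obtain U V U' V' where "rel U V" "rel U' V'" "x = U 0" "y = V 0" "x' = U' 0" "y' = V' 0"
      unfolding R_def by blast
    then show ?thesis using lin[of U V U' V' 1] unfolding R_def
      by (intro exI[of _ "\<lambda>z. U z + 1 *s U' z"] exI[of _ "\<lambda>z. V z + 1 *s V' z"]) auto
  qed
  have scale: "R (c *s x) (c *s y)" if "R x y" for c x y
  proof -
    from that obtain U V where "rel U V" "x = U 0" "y = V 0" unfolding R_def by blast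
    then show ?thesis using lin[OF rel0, of U V c] unfolding R_def
      by (intro exI[of _ "\<lambda>z. 0 + c *s U z"] exI[of _ "\<lambda>z. 0 + c *s V z"]) auto
  qed
  have to_V: "\<exists>V. rel U V" if "sol B U" "bdd_cont U" for U
  proof -
    let ?V = "\<lambda>z. U z + (- 1) *s T (\<lambda>t. ?E t *v U t) z"
    have "sol (\<lambda>_. B0) ?V"
      unfolding ode_def
    proof (intro allI impI)
      fix z :: real assume z: "z \<ge> 0"
      have "(?V has_vector_derivative B z *v U z + 0 + (- 1) *s (B0 *v T (\<lambda>t. ?E t *v U t) z + ?E z *v U z)) (at z within {0..})"
        by (intro has_vector_derivative_add has_vector_derivative_const_scale
            odeD[OF that(1) z] odeD[OF inverts_ode[OF T bcE[OF that(2)]] z])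
      then show "(?V has_vector_derivative B0 *v ?V z + 0) (at z within {0..})"
        by (simp add: matrix_vector_mult_diff_rdistrib matrix_vector_mult_diff_distrib)
    qed
    moreover have "bdd_cont ?V"
      by (intro bdd_cont_add_scale inverts_bdd_cont[OF T] bcE that)
    ultimately have "rel U ?V" using that by (auto simp: rel_def)
    then show ?thesis by blast
  qed
  have to_U: "\<exists>U. rel U V" if V: "sol (\<lambda>_. B0) V" "bdd_cont V" for V
  proof -
    obtain U where U: "bdd_cont U" "\<And>z. z \<ge> 0 \<Longrightarrow> U z = V z + T (\<lambda>t. ?E t *v U t) z"
      using perturbed_fixpoint[OF T E B(2) e V(2)] by blast
    have "ode (\<lambda>_. B0) (\<lambda>t. ?E t *v U t + 0) (\<lambda>z. V z + T (\<lambda>t. ?E t *v U t) z)"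
      using ode_add_scale[OF V(1) inverts_ode[OF T bcE[OF U(1)]], of 1] by simp
    then have "sol B U" by (rule ode_perturb) (rule U)
    then show ?thesis using U V unfolding rel_def by blast
  qed
  have U_zero: "U 0 = 0" if "rel U V" "V 0 = 0" for U V
  proof -
    have V: "V z = 0" if "z \<ge> 0" for z
      by (rule sol_zero_propagates[OF relD(3)[OF \<open>rel U V\<close>] _ _ \<open>V 0 = 0\<close> that]) auto
    have "norm (U 0) \<le> 2 * 0"
    proof (rule half_bound)
      show "bounded (U ` {0..})" using relD(2)[OF that(1)] by (simp add: bdd_cont_def)
      fix m y assume m: "\<And>z. z \<ge> 0 \<Longrightarrow> norm (U z) \<le> m" and y: "(0::real) \<le> y"
      have m0: "m \<ge> 0" using m[of 0] norm_ge_zero[of "U 0"] by linarith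
      have "norm (T (\<lambda>t. ?E t *v U t) y) \<le> C * (e * m)"
      proof (rule inverts_bound[OF T bcE _ y])
        show "bdd_cont U" by (rule relD(2)[OF that(1)])
        fix z :: real assume z: "z \<ge> 0"
        show "norm (?E z *v U z) \<le> e * m"
          using norm_matvec_le mult_mono[OF B(2)[OF z] m[OF z] order_trans[OF norm_ge_zero B(2)[OF z]] norm_ge_zero]
          by (rule order_trans)
      qed
      also have "\<dots> \<le> 1 / 2 * m" using mult_right_mono[OF e m0] by (simp add: mult.assoc)
      finally show "norm (U y) \<le> 0 + m / 2"
        by (subst relD(5)[OF that(1) y]) (simp add: V[OF y])
    qed simp
    then show ?thesis by simp
  qed
  have V_zero: "V 0 = 0" if "rel U V" "U 0 = 0" for U V
  proof -
    have U: "U z = 0" if "z \<ge> 0" for z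
      by (rule sol_zero_propagates[OF relD(1)[OF \<open>rel U V\<close>] B(1) _ \<open>U 0 = 0\<close> that]) simp
    have "T (\<lambda>t. ?E t *v U t) 0 = T (\<lambda>_. 0) 0"
      by (rule inverts_cong[OF T bcE[OF relD(2)[OF that(1)]]])
        (use U in \<open>auto simp: bdd_cont_def image_constant_conv\<close>)
    then show ?thesis using relD(5)[OF that(1), of 0] that(2) T_zero[of 0] by simp
  qed
  have data: "x \<in> bounded_data B' \<longleftrightarrow> (\<exists>U. sol B' U \<and> bdd_cont U \<and> x = U 0)" for x B'
    unfolding bounded_data_def bdd_cont_def using ode_continuous by auto
  show ?thesis
  proof (rule antisym)
    show "vec.dim (bounded_data B) \<le> vec.dim (bounded_data (\<lambda>_. B0))"
    proof (rule dim_le_by_relation[where R = R])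
      show "\<exists>y\<in>bounded_data (\<lambda>_. B0). R x y" if "x \<in> bounded_data B" for x
      proof -
        from that obtain U where U: "sol B U" "bdd_cont U" "x = U 0" unfolding data by blast
        then obtain V where V: "rel U V" using to_V by blast
        then have "V 0 \<in> bounded_data (\<lambda>_. B0)" unfolding data rel_def by blast
        then show ?thesis using U V R_def by blast
      qed
      show "x = 0" if "R x 0" for x using that U_zero unfolding R_def by metis
    qed (rule subspace_bounded_data add scale; assumption?)+
    show "vec.dim (bounded_data (\<lambda>_. B0)) \<le> vec.dim (bounded_data B)"
    proof (rule dim_le_by_relation[where R = "\<lambda>y x. R x y"])
      show "\<exists>y\<in>bounded_data B. R y x" if "x \<in> bounded_data (\<lambda>_. B0)" for x
      proof -
        from that obtain V where V: "sol (\<lambda>_. B0) V" "bdd_cont V" "x = V 0" unfolding data by blast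
        then obtain U where U: "rel U V" using to_U by blast
        then have "U 0 \<in> bounded_data B" unfolding data rel_def by blast
        then show ?thesis using U V R_def by blast
      qed
      show "x = 0" if "R 0 x" for x using that V_zero unfolding R_def by metis
    qed (rule subspace_bounded_data add scale; assumption?)+
  qed
qed

text \<open>The same fixed point argument, starting from \<open>T g\<close> instead of a homogeneous solution.\<close>

lemma perturbed_inverts:
  fixes B0 :: "complex^'m^'m"
  assumes T: "inverts B0 T C" and B: "continuous_on {0..} B" "\<And>z. z \<ge> 0 \<Longrightarrow> norm (B z - B0) \<le> e"
    and e: "C * e \<le> 1 / 2" and g: "bdd_cont g" and M: "\<And>z. z \<ge> 0 \<Longrightarrow> norm (g z) \<le> M"
  obtains D where "ode B g D" "\<And>z. z \<ge> 0 \<Longrightarrow> norm (D z) \<le> 2 * (C * M)"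
proof -
  let ?E = "\<lambda>t. B t - B0"
  have E: "continuous_on {0..} ?E" by (intro continuous_intros B)
  obtain D where D: "bdd_cont D" "\<And>z. z \<ge> 0 \<Longrightarrow> D z = T g z + T (\<lambda>t. ?E t *v D t) z"
    using perturbed_fixpoint[OF T E B(2) e inverts_bdd_cont[OF T g]] by blast
  have bcE: "bdd_cont (\<lambda>t. ?E t *v D t)" by (rule bdd_cont_matvec[OF E B(2) D(1)])
  have "ode (\<lambda>_. B0) (\<lambda>t. ?E t *v D t + g t) (\<lambda>z. T g z + T (\<lambda>t. ?E t *v D t) z)"
    using ode_add_scale[OF inverts_ode[OF T g] inverts_ode[OF T bcE], of 1] by (simp add: add.commute)
  then have "ode B g D" by (rule ode_perturb) (rule D)
  moreover have "norm (D z) \<le> 2 * (C * M)" if z: "z \<ge> 0" for z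
  proof (rule half_bound[OF _ _ z])
    show "bounded (D ` {0..})" using D by (simp add: bdd_cont_def)
    fix m y assume m: "\<And>z. z \<ge> 0 \<Longrightarrow> norm (D z) \<le> m" and y: "(0::real) \<le> y"
    have m0: "m \<ge> 0" using m[of 0] norm_ge_zero[of "D 0"] by linarith
    have "norm (T (\<lambda>t. ?E t *v D t) y) \<le> C * (e * m)"
    proof (rule inverts_bound[OF T bcE _ y])
      fix z :: real assume z: "z \<ge> 0"
      show "norm (?E z *v D z) \<le> e * m"
        using norm_matvec_le mult_mono[OF B(2)[OF z] m[OF z] order_trans[OF norm_ge_zero B(2)[OF z]] norm_ge_zero]
        by (rule order_trans)
    qed
    also have "\<dots> \<le> m / 2" using mult_right_mono[OF e m0] by (simp add: mult.assoc)
    finally show "norm (D y) \<le> C * M + m / 2"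
      unfolding D(2)[OF y] by (intro norm_triangle_mono inverts_bound[OF T g M y])
  qed
  ultimately show ?thesis using that by blast
qed

section \<open>Systems with a hyperbolic limit\<close>

lemma mat_matvec_add: "(B + mat c) *v x = B *v x + c *s x" for B :: "complex^'m^'m"
  by (simp add: matrix_vector_mult_add_rdistrib mat_matvec)

text \<open>Multiplication by \<open>exp (d z)\<close> shifts the coefficient, and hence its spectrum, by \<open>d\<close>.\<close>

lemma ode_weight:
  assumes "ode B f U"
  shows "ode (\<lambda>z. B z + mat (complex_of_real d)) (\<lambda>z. complex_of_real (exp (d * z)) *s f z)
    (\<lambda>z. complex_of_real (exp (d * z)) *s U z)"
  unfolding ode_def
proof (intro allI impI)
  fix z :: real assume z: "z \<ge> 0"
  have e: "((\<lambda>z. complex_of_real (exp (d * z))) has_vector_derivative complex_of_real (d * exp (d * z))) (at z within {0..})"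
    by (intro has_vector_derivative_of_real)
      (auto intro!: derivative_eq_intros simp: has_real_derivative_iff_has_vector_derivative[symmetric])
  from has_vector_derivative_scale[OF e odeD[OF assms z]]
  show "((\<lambda>z. complex_of_real (exp (d * z)) *s U z) has_vector_derivative
      (B z + mat (complex_of_real d)) *v (complex_of_real (exp (d * z)) *s U z) +
      complex_of_real (exp (d * z)) *s f z) (at z within {0..})"
    by (simp add: mat_matvec matrix_vector_mult_add_rdistrib matvec_scale vec.scale_right_distrib algebra_simps)
qed

lemma sol_weight:
  "sol B U \<Longrightarrow> sol (\<lambda>z. B z + mat (complex_of_real d)) (\<lambda>z. complex_of_real (exp (d * z)) *s U z)"
  using ode_weight[of B "\<lambda>_. 0" U d] by simp

lemma sol_unweight:
  fixes B :: "real \<Rightarrow> complex^'m^'m"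
  assumes "sol (\<lambda>z. B z + mat (complex_of_real d)) U"
  shows "sol B (\<lambda>z. complex_of_real (exp (- d * z)) *s U z)"
proof -
  have "B z + mat (complex_of_real d) + mat (complex_of_real (- d)) = B z" for z
    by (simp add: mat_def vec_eq_iff)
  then show ?thesis using sol_weight[OF assms, of "- d"] by (simp only:)
qed

lemma bdd_contD: "bdd_cont f \<Longrightarrow> continuous_on {0..} f"
  by (simp add: bdd_cont_def)

lemma bdd_cont_bound:
  assumes "bdd_cont f"
  obtains K where "K \<ge> 0" "\<And>z. z \<ge> 0 \<Longrightarrow> norm (f z) \<le> K"
proof -
  from assms obtain K where K: "\<forall>z\<ge>0. norm (f z) \<le> K" by (auto simp: bdd_cont_def bounded_half_line_iff)
  then have "K \<ge> 0" using norm_ge_zero[of "f 0"] order_trans by blast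
  then show ?thesis using K that by blast
qed

lemma bounded_half_line_split:
  fixes f :: "real \<Rightarrow> 'a::real_normed_vector"
  assumes f: "continuous_on {0..} f" and b: "b \<ge> 0" and far: "\<And>z. z \<ge> b \<Longrightarrow> norm (f z) \<le> M"
  shows "bounded (f ` {0..})"
proof -
  have "compact (f ` {0..b})"
    by (rule compact_continuous_image) (auto intro: continuous_on_subset[OF f])
  then have "bounded (f ` {0..b})" by (rule compact_imp_bounded)
  moreover have "bounded (f ` {b..})" using far by (auto simp: bounded_iff)
  ultimately have "bounded (f ` {0..b} \<union> f ` {b..})" by simp
  moreover have "f ` {0..} \<subseteq> f ` {0..b} \<union> f ` {b..}" by force
  ultimately show ?thesis by (rule bounded_subset)
qed

lemma bdd_cont_of_limit:
  fixes f :: "real \<Rightarrow> 'a::real_normed_vector"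
  assumes f: "continuous_on {0..} f" and l: "(f \<longlongrightarrow> l) at_top"
  shows "bdd_cont f"
proof -
  have "eventually (\<lambda>z. dist (f z) l < 1) at_top" using l by (rule tendstoD) simp
  then obtain b where b: "\<And>z. z \<ge> b \<Longrightarrow> dist (f z) l < 1" by (auto simp: eventually_at_top_linorder)
  have "norm (f z) \<le> norm l + 1" if "z \<ge> max 0 b" for z
    using b[of z] that norm_triangle_sub[of "f z" l] by (auto simp: dist_norm)
  then have "bounded (f ` {0..})" using bounded_half_line_split[OF f, of "max 0 b"] by auto
  then show ?thesis using f by (simp add: bdd_cont_def)
qed

lemma full_dim_eq_UNIV:
  fixes S :: "(complex^'m) set"
  assumes "vec.subspace S" "CARD('m) \<le> vec.dim S"
  shows "S = UNIV"
  using vec.subspace_dim_equal[OF assms(1) vec.subspace_UNIV subset_UNIV] assms(2)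
  by (simp add: vec_dim_card card_cart_basis)

text \<open>Subtracting a large multiple of the identity makes every solution bounded, by perturbation
  from the system \<open>U' = - r U\<close>; this gives existence for all initial data.\<close>

lemma sol_exists:
  fixes B :: "real \<Rightarrow> complex^'m^'m"
  assumes B: "bdd_cont B"
  obtains U where "sol B U" "U 0 = x"
proof -
  obtain K where K: "K \<ge> 0" "\<And>z. z \<ge> 0 \<Longrightarrow> norm (B z) \<le> K" using bdd_cont_bound[OF B] by blast
  define m where "m = real CARD('m)"
  \<comment> \<open>so large that the perturbation \<open>K\<close> times the bound \<open>m / r\<close> of the inverse is at most \<open>1/2\<close>\<close>
  define r where "r = 2 * m * K + 1"
  have m: "m \<ge> 0" and r: "r > 0" using K by (auto simp: r_def m_def intro: add_nonneg_pos)
  let ?N = "mat (complex_of_real (- r)) :: complex^'m^'m"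
  let ?B = "\<lambda>z. B z + ?N"
  obtain T where T: "inverts ?N T (m / r)" using inverts_scalar[OF r] unfolding m_def by blast
  have "vec.dim (bounded_data ?B) = vec.dim (bounded_data (\<lambda>_. ?N))"
  proof (rule bounded_data_dim_perturb[OF T])
    show "continuous_on {0..} ?B" by (intro continuous_intros bdd_contD[OF B])
    show "m / r * K \<le> 1 / 2" using r m K by (simp add: r_def field_simps)
  qed (simp add: K)
  moreover have "y \<in> bounded_data (\<lambda>_. ?N)" for y
  proof -
    have "sol (\<lambda>_. 0) (\<lambda>_. y)" by (simp add: ode_def)
    from sol_weight[OF this, of "- r"]
    have "sol (\<lambda>_. ?N) (\<lambda>z. complex_of_real (exp (- r * z)) *s y)" by simp
    moreover have "norm (complex_of_real (exp (- r * z)) *s y) \<le> norm y" if "z \<ge> 0" for z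
      using r that by (simp add: norm_scale mult_left_le_one_le)
    ultimately show ?thesis unfolding bounded_data_def bounded_half_line_iff
      by (intro CollectI exI[of _ "\<lambda>z. complex_of_real (exp (- r * z)) *s y"]) auto
  qed
  then have "bounded_data (\<lambda>_. ?N) = UNIV" by blast
  ultimately have "vec.dim (bounded_data ?B) = CARD('m)" by (simp add: vec_dim_card card_cart_basis)
  then have "bounded_data ?B = UNIV" by (intro full_dim_eq_UNIV subspace_bounded_data) simp
  then have "x \<in> bounded_data ?B" by simp
  then obtain U where U: "sol ?B U" "x = U 0" by (auto simp: bounded_data_def)
  have "sol B (\<lambda>z. complex_of_real (exp (- (- r) * z)) *s U z)" by (rule sol_unweight[OF U(1)])
  then show ?thesis by (rule that) (simp add: U)
qed

lemma ode_shift: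
  assumes U: "ode B f U" and b: "b \<ge> 0"
  shows "ode (\<lambda>z. B (b + z)) (\<lambda>z. f (b + z)) (\<lambda>z. U (b + z))"
  unfolding ode_def
proof (intro allI impI)
  fix z :: real assume z: "z \<ge> 0"
  have "((\<lambda>z. b + z) has_vector_derivative 1) (at z within {0..})"
    by (auto intro!: derivative_eq_intros)
  moreover have "(U has_vector_derivative B (b + z) *v U (b + z) + f (b + z)) (at (b + z) within (\<lambda>z. b + z) ` {0..})"
    by (rule has_vector_derivative_within_subset[OF odeD[OF U]]) (use b z in auto)
  ultimately have "(U \<circ> (\<lambda>z. b + z) has_vector_derivative 1 *\<^sub>R (B (b + z) *v U (b + z) + f (b + z))) (at z within {0..})"
    by (rule vector_diff_chain_within)
  then show "((\<lambda>z. U (b + z)) has_vector_derivative B (b + z) *v U (b + z) + f (b + z)) (at z within {0..})"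
    by (simp add: o_def)
qed

lemma sol_shift: "sol B U \<Longrightarrow> b \<ge> 0 \<Longrightarrow> sol (\<lambda>z. B (b + z)) (\<lambda>z. U (b + z))"
  using ode_shift[of B "\<lambda>_. 0" U b] by simp

lemma continuous_on_shift:
  fixes f :: "real \<Rightarrow> 'a::topological_space"
  shows "continuous_on {0..} f \<Longrightarrow> b \<ge> 0 \<Longrightarrow> continuous_on {0..} (\<lambda>z. f (b + z))"
  by (rule continuous_on_compose2[of "{0..}" f]) (auto intro!: continuous_intros)

lemma bounded_half_line_shift:
  fixes f :: "real \<Rightarrow> 'a::real_normed_vector"
  shows "bounded (f ` {0..}) \<Longrightarrow> b \<ge> 0 \<Longrightarrow> bounded ((\<lambda>z. f (b + z)) ` {0..})"
  unfolding bounded_half_line_iff by (metis add_nonneg_nonneg)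

text \<open>The evolution map from \<open>0\<close> to \<open>b\<close> is injective by uniqueness, hence onto by dimension, so that
  solutions on \<open>[b, \<infinity>)\<close> extend to the left.\<close>

lemma sol_extends:
  fixes B :: "real \<Rightarrow> complex^'m^'m"
  assumes B: "bdd_cont B" and b: "b \<ge> 0" and V: "sol (\<lambda>z. B (b + z)) V"
  obtains U where "sol B U" "\<And>z. z \<ge> 0 \<Longrightarrow> U (b + z) = V z"
proof -
  let ?S = "{U b | U. sol B U}"
  have S: "vec.subspace ?S"
    unfolding vec.subspace_def
  proof (intro conjI ballI allI)
    show "0 \<in> ?S" using sol_zero[of B] by (intro CollectI exI[of _ "\<lambda>_. 0"]) auto
  next
    fix x y assume "x \<in> ?S" "y \<in> ?S"
    then obtain U V where "sol B U" "x = U b" "sol B V" "y = V b" by auto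
    then show "x + y \<in> ?S" using sol_add[of B U V] by (intro CollectI exI[of _ "\<lambda>z. U z + V z"]) auto
  next
    fix c x assume "x \<in> ?S"
    then obtain U where "sol B U" "x = U b" by auto
    then show "c *s x \<in> ?S" using sol_scale[of B U c] by (intro CollectI exI[of _ "\<lambda>z. c *s U z"]) auto
  qed
  have "vec.dim (UNIV :: (complex^'m) set) \<le> vec.dim ?S"
  proof (rule dim_le_by_relation[where R = "\<lambda>x y. \<exists>U. sol B U \<and> U 0 = x \<and> U b = y"])
    show "\<exists>y\<in>?S. \<exists>U. sol B U \<and> U 0 = x \<and> U b = y" for x
    proof -
      obtain U where "sol B U" "U 0 = x" using sol_exists[OF B] by blast
      then show ?thesis by blast
    qed
    show "x = 0" if "\<exists>U. sol B U \<and> U 0 = x \<and> U b = 0" for x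
      using that sol_zero_propagates[of B _ b 0] B b by (auto simp: bdd_cont_def)
    show "\<exists>U. sol B U \<and> U 0 = x + x' \<and> U b = y + y'"
      if "\<exists>U. sol B U \<and> U 0 = x \<and> U b = y" "\<exists>U. sol B U \<and> U 0 = x' \<and> U b = y'" for x y x' y'
    proof -
      from that obtain U V where "sol B U" "U 0 = x" "U b = y" "sol B V" "V 0 = x'" "V b = y'" by blast
      then show ?thesis using sol_add[of B U V] by (intro exI[of _ "\<lambda>z. U z + V z"]) auto
    qed
    show "\<exists>U. sol B U \<and> U 0 = c *s x \<and> U b = c *s y" if "\<exists>U. sol B U \<and> U 0 = x \<and> U b = y" for c x y
    proof -
      from that obtain U where "sol B U" "U 0 = x" "U b = y" by blast
      then show ?thesis using sol_scale[of B U c] by (intro exI[of _ "\<lambda>z. c *s U z"]) auto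
    qed
  qed (use S in auto)
  then have "?S = UNIV" by (intro full_dim_eq_UNIV S) (simp add: vec_dim_card card_cart_basis)
  then have "V 0 \<in> ?S" by blast
  then obtain U where U: "sol B U" "U b = V 0" by auto
  have "U (b + z) = V z" if "z \<ge> 0" for z
    by (rule sol_unique[OF sol_shift[OF U(1) b] V _ order_refl _ that])
      (use U b B in \<open>auto intro: continuous_on_shift simp: bdd_cont_def\<close>)
  then show ?thesis using that U by blast
qed

lemma bounded_data_dim_shift:
  fixes B :: "real \<Rightarrow> complex^'m^'m"
  assumes B: "bdd_cont B" and b: "b \<ge> 0"
  shows "vec.dim (bounded_data B) = vec.dim (bounded_data (\<lambda>z. B (b + z)))"
proof -
  define R where "R x y \<longleftrightarrow> (\<exists>U. sol B U \<and> bounded (U ` {0..}) \<and> U 0 = x \<and> U b = y)" for x y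
  have add: "R (x + x') (y + y')" if "R x y" "R x' y'" for x y x' y'
  proof -
    from that obtain U V where "sol B U" "bounded (U ` {0..})" "U 0 = x" "U b = y"
      "sol B V" "bounded (V ` {0..})" "V 0 = x'" "V b = y'" unfolding R_def by blast
    then show ?thesis unfolding R_def using sol_add[of B U V] bounded_add_scale[of U _ V 1]
      by (intro exI[of _ "\<lambda>z. U z + V z"]) auto
  qed
  have scale: "R (c *s x) (c *s y)" if "R x y" for c x y
  proof -
    from that obtain U where "sol B U" "bounded (U ` {0..})" "U 0 = x" "U b = y" unfolding R_def by blast
    then show ?thesis unfolding R_def using sol_scale[of B U c] bounded_half_line_scale[of U c]
      by (intro exI[of _ "\<lambda>z. c *s U z"]) auto
  qed
  have c: "continuous_on {0..} B" using B by (rule bdd_contD)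
  show ?thesis
  proof (rule antisym)
    show "vec.dim (bounded_data B) \<le> vec.dim (bounded_data (\<lambda>z. B (b + z)))"
    proof (rule dim_le_by_relation[where R = R])
      fix x assume "x \<in> bounded_data B"
      then obtain U where U: "sol B U" "bounded (U ` {0..})" "U 0 = x" by (auto simp: bounded_data_def)
      have "bounded ((\<lambda>z. U (b + z)) ` {0..})" by (intro bounded_half_line_shift U b)
      then have "U b \<in> bounded_data (\<lambda>z. B (b + z))"
        unfolding bounded_data_def using sol_shift[OF U(1) b] by (intro CollectI exI[of _ "\<lambda>z. U (b + z)"]) auto
      then show "\<exists>y\<in>bounded_data (\<lambda>z. B (b + z)). R x y" using U R_def by blast
    next
      show "x = 0" if "R x 0" for x
        using that sol_zero_propagates[OF _ c b] by (auto simp: R_def)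
    qed (rule subspace_bounded_data add scale; assumption?)+
    show "vec.dim (bounded_data (\<lambda>z. B (b + z))) \<le> vec.dim (bounded_data B)"
    proof (rule dim_le_by_relation[where R = "\<lambda>y x. R x y"])
      fix x assume "x \<in> bounded_data (\<lambda>z. B (b + z))"
      then obtain V where V: "sol (\<lambda>z. B (b + z)) V" "bounded (V ` {0..})" "V 0 = x"
        by (auto simp: bounded_data_def)
      then obtain M where M: "\<And>z. z \<ge> 0 \<Longrightarrow> norm (V z) \<le> M" by (auto simp: bounded_half_line_iff)
      obtain U where U: "sol B U" "\<And>z. z \<ge> 0 \<Longrightarrow> U (b + z) = V z" using sol_extends[OF B b V(1)] by blast
      have "norm (U z) \<le> M" if "z \<ge> b" for z using M[of "z - b"] U(2)[of "z - b"] that by simp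
      then have bU: "bounded (U ` {0..})" by (rule bounded_half_line_split[OF ode_continuous[OF U(1)] b])
      then have "U 0 \<in> bounded_data B" using U unfolding bounded_data_def by blast
      moreover have "R (U 0) x" unfolding R_def using U(1) bU U(2)[of 0] V(3) by (intro exI[of _ U]) simp
      ultimately show "\<exists>y\<in>bounded_data B. R y x" by blast
    next
      show "x = 0" if "R 0 x" for x
        using that sol_zero_propagates[OF _ c order_refl _ b] by (auto simp: R_def)
    qed (rule subspace_bounded_data add scale; assumption?)+
  qed
qed

lemma eventually_close:
  fixes f :: "real \<Rightarrow> 'a::real_normed_vector"
  assumes "(f \<longlongrightarrow> l) at_top" "e > 0"
  obtains b where "b \<ge> 0" "\<And>z. z \<ge> 0 \<Longrightarrow> norm (f (b + z) - l) \<le> e"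
proof -
  have "eventually (\<lambda>z. dist (f z) l < e) at_top" using assms by (rule tendstoD)
  then obtain b where b: "\<And>z. z \<ge> b \<Longrightarrow> dist (f z) l < e" by (auto simp: eventually_at_top_linorder)
  show ?thesis
  proof (rule that[of "max 0 b"])
    fix z :: real assume "z \<ge> 0"
    then show "norm (f (max 0 b + z) - l) \<le> e" using b[of "max 0 b + z"] by (simp add: dist_norm less_imp_le)
  qed simp
qed

text \<open>Far out the coefficient is as close to its limit as desired, and moving the starting point does not
  change the dimension.\<close>

theorem bounded_data_dim_limit:
  fixes B :: "real \<Rightarrow> complex^'m^'m"
  assumes B: "continuous_on {0..} B" "(B \<longlongrightarrow> B0) at_top" and hyp: "hyperbolic B0"
  shows "vec.dim (bounded_data B) = vec.dim (bounded_data (\<lambda>_. B0))"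
proof -
  obtain T C where C: "C > 0" and T: "inverts B0 T C" using hyperbolic_inverts[OF hyp] .
  obtain b where b: "b \<ge> 0" "\<And>z. z \<ge> 0 \<Longrightarrow> norm (B (b + z) - B0) \<le> 1 / (2 * C)"
    using eventually_close[OF B(2), of "1 / (2 * C)"] C by auto
  have "vec.dim (bounded_data (\<lambda>z. B (b + z))) = vec.dim (bounded_data (\<lambda>_. B0))"
    by (rule bounded_data_dim_perturb[OF T continuous_on_shift[OF B(1) b(1)] b(2)]) (use C in auto)
  then show ?thesis using bounded_data_dim_shift[OF bdd_cont_of_limit[OF B] b(1)] by simp
qed

text \<open>Bounded solutions decay exponentially: for small \<open>d > 0\<close> the bounded solutions of the system
  with coefficient \<open>B + d\<close> are, after multiplication by \<open>exp (- d z)\<close>, bounded solutions of the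
  original one, and the two spaces have the same dimension.\<close>

theorem bounded_solutions_decay:
  fixes B :: "real \<Rightarrow> complex^'m^'m"
  assumes B: "continuous_on {0..} B" "(B \<longlongrightarrow> B0) at_top" and hyp: "hyperbolic B0"
  obtains d0 where "d0 > 0"
    "\<And>d U. 0 < d \<Longrightarrow> d \<le> d0 \<Longrightarrow> sol B U \<Longrightarrow> bounded (U ` {0..}) \<Longrightarrow> \<exists>c. \<forall>z\<ge>0. norm (U z) \<le> c * exp (- d * z)"
proof -
  obtain T C where C: "C > 0" and T: "inverts B0 T C" using hyperbolic_inverts[OF hyp] .
  define \<kappa> where "\<kappa> = norm (mat 1 :: complex^'m^'m)"
  have "(mat 1 :: complex^'m^'m) \<noteq> 0" by (auto simp: mat_def vec_eq_iff)
  then have \<kappa>: "\<kappa> > 0" by (simp add: \<kappa>_def)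
  have nm: "norm (mat (complex_of_real d) :: complex^'m^'m) = \<bar>d\<bar> * \<kappa>" for d
  proof -
    have "(mat (complex_of_real d) :: complex^'m^'m) = d *\<^sub>R mat 1"
      by (auto simp: mat_def vec_eq_iff scaleR_conv_of_real[of d "1::complex"])
    then show ?thesis by (simp add: \<kappa>_def)
  qed
  \<comment> \<open>half of the admissible perturbation is reserved for the weight\<close>
  define e where "e = 1 / (4 * C)"
  have e: "e > 0" using C by (simp add: e_def)
  obtain b where b: "b \<ge> 0" "\<And>z. z \<ge> 0 \<Longrightarrow> norm (B (b + z) - B0) \<le> e"
    using eventually_close[OF B(2) e] by auto
  let ?B = "\<lambda>z. B (b + z)"
  have cB: "continuous_on {0..} ?B" by (rule continuous_on_shift[OF B(1) b(1)])
  show ?thesis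
  proof (rule that[of "e / \<kappa>"])
    show "e / \<kappa> > 0" using e \<kappa> by simp
    fix d U assume d: "0 < d" "d \<le> e / \<kappa>" and U: "sol B U" "bounded (U ` {0..})"
    let ?Bd = "\<lambda>z. ?B z + mat (complex_of_real d)"
    have 1: "vec.dim (bounded_data ?B) = vec.dim (bounded_data (\<lambda>_. B0))"
      by (rule bounded_data_dim_perturb[OF T cB b(2)]) (use C in \<open>auto simp: e_def\<close>)
    have 2: "vec.dim (bounded_data ?Bd) = vec.dim (bounded_data (\<lambda>_. B0))"
    proof (rule bounded_data_dim_perturb[OF T])
      show "continuous_on {0..} ?Bd" by (intro continuous_intros cB)
      show "C * (2 * e) \<le> 1 / 2" using C by (simp add: e_def)
      fix z :: real assume z: "z \<ge> 0"
      have "norm (?Bd z - B0) = norm ((?B z - B0) + mat (complex_of_real d))"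
        by (simp add: algebra_simps)
      also have "\<dots> \<le> e + d * \<kappa>"
        using d by (intro norm_triangle_mono b z) (simp add: nm)
      also have "d * \<kappa> \<le> e" using d \<kappa> by (simp add: field_simps)
      finally show "norm (?Bd z - B0) \<le> 2 * e" by simp
    qed
    have "bounded_data ?Bd \<subseteq> bounded_data ?B"
    proof
      fix x assume "x \<in> bounded_data ?Bd"
      then obtain V where V: "sol ?Bd V" "bounded (V ` {0..})" "x = V 0" by (auto simp: bounded_data_def)
      then obtain M where M: "\<And>z. z \<ge> 0 \<Longrightarrow> norm (V z) \<le> M" by (auto simp: bounded_half_line_iff)
      have s: "sol ?B (\<lambda>z. complex_of_real (exp (- d * z)) *s V z)" by (rule sol_unweight[OF V(1)])
      have "norm (complex_of_real (exp (- d * z)) *s V z) \<le> M" if "z \<ge> 0" for z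
      proof -
        have "exp (- d * z) * norm (V z) \<le> 1 * norm (V z)" using d that by (intro mult_right_mono) auto
        then show ?thesis using M[OF that] by (simp add: norm_scale)
      qed
      then show "x \<in> bounded_data ?B" unfolding bounded_data_def bounded_half_line_iff using s V(3)
        by (intro CollectI exI[of _ "\<lambda>z. complex_of_real (exp (- d * z)) *s V z"]) auto
    qed
    then have eq: "bounded_data ?Bd = bounded_data ?B"
      using 1 2 by (intro vec.subspace_dim_equal subspace_bounded_data) auto
    have "bounded ((\<lambda>z. U (b + z)) ` {0..})" by (intro bounded_half_line_shift U b)
    then have "U b \<in> bounded_data ?B"
      unfolding bounded_data_def using sol_shift[OF U(1) b(1)] by (intro CollectI exI[of _ "\<lambda>z. U (b + z)"]) auto
    then have "U b \<in> bounded_data ?Bd" using eq by simp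
    then obtain V where V: "sol ?Bd V" "bounded (V ` {0..})" "U b = V 0" by (auto simp: bounded_data_def)
    then obtain M where M: "\<And>z. z \<ge> 0 \<Longrightarrow> norm (V z) \<le> M" by (auto simp: bounded_half_line_iff)
    have UV: "complex_of_real (exp (d * z)) *s U (b + z) = V z" if "z \<ge> 0" for z
    proof (rule sol_unique[OF sol_weight[OF sol_shift[OF U(1) b(1)]] V(1) _ order_refl _ that])
      show "continuous_on {0..} ?Bd" by (intro continuous_intros cB)
    qed (simp add: V(3))
    have "bounded ((\<lambda>z. complex_of_real (exp (d * z)) *s U z) ` {0..})"
    proof (rule bounded_half_line_split[OF _ b(1)])
      show "continuous_on {0..} (\<lambda>z. complex_of_real (exp (d * z)) *s U z)"
        by (intro continuous_intros ode_continuous[OF U(1)])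
      fix z assume z: "z \<ge> b"
      have "complex_of_real (exp (d * z)) *s U z = complex_of_real (exp (d * b)) *s V (z - b)"
      proof -
        have "complex_of_real (exp (d * z)) = complex_of_real (exp (d * b)) * complex_of_real (exp (d * (z - b)))"
          by (simp flip: of_real_mult exp_add add: right_diff_distrib)
        then show ?thesis using UV[of "z - b"] z by (simp flip: vec.scale_scale)
      qed
      then show "norm (complex_of_real (exp (d * z)) *s U z) \<le> exp (d * b) * M"
        using M[of "z - b"] z by (simp add: norm_scale)
    qed
    then obtain c where c: "\<And>z. z \<ge> 0 \<Longrightarrow> norm (complex_of_real (exp (d * z)) *s U z) \<le> c"
      by (auto simp: bounded_half_line_iff)
    have "norm (U z) \<le> c * exp (- d * z)" if "z \<ge> 0" for z
    proof -
      have "exp (d * z) * norm (U z) \<le> c" using c[OF that] by (simp add: norm_scale)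
      then have "norm (U z) \<le> c / exp (d * z)" by (simp add: field_simps)
      then show ?thesis by (simp add: exp_minus field_simps)
    qed
    then show "\<exists>c. \<forall>z\<ge>0. norm (U z) \<le> c * exp (- d * z)" by blast
  qed
qed

text \<open>A solution that decays at rate \<open>d\<close> persists as a bounded solution, up to an error of the size
  of the perturbation of the coefficients, as soon as the shifted limit matrix is hyperbolic. The shift is
  there because the limit matrix to which this is applied has the eigenvalue \<open>0\<close>.\<close>

theorem bounded_solution_near:
  fixes B :: "real \<Rightarrow> complex^'m^'m"
  assumes B: "continuous_on {0..} B" "(B \<longlongrightarrow> B0) at_top"
    and d: "d > 0" and hyp: "hyperbolic (B0 + mat (complex_of_real d))"
    and U0: "sol B U0" and decay: "\<And>z. z \<ge> 0 \<Longrightarrow> norm (U0 z) \<le> c * exp (- d * z)"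
  obtains K r where "K \<ge> 0" "r > 0"
    "\<And>F t. continuous_on {0..} F \<Longrightarrow> (\<And>z. z \<ge> 0 \<Longrightarrow> norm (F z) \<le> t) \<Longrightarrow> t \<le> r \<Longrightarrow>
       \<exists>U. sol (\<lambda>z. B z + F z) U \<and> bounded (U ` {0..}) \<and> norm (U 0 - U0 0) \<le> K * t"
proof -
  let ?md = "mat (complex_of_real d) :: complex^'m^'m"
  obtain T C where C: "C > 0" and T: "inverts (B0 + ?md) T C" using hyperbolic_inverts[OF hyp] .
  define e where "e = 1 / (4 * C)"
  have e: "e > 0" using C by (simp add: e_def)
  obtain b where b: "b \<ge> 0" "\<And>z. z \<ge> 0 \<Longrightarrow> norm (B (b + z) - B0) \<le> e"
    using eventually_close[OF B(2) e] by auto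
  obtain L where L: "L \<ge> 0" "\<And>z. z \<ge> 0 \<Longrightarrow> norm (B z) \<le> L"
    using bdd_cont_bound[OF bdd_cont_of_limit[OF B]] by blast
  have c0: "c \<ge> 0" using order_trans[OF norm_ge_zero decay[of 0]] by simp
  define K where "K = sqrt (exp (3 * (L + 1) * b) * (4 * C\<^sup>2 + 1)) * c"
  show ?thesis
  proof (rule that[of K "min e 1"])
    show "K \<ge> 0" "min e 1 > 0" using c0 e by (auto simp: K_def)
    fix F :: "real \<Rightarrow> complex^'m^'m" and t assume F: "continuous_on {0..} F" and t: "\<And>z. z \<ge> 0 \<Longrightarrow> norm (F z) \<le> t"
      and tr: "t \<le> min e 1"
    have t0: "t \<ge> 0" using order_trans[OF norm_ge_zero t[OF order_refl]] .
    let ?B2 = "\<lambda>z. B (b + z) + F (b + z) + ?md"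
    let ?Y0 = "\<lambda>z. complex_of_real (exp (d * z)) *s U0 (b + z)"
    let ?g = "\<lambda>z. F (b + z) *v ?Y0 z"
    have Y0: "sol (\<lambda>z. B (b + z) + ?md) ?Y0" by (rule sol_weight[OF sol_shift[OF U0 b(1)]])
    have Y0_le: "norm (?Y0 z) \<le> c" if z: "z \<ge> 0" for z
    proof -
      have "norm (?Y0 z) = exp (d * z) * norm (U0 (b + z))" by (simp add: norm_scale)
      also have "\<dots> \<le> exp (d * z) * (c * exp (- d * (b + z)))"
        using decay[of "b + z"] b z by (intro mult_left_mono) auto
      also have "\<dots> = c * exp (- d * b)"
        by (simp add: algebra_simps flip: exp_add)
      also have "\<dots> \<le> c * 1" using c0 d b by (intro mult_left_mono) auto
      finally show ?thesis by simp
    qed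
    have cF: "continuous_on {0..} (\<lambda>z. F (b + z))" by (rule continuous_on_shift[OF F b(1)])
    have Ft: "norm (F (b + z)) \<le> t" if "z \<ge> 0" for z using t that b by simp
    have Y0b: "bdd_cont ?Y0"
      using ode_continuous[OF Y0] Y0_le by (auto simp: bdd_cont_def bounded_half_line_iff)
    have g: "bdd_cont ?g" by (rule bdd_cont_matvec[OF cF Ft Y0b])
    have g_le: "norm (?g z) \<le> t * c" if z: "z \<ge> 0" for z
      using norm_matvec_le mult_mono[OF Ft[OF z] Y0_le[OF z] t0 norm_ge_zero] by (rule order_trans)
    have cB2: "continuous_on {0..} ?B2"
      by (intro continuous_intros cF continuous_on_shift[OF B(1) b(1)])
    have B2: "norm (?B2 z - (B0 + ?md)) \<le> 2 * e" if z: "z \<ge> 0" for z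
    proof -
      have "norm (?B2 z - (B0 + ?md)) = norm ((B (b + z) - B0) + F (b + z))" by (simp add: algebra_simps)
      also have "\<dots> \<le> e + t" by (intro norm_triangle_mono b(2) Ft z)
      finally show ?thesis using tr by simp
    qed
    have Ce: "C * (2 * e) \<le> 1 / 2" using C by (simp add: e_def)
    obtain D where D: "ode ?B2 ?g D" "\<And>z. z \<ge> 0 \<Longrightarrow> norm (D z) \<le> 2 * (C * (t * c))"
      using perturbed_inverts[OF T cB2 B2 Ce g g_le] by blast
    have "ode ?B2 (\<lambda>z. - ?g z) ?Y0"
      using Y0 unfolding ode_def by (simp add: matrix_vector_mult_add_rdistrib)
    from ode_add_scale[OF this D(1), of 1] have Y: "sol ?B2 (\<lambda>z. ?Y0 z + D z)" by simp
    define V where "V z = complex_of_real (exp (- d * z)) *s (?Y0 z + D z)" for z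
    have V: "sol (\<lambda>z. B (b + z) + F (b + z)) V"
      using sol_unweight[OF Y] unfolding V_def .
    have V_le: "norm (V z) \<le> c + 2 * (C * (t * c))" if z: "z \<ge> 0" for z
    proof -
      have "norm (V z) = exp (- d * z) * norm (?Y0 z + D z)" unfolding V_def norm_scale by simp
      also have "\<dots> \<le> 1 * norm (?Y0 z + D z)" using d z by (intro mult_right_mono) auto
      also have "\<dots> \<le> c + 2 * (C * (t * c))"
        unfolding mult_1 by (intro norm_triangle_mono Y0_le D z)
      finally show ?thesis .
    qed
    have BF_le: "norm (B z + F z) \<le> L + 1" if "z \<ge> 0" for z
      using L(2)[OF that] t[OF that] tr by (intro norm_triangle_mono) auto
    have BF: "bdd_cont (\<lambda>z. B z + F z)"
      unfolding bdd_cont_def bounded_half_line_iff using BF_le by (auto intro!: continuous_intros B F)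
    obtain U where U: "sol (\<lambda>z. B z + F z) U" "\<And>z. z \<ge> 0 \<Longrightarrow> U (b + z) = V z"
      using sol_extends[OF BF b(1) V] by blast
    have "norm (U z) \<le> c + 2 * (C * (t * c))" if "z \<ge> b" for z
      using V_le[of "z - b"] U(2)[of "z - b"] that by simp
    then have bU: "bounded (U ` {0..})" by (rule bounded_half_line_split[OF ode_continuous[OF U(1)] b(1)])
    have Ub: "U b - U0 b = D 0" using U(2)[of 0] by (simp add: V_def)
    have "(norm (U 0 - U0 0))\<^sup>2 + (t * c)\<^sup>2 \<le> exp (3 * (L + 1) * \<bar>0 - b\<bar>) * ((norm (U b - U0 b))\<^sup>2 + (t * c)\<^sup>2)"
    proof (rule gronwall[where b = b and U = "\<lambda>z. U z - U0 z" and
          U' = "\<lambda>z. (B z + F z) *v U z - B z *v U0 z"])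
      show "((\<lambda>z. U z - U0 z) has_vector_derivative (B z + F z) *v U z - B z *v U0 z) (at z within {0..})"
        if "z \<ge> 0" for z
        using has_vector_derivative_diff[OF odeD[OF U(1) that] odeD[OF U0 that]] by simp
      show "norm ((B z + F z) *v U z - B z *v U0 z) \<le> (L + 1) * (norm (U z - U0 z) + t * c)"
        if z: "0 \<le> z" "z \<le> b" for z
      proof -
        have U0c: "norm (U0 z) \<le> c"
          using decay[OF z(1)] mult_left_mono[of "exp (- d * z)" 1 c] d z c0 by simp
        have "(B z + F z) *v U z - B z *v U0 z = (B z + F z) *v (U z - U0 z) + F z *v U0 z"
          by (simp add: matrix_vector_mult_add_rdistrib matrix_vector_mult_diff_distrib)
        also have "norm \<dots> \<le> (L + 1) * norm (U z - U0 z) + t * c"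
        proof (intro norm_triangle_mono)
          show "norm ((B z + F z) *v (U z - U0 z)) \<le> (L + 1) * norm (U z - U0 z)"
            using norm_matvec_le mult_right_mono[OF BF_le[OF z(1)] norm_ge_zero] by (rule order_trans)
          show "norm (F z *v U0 z) \<le> t * c"
            using norm_matvec_le mult_mono[OF t[OF z(1)] U0c t0 norm_ge_zero] by (rule order_trans)
        qed
        also have "\<dots> \<le> (L + 1) * (norm (U z - U0 z) + t * c)"
          using L t0 c0 by (simp add: algebra_simps)
        finally show ?thesis .
      qed
    qed (use L t0 c0 b in auto)
    also have "\<dots> \<le> exp (3 * (L + 1) * b) * ((2 * (C * (t * c)))\<^sup>2 + (t * c)\<^sup>2)"
    proof -
      have "(norm (U b - U0 b))\<^sup>2 \<le> (2 * (C * (t * c)))\<^sup>2"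
        unfolding Ub by (intro power_mono D) auto
      then show ?thesis using b by (intro mult_mono) auto
    qed
    also have "\<dots> = (K * t)\<^sup>2"
      by (simp add: K_def power_mult_distrib algebra_simps)
    finally have "(norm (U 0 - U0 0))\<^sup>2 \<le> (K * t)\<^sup>2" using zero_le_power2[of "t * c"] by linarith
    then have "norm (U 0 - U0 0) \<le> K * t"
      by (rule power2_le_imp_le) (use \<open>K \<ge> 0\<close> t0 in simp)
    then show "\<exists>U. sol (\<lambda>z. B z + F z) U \<and> bounded (U ` {0..}) \<and> norm (U 0 - U0 0) \<le> K * t"
      using U bU by blast
  qed
qed

section \<open>Second-order systems\<close>

text \<open>An inequality of Landau type. Over a step of fixed length \<open>h\<close> the increment of \<open>u\<close> is \<open>h v\<close> up to
  \<open>h\<^sup>2 sup \<bar>a\<bar>\<close>, and on that step Gronwall bounds \<open>v\<close>, hence \<open>a\<close>, by \<open>M\<close> and the initial value of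
  \<open>v\<close>; for small \<open>h\<close> the latter can be absorbed.\<close>

lemma derivative_bound:
  fixes u v a :: "real \<Rightarrow> 'a::real_inner"
  assumes u: "\<And>z. z \<ge> 0 \<Longrightarrow> (u has_vector_derivative v z) (at z within {0..})"
    and v: "\<And>z. z \<ge> 0 \<Longrightarrow> (v has_vector_derivative a z) (at z within {0..})"
    and a: "\<And>z. z \<ge> 0 \<Longrightarrow> norm (a z) \<le> L * (norm (u z) + norm (v z))" and L: "L \<ge> 0"
    and M: "\<And>z. z \<ge> 0 \<Longrightarrow> norm (u z) \<le> M" and z: "z \<ge> 0"
  shows "norm (v z) \<le> (8 * (L + 1) * (1 + exp 2) + 1) * M"
proof -
  \<comment> \<open>chosen so that \<open>v\<close> grows at most by the factor \<open>exp 2\<close> over a step and \<open>h L (1 + exp 2) \<le> 1/2\<close>\<close>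
  define h where "h = 1 / (2 * (L + 1) * (1 + exp (2::real)))"
  have e0: "1 + exp (2::real) > 0" by (simp add: add_pos_pos)
  have h: "h > 0" using L e0 by (simp add: h_def)
  have hL: "h * L * (1 + exp 2) \<le> 1 / 2"
  proof -
    have "h * L * (1 + exp 2) = L / (2 * (L + 1))" using e0 by (simp add: h_def)
    also have "\<dots> \<le> 1 / 2" using L by (simp add: field_simps)
    finally show ?thesis .
  qed
  have "h * L \<le> h * L * (1 + exp 2)" using h L mult_left_mono[of 1 "1 + exp (2::real)" "h * L"] by simp
  then have "h * L \<le> 1 / 2" using hL by linarith
  then have hL': "3 * L * h \<le> 4" by (simp add: mult_ac)
  have M0: "M \<ge> 0" using order_trans[OF norm_ge_zero M[OF order_refl]] .
  define m where "m = norm (v z)"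
  have v_le: "norm (v y) \<le> exp 2 * (m + M)" if y: "z \<le> y" "y \<le> z + h" for y
  proof -
    have "(norm (v y))\<^sup>2 + M\<^sup>2 \<le> exp (3 * L * \<bar>y - z\<bar>) * ((norm (v z))\<^sup>2 + M\<^sup>2)"
    proof (rule gronwall[where b = y and U' = a])
      show "norm (a x) \<le> L * (norm (v x) + M)" if "0 \<le> x" "x \<le> y" for x
        using a[OF that(1)] mult_left_mono[OF add_right_mono[OF M[OF that(1)], of "norm (v x)"] L]
        by (simp add: add.commute)
    qed (use v M0 L z y in auto)
    also have "\<dots> \<le> exp 4 * ((norm (v z))\<^sup>2 + M\<^sup>2)"
    proof (intro mult_right_mono)
      have "3 * L * \<bar>y - z\<bar> \<le> 3 * L * h" using y L by (intro mult_left_mono) auto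
      then show "exp (3 * L * \<bar>y - z\<bar>) \<le> exp 4" using hL' by simp
    qed auto
    also have "\<dots> \<le> exp 4 * (m + M)\<^sup>2"
      using M0 by (intro mult_left_mono) (auto simp: m_def power2_sum)
    also have "\<dots> = (exp 2 * (m + M))\<^sup>2"
      by (simp add: power_mult_distrib power2_eq_square flip: exp_add)
    finally have "(norm (v y))\<^sup>2 \<le> (exp 2 * (m + M))\<^sup>2" using zero_le_power2[of M] by linarith
    then show ?thesis by (rule power2_le_imp_le) (use M0 in \<open>auto simp: m_def\<close>)
  qed
  define A where "A = L * (M + exp 2 * (m + M))"
  have A0: "A \<ge> 0" using L M0 by (auto simp: A_def m_def)
  have a_le: "norm (a y) \<le> A" if y: "z \<le> y" "y \<le> z + h" for y
  proof -
    have "norm (a y) \<le> L * (norm (u y) + norm (v y))" using y z by (intro a) auto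
    also have "\<dots> \<le> A"
      unfolding A_def using y z by (intro mult_left_mono add_mono M v_le L) auto
    finally show ?thesis .
  qed
  let ?S = "{z..z + h}"
  have sub: "(g has_vector_derivative g' y) (at y within ?S)"
    if "\<And>y. y \<ge> 0 \<Longrightarrow> (g has_vector_derivative g' y) (at y within {0..})" "y \<in> ?S" for g g' :: "real \<Rightarrow> 'a" and y
    by (rule has_vector_derivative_within_subset[OF that(1)]) (use that(2) z in auto)
  have v_near: "norm (v y - v z) \<le> h * A" if y: "y \<in> ?S" for y
  proof -
    have "norm (v y - v z) \<le> A * norm (y - z)"
    proof (rule differentiable_bound[where S = ?S and f' = "\<lambda>x t. t *\<^sub>R a x"])
      show "(v has_derivative (\<lambda>t. t *\<^sub>R a x)) (at x within ?S)" if "x \<in> ?S" for x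
        using sub[OF v that] by (simp add: has_vector_derivative_def)
      show "onorm (\<lambda>t. t *\<^sub>R a x) \<le> A" if "x \<in> ?S" for x
        using a_le[of x] that A0 by (intro onorm_le) (auto simp: mult.commute[of A] intro!: mult_left_mono)
    qed (use y h in auto)
    also have "\<dots> \<le> A * h" using y A0 by (intro mult_left_mono) auto
    finally show ?thesis by (simp add: mult.commute)
  qed
  have "norm (u (z + h) - u z - (z + h - z) *\<^sub>R v z) \<le> norm (z + h - z) * (h * A)"
    by (rule vector_differentiable_bound_linearization[where S = ?S])
      (use sub[OF u] v_near h in \<open>auto simp: closed_segment_eq_real_ivl\<close>)
  then have lin: "norm (u (z + h) - u z - h *\<^sub>R v z) \<le> h * (h * A)" using h by simp
  have "h * m = norm ((u (z + h) - u z) - (u (z + h) - u z - h *\<^sub>R v z))"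
    using h by (simp add: m_def)
  also have "\<dots> \<le> norm (u (z + h) - u z) + h * (h * A)"
    by (rule order_trans[OF norm_triangle_ineq4 add_left_mono[OF lin]])
  also have "norm (u (z + h) - u z) \<le> norm (u (z + h)) + norm (u z)" by (rule norm_triangle_ineq4)
  also have "\<dots> \<le> M + M" using z h by (intro add_mono M) auto
  finally have 1: "h * m \<le> 2 * M + h * (h * A)" by simp
  have "h * A \<le> (m + M) / 2"
  proof -
    have "M + exp 2 * (m + M) \<le> (1 + exp 2) * (m + M)" using M0 by (simp add: m_def algebra_simps)
    then have "h * A \<le> h * (L * ((1 + exp 2) * (m + M)))"
      unfolding A_def using h L by (intro mult_left_mono) auto
    also have "\<dots> = (h * L * (1 + exp 2)) * (m + M)" by (simp add: mult_ac)
    also have "\<dots> \<le> 1 / 2 * (m + M)" using M0 by (intro mult_right_mono hL) (simp add: m_def)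
    finally show ?thesis by simp
  qed
  then have "h * m \<le> 2 * M + h * ((m + M) / 2)" using 1 mult_left_mono[of "h * A" "(m + M) / 2" h] h by linarith
  then have "m \<le> 2 * M / h + (m + M) / 2" using h by (simp add: field_simps)
  then have "m \<le> 4 * (M / h) + M" by (simp add: field_simps)
  also have "4 * (M / h) = 8 * (L + 1) * (1 + exp 2) * M" by (simp add: h_def)
  finally show ?thesis by (simp add: m_def algebra_simps)
qed

text \<open>The coefficient matrix of the first-order system for \<open>(u, u')\<close> that is equivalent to
  \<open>u'' = K u + M u'\<close>.\<close>

definition comp2 :: "complex^'n^'n \<Rightarrow> complex^'n^'n \<Rightarrow> complex^('n + 'n)^('n + 'n)" where
  "comp2 K M = (\<chi> i j. case i of
      Inl a \<Rightarrow> (case j of Inl b \<Rightarrow> 0 | Inr b \<Rightarrow> if a = b then 1 else 0)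
    | Inr a \<Rightarrow> (case j of Inl b \<Rightarrow> K $ a $ b | Inr b \<Rightarrow> M $ a $ b))"

lemma comp2_matvec: "comp2 K M *v vjoin u v = vjoin v (K *v u + M *v v)"
  by (rule vec_eq_vjoin)
    (auto simp: comp2_def matrix_vector_mult_def sum_UNIV_sum if_distrib[of "\<lambda>c. c * _"] cong: if_cong)

lemma continuous_on_comp2 [continuous_intros]:
  fixes K M :: "'t::topological_space \<Rightarrow> complex^'n^'n"
  assumes "continuous_on S K" "continuous_on S M"
  shows "continuous_on S (\<lambda>z. comp2 (K z) (M z))"
  unfolding comp2_def
proof (intro continuous_on_vec_lambda)
  fix i j :: "'n + 'n"
  show "continuous_on S (\<lambda>z. case i of
      Inl a \<Rightarrow> (case j of Inl b \<Rightarrow> 0 | Inr b \<Rightarrow> if a = b then 1 else 0)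
    | Inr a \<Rightarrow> (case j of Inl b \<Rightarrow> K z $ a $ b | Inr b \<Rightarrow> M z $ a $ b))"
    by (cases i; cases j) (auto intro!: continuous_intros assms)
qed

lemma tendsto_comp2 [tendsto_intros]:
  fixes K M :: "'t \<Rightarrow> complex^'n^'n"
  assumes "(K \<longlongrightarrow> K0) F" "(M \<longlongrightarrow> M0) F"
  shows "((\<lambda>z. comp2 (K z) (M z)) \<longlongrightarrow> comp2 K0 M0) F"
  unfolding comp2_def
proof (intro tendsto_vec_lambda)
  fix i j :: "'n + 'n"
  show "((\<lambda>z. case i of
      Inl a \<Rightarrow> (case j of Inl b \<Rightarrow> 0 | Inr b \<Rightarrow> if a = b then 1 else 0)
    | Inr a \<Rightarrow> (case j of Inl b \<Rightarrow> K z $ a $ b | Inr b \<Rightarrow> M z $ a $ b)) \<longlongrightarrow>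
    (case i of
      Inl a \<Rightarrow> (case j of Inl b \<Rightarrow> 0 | Inr b \<Rightarrow> if a = b then 1 else 0)
    | Inr a \<Rightarrow> (case j of Inl b \<Rightarrow> K0 $ a $ b | Inr b \<Rightarrow> M0 $ a $ b))) F"
    by (cases i; cases j) (auto intro!: tendsto_intros assms)
qed

lemma norm_comp2_diff_le:
  fixes K M :: "complex^'n^'n"
  shows "norm (comp2 K M - comp2 K' M') \<le> norm (K - K') + norm (M - M')"
proof -
  have sq: "(norm x)\<^sup>2 = (\<Sum>i\<in>UNIV. (norm (x $ i))\<^sup>2)" for x :: "'v::real_normed_vector^'k"
    by (simp add: norm_vec_def L2_set_def sum_nonneg)
  let ?D = "comp2 K M - comp2 K' M'"
  have l: "?D $ Inl a = 0" for a
    by (rule vec_eq_vjoin) (auto simp: comp2_def)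
  have r: "?D $ Inr a = vjoin ((K - K') $ a) ((M - M') $ a)" for a
    by (rule vec_eq_vjoin) (auto simp: comp2_def)
  have "(norm ?D)\<^sup>2 = (norm (K - K'))\<^sup>2 + (norm (M - M'))\<^sup>2"
    unfolding sq[of ?D] sq[of "K - K'"] sq[of "M - M'"] sum_UNIV_sum l r norm_vjoin_sq
    by (simp add: sum.distrib)
  also have "\<dots> \<le> (norm (K - K') + norm (M - M'))\<^sup>2" by (simp add: power2_sum)
  finally show ?thesis by (rule power2_le_imp_le) simp
qed

lemma eigenvalue_comp2:
  assumes "eigenvalue (comp2 K M) r"
  obtains u where "u \<noteq> 0" "K *v u + r *s (M *v u) = (r * r) *s u"
proof -
  from assms obtain w where w: "w \<noteq> 0" "comp2 K M *v w = r *s w" by (auto simp: eigenvalue_def)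
  obtain u v where uv: "w = vjoin u v" by (rule vjoin_exhaust)
  have *: "v = r *s u" "K *v u + M *v v = r *s v" using w(2) by (auto simp: uv comp2_matvec vjoin_scale)
  have "u \<noteq> 0" using w(1) *(1) by (auto simp: uv)
  moreover have "K *v u + r *s (M *v u) = (r * r) *s u" using *(2) unfolding *(1) by (simp add: matvec_scale)
  ultimately show ?thesis using that by blast
qed

lemma hyperbolic_comp2I:
  assumes "\<And>u x. u \<noteq> 0 \<Longrightarrow> K *v u + (\<i> * complex_of_real x) *s (M *v u) \<noteq> - complex_of_real (x\<^sup>2) *s u"
  shows "hyperbolic (comp2 K M)"
  unfolding hyperbolic_def
proof (intro allI impI)
  fix r assume "eigenvalue (comp2 K M) r"
  then obtain u where u: "u \<noteq> 0" "K *v u + r *s (M *v u) = (r * r) *s u" by (rule eigenvalue_comp2)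
  show "Re r \<noteq> 0"
  proof
    assume "Re r = 0"
    then have r: "r = \<i> * complex_of_real (Im r)" by (simp add: complex_eq_iff)
    then have "r * r = - complex_of_real ((Im r)\<^sup>2)"
      by (metis (no_types, opaque_lifting) complex_i_mult_minus mult.assoc mult.left_commute of_real_mult power2_eq_square)
    then show False using assms[OF u(1), of "Im r"] u(2) r by metis
  qed
qed

text \<open>By perturbation the dimension is locally constant along a path of hyperbolic matrices.\<close>

lemma bounded_data_dim_homotopy:
  fixes B :: "real \<Rightarrow> complex^'m^'m"
  assumes B: "continuous_on {0..1} B" and hyp: "\<And>t. t \<in> {0..1} \<Longrightarrow> hyperbolic (B t)"
  shows "vec.dim (bounded_data (\<lambda>_. B 0)) = vec.dim (bounded_data (\<lambda>_. B 1))"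
proof (rule connected_local_const[where A = "{0..1}" and f = "\<lambda>t. vec.dim (bounded_data (\<lambda>_. B t))"])
  show "\<forall>a\<in>{0..1}. eventually (\<lambda>b. vec.dim (bounded_data (\<lambda>_. B a)) = vec.dim (bounded_data (\<lambda>_. B b))) (at a within {0..1})"
  proof
    fix a :: real assume a: "a \<in> {0..1}"
    obtain T C where C: "C > 0" and T: "inverts (B a) T C" using hyperbolic_inverts[OF hyp[OF a]] .
    have "(B \<longlongrightarrow> B a) (at a within {0..1})" using B a by (simp add: continuous_on_def)
    then have "eventually (\<lambda>b. dist (B b) (B a) < 1 / (2 * C)) (at a within {0..1})"
      by (rule tendstoD) (use C in simp)
    then show "eventually (\<lambda>b. vec.dim (bounded_data (\<lambda>_. B a)) = vec.dim (bounded_data (\<lambda>_. B b))) (at a within {0..1})"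
    proof eventually_elim
      case (elim b)
      have "vec.dim (bounded_data (\<lambda>_. B b)) = vec.dim (bounded_data (\<lambda>_. B a))"
        by (rule bounded_data_dim_perturb[OF T, where e = "1 / (2 * C)"]) (use elim C in \<open>auto simp: dist_norm\<close>)
      then show ?case ..
    qed
  qed
qed auto

text \<open>The sum \<open>m\<close> of the two characteristic roots is imaginary, so they lie on opposite sides of the
  imaginary axis, and exactly the solutions with \<open>u' = a u\<close>, \<open>Re a < 0\<close>, are bounded.\<close>

lemma bounded_data_dim_scalar:
  assumes k: "hyperbolic (comp2 (mat k) (mat m) :: complex^('n::finite + 'n)^('n + 'n))" and m: "Re m = 0"
  shows "vec.dim (bounded_data (\<lambda>_. comp2 (mat k) (mat m) :: complex^('n + 'n)^('n + 'n))) = CARD('n)"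
proof -
  let ?B = "comp2 (mat k) (mat m) :: complex^('n + 'n)^('n + 'n)"
  define s where "s = csqrt (m\<^sup>2 + 4 * k)"
  have roots: "\<exists>a b. a + b = m \<and> a * b = - k"
  proof (intro exI conjI)
    have "s\<^sup>2 = m\<^sup>2 + 4 * k" by (simp add: s_def)
    then show "(m + s) / 2 * ((m - s) / 2) = - k" by (simp add: field_simps power2_eq_square)
    show "(m + s) / 2 + (m - s) / 2 = m" by (simp add: field_simps)
  qed
  have ev: "Re a \<noteq> 0" if ab: "a + b = m" "a * b = - k" for a b
  proof -
    let ?e = "axis undefined 1 :: complex^'n"
    have km: "k = - (a * b)" "m = a + b" using ab by auto
    have "?B *v vjoin ?e (a *s ?e) = a *s vjoin ?e (a *s ?e)"
      by (simp add: comp2_matvec vjoin_scale mat_matvec km) (simp add: vec_eq_iff algebra_simps)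
    moreover have "vjoin ?e (a *s ?e) \<noteq> 0"
      by (metis vjoin_eq_iff vjoin_zero axis_eq_0_iff zero_neq_one)
    ultimately show ?thesis using k unfolding hyperbolic_def eigenvalue_def by blast
  qed
  obtain a b where ab: "a + b = m" "a * b = - k" "Re a < 0" "Re b > 0"
  proof -
    obtain a b where ab: "a + b = m" "a * b = - k" using roots by blast
    have "Re a \<noteq> 0" "Re b = - Re a" using ev[OF ab] m ab(1) by auto
    then show ?thesis using that[of a b] that[of b a] ab
      by (cases "Re a < 0") (auto simp: add.commute mult.commute)
  qed
  have km: "k = - (a * b)" "m = a + b" using ab by auto
  have data: "bounded_data (\<lambda>_. ?B) = {vjoin u (a *s u) | u. True}"
  proof (intro equalityI subsetI)
    fix x :: "complex^('n + 'n)" assume "x \<in> {vjoin u (a *s u) | u. True}"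
    then obtain u where x: "x = vjoin u (a *s u)" by auto
    define U where "U z = exp (a * complex_of_real z) *s vjoin u (a *s u)" for z
    have "sol (\<lambda>_. ?B) U"
      unfolding ode_def
    proof (intro allI impI)
      fix z :: real
      have "((\<lambda>z. exp (a * complex_of_real z)) has_vector_derivative a * exp (a * complex_of_real z)) (at z within {0..})"
        by (rule has_vector_derivative_real_field) (auto intro!: derivative_eq_intros)
      from has_vector_derivative_scale[OF this has_vector_derivative_const[of "vjoin u (a *s u)"]]
      have "(U has_vector_derivative (a * exp (a * complex_of_real z)) *s vjoin u (a *s u)) (at z within {0..})"
        by (simp add: U_def[abs_def])
      moreover have "?B *v U z = (a * exp (a * complex_of_real z)) *s vjoin u (a *s u)"
      proof -
        have "?B *v vjoin u (a *s u) = a *s vjoin u (a *s u)"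
          by (simp add: comp2_matvec mat_matvec vjoin_scale km) (simp add: vec_eq_iff algebra_simps)
        then show ?thesis by (simp add: U_def matvec_scale vec.scale_scale mult.commute)
      qed
      ultimately show "(U has_vector_derivative ?B *v U z + 0) (at z within {0..})" by simp
    qed
    moreover have "norm (U z) \<le> norm (vjoin u (a *s u))" if "z \<ge> 0" for z
      using that ab(3) by (simp add: U_def norm_scale norm_exp_eq_Re mult_left_le_one_le mult_nonpos_nonneg)
    moreover have "x = U 0" by (simp add: U_def x)
    ultimately show "x \<in> bounded_data (\<lambda>_. ?B)" unfolding bounded_data_def bounded_half_line_iff by blast
  next
    fix x assume "x \<in> bounded_data (\<lambda>_. ?B)"
    then obtain U M where U: "sol (\<lambda>_. ?B) U" "\<And>z. z \<ge> 0 \<Longrightarrow> norm (U z) \<le> M" "x = U 0"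
      by (auto simp: bounded_data_def bounded_half_line_iff)
    define u v where "u z = (\<chi> i. U z $ Inl i)" and "v z = (\<chi> i. U z $ Inr i)" for z
    have Uuv: "U z = vjoin (u z) (v z)" for z by (rule vec_eq_vjoin) (auto simp: u_def v_def)
    define w where "w z = v z - a *s u z" for z
    let ?P = "\<lambda>x :: complex^('n + 'n). (\<chi> i. x $ Inr i) - a *s (\<chi> i. x $ Inl i) :: complex^'n"
    have P: "bounded_linear ?P"
    proof -
      have "linear ?P" by (rule linearI) (auto simp: vec_eq_iff algebra_simps)
      then show ?thesis by (simp add: linear_conv_bounded_linear)
    qed
    have wP: "w z = ?P (U z)" for z by (simp add: w_def u_def v_def)
    have w: "(w has_vector_derivative b *s w z) (at z within {0..})" if "z \<ge> 0" for z
    proof -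
      from bounded_linear.has_vector_derivative[OF P odeD[OF U(1) that]]
      have "(w has_vector_derivative ?P (?B *v U z + 0)) (at z within {0..})" by (simp add: wP[abs_def])
      moreover have "?P (?B *v U z + 0) = b *s w z"
        by (simp add: Uuv comp2_matvec mat_matvec w_def km vec_eq_iff algebra_simps)
      ultimately show ?thesis by simp
    qed
    have const: "exp (- b * complex_of_real z) *s w z = w 0" if z: "z \<ge> 0" for z
    proof -
      have "((\<lambda>z. exp (- b * complex_of_real z) *s w z) has_vector_derivative 0) (at y within {0..})" if "y \<in> {0..}" for y
      proof -
        have "((\<lambda>z. exp (- b * complex_of_real z)) has_vector_derivative - b * exp (- b * complex_of_real y)) (at y within {0..})"
          by (rule has_vector_derivative_real_field) (auto intro!: derivative_eq_intros)
        from has_vector_derivative_scale[OF this w] that show ?thesis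
          by (simp add: vec.scale_scale mult.commute)
      qed
      then obtain c where "\<And>y. y \<in> {0..} \<Longrightarrow> exp (- b * complex_of_real y) *s w y = c"
        using has_vector_derivative_zero_constant[of "{0..}" "\<lambda>z. exp (- b * complex_of_real z) *s w z"] by auto
      from this[of z] this[of 0] z show ?thesis by simp
    qed
    obtain N where N: "N \<ge> 0" "\<And>x. norm (?P x) \<le> N * norm x"
      using bounded_linear.nonneg_bounded[OF P] by (metis mult.commute)
    have w_le: "norm (w 0) \<le> exp (- Re b * z) * (N * M)" if "z \<ge> 0" for z
    proof -
      have "norm (w 0) = exp (- Re b * z) * norm (w z)"
        unfolding const[OF that, symmetric] by (simp add: norm_scale norm_exp_eq_Re)
      also have "norm (w z) \<le> N * norm (U z)" unfolding wP by (rule N)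
      also have "\<dots> \<le> N * M" by (intro mult_left_mono N U that)
      finally show ?thesis by simp
    qed
    have "((\<lambda>z. exp (- Re b * z) * (N * M)) \<longlongrightarrow> 0 * (N * M)) at_top"
    proof (intro tendsto_mult tendsto_const)
      have "filterlim (\<lambda>z. - (Re b * z)) at_bot at_top"
        unfolding filterlim_uminus_at_bot minus_minus
        by (rule filterlim_tendsto_pos_mult_at_top[OF tendsto_const ab(4) filterlim_ident])
      then show "((\<lambda>z. exp (- Re b * z)) \<longlongrightarrow> 0) at_top"
        by (intro filterlim_compose[OF exp_at_bot]) simp
    qed
    then have "norm (w 0) \<le> 0 * (N * M)"
      by (rule tendsto_lowerbound) (use w_le in \<open>auto simp: eventually_at_top_linorder\<close>)
    then have "v 0 = a *s u 0" by (simp add: w_def)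
    then show "x \<in> {vjoin u (a *s u) | u. True}" using U(3) Uuv by auto
  qed
  have sub: "vec.subspace {vjoin u (a *s u) | u :: complex^'n. True}"
    using subspace_bounded_data[of "\<lambda>_. ?B"] data by simp
  have "vec.dim {vjoin u (a *s u) | u :: complex^'n. True} = vec.dim (UNIV :: (complex^'n) set)"
  proof (rule antisym)
    show "vec.dim {vjoin u (a *s u) | u :: complex^'n. True} \<le> vec.dim (UNIV :: (complex^'n) set)"
      by (rule dim_le_by_relation[where R = "\<lambda>x u. x = vjoin u (a *s u)", OF sub])
        (auto simp: vjoin_add vjoin_scale vec.scale_right_distrib vec.scale_scale mult.commute)
    show "vec.dim (UNIV :: (complex^'n) set) \<le> vec.dim {vjoin u (a *s u) | u :: complex^'n. True}"
    proof (rule dim_le_by_relation[where R = "\<lambda>u x. x = vjoin u (a *s u)", OF vec.subspace_UNIV sub])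
      show "u = 0" if "0 = vjoin u (a *s u)" for u :: "complex^'n"
        using that by (metis vjoin_eq_iff vjoin_zero)
    qed (auto simp: vjoin_add vjoin_scale vec.scale_right_distrib vec.scale_scale mult.commute)
  qed
  then show ?thesis unfolding data by (simp add: vec_dim_card card_cart_basis)
qed

text \<open>The homotopy that switches off \<open>K'\<close> and \<open>M'\<close> leads to the scalar equation.\<close>

theorem bounded_data_dim_second_order:
  fixes K M :: "real \<Rightarrow> complex^'n^'n"
  assumes "continuous_on {0..} K" "continuous_on {0..} M"
    and "(K \<longlongrightarrow> mat k + K') at_top" "(M \<longlongrightarrow> mat m + M') at_top" and m: "Re m = 0"
    and hyp: "\<And>t. t \<in> {0..1} \<Longrightarrow> hyperbolic (comp2 (mat k + t *\<^sub>R K') (mat m + t *\<^sub>R M'))"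
  shows "vec.dim (bounded_data (\<lambda>z. comp2 (K z) (M z))) = CARD('n)"
proof -
  let ?B = "\<lambda>t. comp2 (mat k + t *\<^sub>R K') (mat m + t *\<^sub>R M')"
  have "vec.dim (bounded_data (\<lambda>z. comp2 (K z) (M z))) = vec.dim (bounded_data (\<lambda>_. ?B 1))"
    using hyp[of 1] by (intro bounded_data_dim_limit continuous_intros tendsto_intros) (use assms in auto)
  also have "\<dots> = vec.dim (bounded_data (\<lambda>_. ?B 0))"
    by (rule bounded_data_dim_homotopy[symmetric]) (auto intro!: continuous_intros hyp)
  also have "\<dots> = CARD('n)" using hyp[of 0] m by (simp add: bounded_data_dim_scalar)
  finally show ?thesis .
qed

section \<open>Regularity of the profiles and of the coefficients\<close>

lemma norm_cvec [simp]: "norm (cvec x) = norm x"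
  by (simp add: cvec_def norm_vec_def)

lemma cvec_add: "cvec (x + y) = cvec x + cvec y" by (simp add: cvec_def vec_eq_iff)
lemma cvec_scaleR: "cvec (r *\<^sub>R x) = r *\<^sub>R cvec x"
  by (simp add: cvec_def vec_eq_iff) (simp add: scaleR_conv_of_real)

lemma bounded_linear_cvec: "bounded_linear (cvec :: real^'n \<Rightarrow> complex^'n)"
  by (rule bounded_linear_intro[where K = 1]) (auto simp: cvec_add cvec_scaleR)

lemma cmat_matvec: "cmat M *v cvec x = cvec (M *v x)"
  by (simp add: cmat_def cvec_def vec_eq_iff matrix_vector_mult_def)

lemma cmat_add: "cmat (M + N) = cmat M + cmat N" by (simp add: cmat_def vec_eq_iff)
lemma cmat_diff: "cmat (M - N) = cmat M - cmat N" by (simp add: cmat_def vec_eq_iff)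
lemma cmat_scaleR: "cmat (r *\<^sub>R M) = r *\<^sub>R cmat M"
  by (simp add: cmat_def vec_eq_iff) (simp add: scaleR_conv_of_real)
lemma cmat_mat: "cmat (mat c) = mat (complex_of_real c)" by (auto simp: cmat_def mat_def vec_eq_iff)
lemma cmat_sum: "cmat (sum f I) = (\<Sum>i\<in>I. cmat (f i))"
  by (induct I rule: infinite_finite_induct) (auto simp: cmat_add cmat_def vec_eq_iff)

lemma continuous_on_cmat [continuous_intros]:
  "continuous_on S f \<Longrightarrow> continuous_on S (\<lambda>z. cmat (f z))"
  unfolding cmat_def by (intro continuous_intros)

lemma tendsto_cmat [tendsto_intros]: "(f \<longlongrightarrow> M) F \<Longrightarrow> ((\<lambda>z. cmat (f z)) \<longlongrightarrow> cmat M) F"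
  unfolding cmat_def by (intro tendsto_intros)

definition smat :: "complex \<Rightarrow> complex^'n^'m \<Rightarrow> complex^'n^'m" where
  "smat c M = (\<chi> i j. c * M $ i $ j)"

lemma smat_matvec: "smat c M *v x = c *s (M *v x)"
  by (simp add: smat_def vec_eq_iff matrix_vector_mult_def sum_distrib_left mult.assoc)

lemma norm_smat: "norm (smat c M) = cmod c * norm M"
proof -
  have "smat c M $ i = c *s M $ i" for i by (simp add: smat_def vec_eq_iff)
  then show ?thesis by (simp add: norm_vec_def[of "smat c M"] norm_vec_def[of M] norm_scale L2_set_right_distrib)
qed

lemma continuous_on_smat [continuous_intros]:
  "continuous_on S f \<Longrightarrow> continuous_on S (\<lambda>z. smat c (f z))"
  unfolding smat_def by (intro continuous_intros)

lemma tendsto_smat [tendsto_intros]: "(f \<longlongrightarrow> M) F \<Longrightarrow> ((\<lambda>z. smat c (f z)) \<longlongrightarrow> smat c M) F"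
  unfolding smat_def by (intro tendsto_intros)

lemma sum_matvec: "(\<Sum>i\<in>I. f i) *v x = (\<Sum>i\<in>I. f i *v x)" for f :: "'i \<Rightarrow> complex^'n^'m"
  by (induct I rule: infinite_finite_induct) (auto simp: matrix_vector_mult_add_rdistrib)

context shock_manifold
begin

text \<open>The profile is locally the restriction of a map that is smooth in \<open>(z, q)\<close> jointly, and \<open>G\<close> is the
  \<open>z\<close>-derivative of that map.\<close>

lemma W_local:
  assumes q: "q \<in> C"
  obtains V G where "open V" "(z, q) \<in> V" "\<And>x. x \<in> V \<Longrightarrow> G differentiable (at x)"
    "\<And>y p. (y, p) \<in> V \<Longrightarrow> p \<in> C \<Longrightarrow> ((\<lambda>y. W y p) has_vector_derivative G (y, p)) (at y)"
proof -
  have "(z, q) \<in> UNIV \<times> C" using q by simp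
  with W_smooth obtain V g where V: "open V" "(z, q) \<in> V" "smooth_on V g"
    and g: "\<And>x. x \<in> (UNIV \<times> C) \<inter> V \<Longrightarrow> g x = (case x of (z, q) \<Rightarrow> W z q)"
    unfolding smooth_rel_def by metis
  have "Ck_on (Suc (Suc 0)) V g" using V(3) unfolding smooth_on_def by blast
  then have d1: "\<And>x. x \<in> V \<Longrightarrow> g differentiable (at x)"
    and d2: "\<And>x v. x \<in> V \<Longrightarrow> (\<lambda>x. frechet_derivative g (at x) v) differentiable (at x)"
    by auto
  show ?thesis
  proof (rule that[OF V(1,2) d2])
    fix y p assume yp: "(y, p) \<in> V" "p \<in> C"
    have gd: "(g has_derivative frechet_derivative g (at (y, p))) (at (y, p))"
      using d1[OF yp(1)] by (simp add: frechet_derivative_works)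
    have "((\<lambda>t. (t, p)) has_vector_derivative (1, 0)) (at y)"
      unfolding has_vector_derivative_def by (auto intro!: derivative_eq_intros)
    from vector_derivative_diff_chain_within[OF this, of g "frechet_derivative g (at (y, p))"]
    have "(g \<circ> (\<lambda>t. (t, p)) has_vector_derivative frechet_derivative g (at (y, p)) (1, 0)) (at y)"
      using has_derivative_at_withinI[OF gd] by auto
    then show "((\<lambda>y. W y p) has_vector_derivative frechet_derivative g (at (y, p)) (1, 0)) (at y)"
    proof (rule has_vector_derivative_transform_within_open)
      show "open ((\<lambda>t. (t, p)) -` V)" using V(1) by (intro open_vimage continuous_intros)
    qed (use yp g in auto)
  qed
qed

lemma W_deriv: assumes "q \<in> C" shows "((\<lambda>y. W y q) has_vector_derivative Wz W z q) (at z)"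
proof -
  obtain V G where "open V" "(z, q) \<in> V"
    "\<And>y p. (y, p) \<in> V \<Longrightarrow> p \<in> C \<Longrightarrow> ((\<lambda>y. W y p) has_vector_derivative G (y, p)) (at y)"
    using W_local[OF assms] by metis
  then have "((\<lambda>y. W y q) has_vector_derivative G (z, q)) (at z)" using assms by blast
  then show ?thesis unfolding Wz_def by (simp add: vector_derivative_at)
qed

lemma Wz_local:
  assumes q: "q \<in> C"
  obtains V G where "open V" "(z, q) \<in> V" "\<And>x. x \<in> V \<Longrightarrow> G differentiable (at x)"
    "\<And>y p. (y, p) \<in> V \<Longrightarrow> p \<in> C \<Longrightarrow> Wz W y p = G (y, p)"
proof -
  obtain V G where V: "open V" "(z, q) \<in> V" "\<And>x. x \<in> V \<Longrightarrow> G differentiable (at x)"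
    and G: "\<And>y p. (y, p) \<in> V \<Longrightarrow> p \<in> C \<Longrightarrow> ((\<lambda>y. W y p) has_vector_derivative G (y, p)) (at y)"
    using W_local[OF q] by metis
  show ?thesis by (rule that[OF V]) (use G in \<open>auto simp: Wz_def vector_derivative_at\<close>)
qed

lemma Wz_deriv: assumes q: "q \<in> C" shows "((\<lambda>y. Wz W y q) has_vector_derivative Wzz W z q) (at z)"
proof -
  obtain V G where V: "open V" "(z, q) \<in> V" and d: "\<And>x. x \<in> V \<Longrightarrow> G differentiable (at x)"
    and G: "\<And>y p. (y, p) \<in> V \<Longrightarrow> p \<in> C \<Longrightarrow> Wz W y p = G (y, p)"
    using Wz_local[OF q] by metis
  have gd: "(G has_derivative frechet_derivative G (at (z, q))) (at (z, q))"
    using d[OF V(2)] by (simp add: frechet_derivative_works)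
  have "((\<lambda>t. (t, q)) has_vector_derivative (1, 0)) (at z)"
    unfolding has_vector_derivative_def by (auto intro!: derivative_eq_intros)
  from vector_derivative_diff_chain_within[OF this, of G "frechet_derivative G (at (z, q))"]
  have "(G \<circ> (\<lambda>t. (t, q)) has_vector_derivative frechet_derivative G (at (z, q)) (1, 0)) (at z)"
    using has_derivative_at_withinI[OF gd] by auto
  then have "((\<lambda>y. Wz W y q) has_vector_derivative frechet_derivative G (at (z, q)) (1, 0)) (at z)"
  proof (rule has_vector_derivative_transform_within_open)
    show "open ((\<lambda>t. (t, q)) -` V)" using V(1) by (intro open_vimage continuous_intros)
  qed (use V q G in auto)
  then show ?thesis unfolding Wzz_def by (simp add: vector_derivative_at)
qed

lemma continuous_W: "q \<in> C \<Longrightarrow> continuous_on S (\<lambda>z. W z q)"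
  by (intro continuous_at_imp_continuous_on ballI has_vector_derivative_continuous[OF W_deriv])

lemma continuous_Wz: "q \<in> C \<Longrightarrow> continuous_on S (\<lambda>z. Wz W z q)"
  by (intro continuous_at_imp_continuous_on ballI has_vector_derivative_continuous[OF Wz_deriv])

lemma A_differentiable: assumes "w \<in> Us" shows "A j differentiable (at w)"
proof -
  have "Ck_on (Suc 0) Us (A j)" using A_smooth[of j] unfolding smooth_on_def by blast
  then show ?thesis using assms by simp
qed

lemma A_has_derivative: "w \<in> Us \<Longrightarrow> (A j has_derivative frechet_derivative (A j) (at w)) (at w)"
  using A_differentiable by (simp add: frechet_derivative_works)

lemma continuous_A: "continuous_on Us (A j)"
proof -
  have "Ck_on 0 Us (A j)" using A_smooth[of j] unfolding smooth_on_def by blast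
  then show ?thesis by simp
qed

lemma continuous_dA: "continuous_on Us (\<lambda>x. frechet_derivative (A j) (at x) v)"
proof -
  have "Ck_on (Suc 0) Us (A j)" using A_smooth[of j] unfolding smooth_on_def by blast
  then show ?thesis by simp
qed

lemma Acal_has_derivative:
  assumes "w \<in> Us"
  shows "((\<lambda>y. Acal l A y \<sigma>) has_derivative (\<lambda>h. frechet_derivative (A l) (at w) h -
    (\<Sum>j\<in>- {l}. \<sigma> $ j *\<^sub>R frechet_derivative (A j) (at w) h))) (at w)"
  unfolding Acal_def A0_def
  by (rule derivative_eq_intros A_has_derivative assms refl)+ simp

lemma Acal_frechet:
  "w \<in> Us \<Longrightarrow> frechet_derivative (\<lambda>y. Acal l A y \<sigma>) (at w) = (\<lambda>h. frechet_derivative (A l) (at w) h -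
    (\<Sum>j\<in>- {l}. \<sigma> $ j *\<^sub>R frechet_derivative (A j) (at w) h))"
  using frechet_derivative_at[OF Acal_has_derivative] by simp

lemma continuous_Acal: "continuous_on Us (\<lambda>w. Acal l A w \<sigma>)"
  unfolding Acal_def A0_def by (intro continuous_intros continuous_A)

lemma continuous_dAcal: "continuous_on Us (\<lambda>w. frechet_derivative (\<lambda>y. Acal l A y \<sigma>) (at w) v)"
proof -
  have "continuous_on Us (\<lambda>w. frechet_derivative (A l) (at w) v -
    (\<Sum>j\<in>- {l}. \<sigma> $ j *\<^sub>R frechet_derivative (A j) (at w) v))"
    by (intro continuous_intros continuous_dA)
  then show ?thesis by (rule continuous_on_eq) (simp add: Acal_frechet)
qed

end

text \<open>The zeroth-order coefficient coming from the differential of \<open>A\<close>: it is the matrix of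
  \<open>u \<mapsto> (d\<A>(w) u) x\<close>.\<close>

definition dmat :: "'d::finite \<Rightarrow> ('d \<Rightarrow> real^'n \<Rightarrow> real^'n^'n) \<Rightarrow> real^'n \<Rightarrow> real^'d \<Rightarrow> real^'n \<Rightarrow> complex^'n^'n" where
  "dmat l A w \<sigma> x = (\<chi> a m. \<Sum>b\<in>UNIV. complex_of_real
     (frechet_derivative (\<lambda>y. Acal l A y \<sigma>) (at w) (axis m 1) $ a $ b * x $ b))"

lemma dAcal_matvec: "dAcal l A w \<sigma> u *v cvec x = dmat l A w \<sigma> x *v u"
proof -
  let ?f = "\<lambda>m a b. complex_of_real (frechet_derivative (\<lambda>y. Acal l A y \<sigma>) (at w) (axis m 1) $ a $ b)"
  have "(\<Sum>b\<in>UNIV. (\<Sum>m\<in>UNIV. u $ m * ?f m a b) * complex_of_real (x $ b)) =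
      (\<Sum>m\<in>UNIV. (\<Sum>b\<in>UNIV. ?f m a b * complex_of_real (x $ b)) * u $ m)" for a
    unfolding sum_distrib_right by (subst sum.swap) (simp add: mult_ac)
  then show ?thesis
    by (simp add: dAcal_def dmat_def matrix_vector_mult_def vec_eq_iff cvec_def)
qed

definition visc :: "'d::finite \<Rightarrow> ('n, 'd) shock \<Rightarrow> real" where
  "visc l q = 1 + normsq_tan l (sig q)"

lemma visc_pos: "visc l q > 0"
  unfolding visc_def normsq_tan_def by (intro add_pos_nonneg sum_nonneg) auto

text \<open>The coefficients of \<open>u'\<close> and \<open>u\<close> when \<open>\<L> u = 0\<close> is solved for \<open>u''\<close>.\<close>

definition Mcoef :: "'d::finite \<Rightarrow> ('d \<Rightarrow> real^'n \<Rightarrow> real^'n^'n) \<Rightarrow>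
    (real \<Rightarrow> ('n, 'd) shock \<Rightarrow> real^'n) \<Rightarrow> ('n, 'd) shock \<Rightarrow> 'd freq \<Rightarrow> real \<Rightarrow> complex^'n^'n" where
  "Mcoef l A W q \<zeta> z = (1 / visc l q) *\<^sub>R
     (cmat (Acal l A (W z q) (sig q)) + mat (2 * (\<Sum>j\<in>- {l}. sig q $ j * \<i> * snd \<zeta> $ j)))"

definition Kcoef :: "'d::finite \<Rightarrow> ('d \<Rightarrow> real^'n \<Rightarrow> real^'n^'n) \<Rightarrow>
    (real \<Rightarrow> ('n, 'd) shock \<Rightarrow> real^'n) \<Rightarrow> ('n, 'd) shock \<Rightarrow> 'd freq \<Rightarrow> real \<Rightarrow> complex^'n^'n" where
  "Kcoef l A W q \<zeta> z = (1 / visc l q) *\<^sub>R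
     (dmat l A (W z q) (sig q) (Wz W z q) + mat (c0 l \<zeta>)
      + (\<Sum>j\<in>- {l}. smat (\<i> * snd \<zeta> $ j) (cmat (A j (W z q)))))"

lemma Lop_eq:
  "Lop l A W q \<zeta> z u0 u1 u2 = visc l q *\<^sub>R (Kcoef l A W q \<zeta> z *v u0 + Mcoef l A W q \<zeta> z *v u1 - u2)"
proof -
  have v: "visc l q \<noteq> 0" using visc_pos[of l q] by simp
  have "visc l q *\<^sub>R (Kcoef l A W q \<zeta> z *v u0 + Mcoef l A W q \<zeta> z *v u1 - u2) =
      (dmat l A (W z q) (sig q) (Wz W z q) *v u0 + c0 l \<zeta> *s u0
      + (\<Sum>j\<in>- {l}. (\<i> * snd \<zeta> $ j) *s (cmat (A j (W z q)) *v u0)))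
      + (cmat (Acal l A (W z q) (sig q)) *v u1 + (2 * (\<Sum>j\<in>- {l}. sig q $ j * \<i> * snd \<zeta> $ j)) *s u1)
      - visc l q *\<^sub>R u2"
    using v unfolding Kcoef_def Mcoef_def matvec_scaleR
    by (simp add: scaleR_right_diff_distrib scaleR_right_distrib matrix_vector_mult_add_rdistrib
        mat_matvec sum_matvec smat_matvec)
  also have "\<dots> = Lop l A W q \<zeta> z u0 u1 u2"
    unfolding Lop_def Let_def dAcal_matvec A0_def cmat_mat visc_def c0_def scaleR_eq_scale
    by (simp add: mat_matvec vec.scale_left_distrib algebra_simps case_prod_beta)
  finally show ?thesis ..
qed

lemma Lop_zero_iff:
  "Lop l A W q \<zeta> z u0 u1 u2 = 0 \<longleftrightarrow> u2 = Kcoef l A W q \<zeta> z *v u0 + Mcoef l A W q \<zeta> z *v u1"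
  unfolding Lop_eq using visc_pos[of l q] by auto

lemma Lop_add_scale:
  "Lop l A W q \<zeta> z (u0 + c *s w0) (u1 + c *s w1) (u2 + c *s w2) =
   Lop l A W q \<zeta> z u0 u1 u2 + c *s Lop l A W q \<zeta> z w0 w1 w2"
  unfolding Lop_eq scaleR_eq_scale
  by (simp add: matrix_vector_right_distrib matvec_scale vec.scale_right_distrib
      vec.scale_right_diff_distrib mult.commute algebra_simps)

context shock_manifold
begin

text \<open>The third derivative of the profile, computed from the profile equation.\<close>

definition Wzzz :: "real \<Rightarrow> ('n, 'd) shock \<Rightarrow> real^'n" where
  "Wzzz z q = (1 / visc l q) *\<^sub>R
     (frechet_derivative (\<lambda>y. Acal l A y (sig q)) (at (W z q)) (Wz W z q) *v Wz W z q
      + Acal l A (W z q) (sig q) *v Wzz W z q)"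

lemma Wzz_eq: assumes "q \<in> C" shows "Wzz W z q = (1 / visc l q) *\<^sub>R (Acal l A (W z q) (sig q) *v Wz W z q)"
proof -
  have "visc l q *\<^sub>R Wzz W z q = Acal l A (W z q) (sig q) *v Wz W z q"
    using W_profile[OF assms, of z] unfolding visc_def .
  then have "(1 / visc l q) *\<^sub>R (visc l q *\<^sub>R Wzz W z q) = (1 / visc l q) *\<^sub>R (Acal l A (W z q) (sig q) *v Wz W z q)"
    by simp
  then show ?thesis using visc_pos[of l q] by simp
qed

lemma bounded_bilinear_real_matvec:
  "bounded_bilinear ((*v) :: real^'k^'m \<Rightarrow> real^'k \<Rightarrow> real^'m)"
proof
  show "\<exists>K. \<forall>a b. norm (a *v b :: real^'m) \<le> norm a * norm (b :: real^'k) * K"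
  proof (intro exI allI)
    fix a :: "real^'k^'m" and b :: "real^'k"
    have "norm (a *v b) = norm (cmat a *v cvec b)" unfolding cmat_matvec norm_cvec ..
    also have "\<dots> \<le> norm (cmat a) * norm (cvec b)" by (rule norm_matvec_le)
    also have "norm (cmat a) = norm a" by (simp add: norm_vec_def cmat_def)
    finally show "norm (a *v b) \<le> norm a * norm b * 1" by simp
  qed
next
  fix r :: real and a :: "real^'k^'m" and b :: "real^'k"
  show "(r *\<^sub>R a) *v b = r *\<^sub>R (a *v b)"
    by (simp add: vec_eq_iff matrix_vector_mult_def sum_distrib_left mult.assoc)
  show "a *v (r *\<^sub>R b) = r *\<^sub>R (a *v b)"
    by (simp add: vec_eq_iff matrix_vector_mult_def sum_distrib_left mult.left_commute)
qed (simp_all add: matrix_vector_right_distrib matrix_vector_mult_add_rdistrib)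

lemma Wzz_deriv: assumes q: "q \<in> C" shows "((\<lambda>y. Wzz W y q) has_vector_derivative Wzzz z q) (at z)"
proof -
  let ?f = "\<lambda>y. Acal l A y (sig q)"
  have "(?f has_derivative frechet_derivative ?f (at (W z q))) (at (W z q))"
    unfolding Acal_frechet[OF W_in[OF q]] by (rule Acal_has_derivative[OF W_in[OF q]])
  then have "(?f has_derivative frechet_derivative ?f (at (W z q))) (at (W z q) within range (\<lambda>z. W z q))"
    by (rule has_derivative_at_withinI)
  from vector_derivative_diff_chain_within[OF W_deriv[OF q] this]
  have "((\<lambda>z. ?f (W z q)) has_vector_derivative frechet_derivative ?f (at (W z q)) (Wz W z q)) (at z)"
    by (simp add: o_def)
  from bounded_bilinear.has_vector_derivative[OF bounded_bilinear_real_matvec this Wz_deriv[OF q]]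
  have "((\<lambda>z. ?f (W z q) *v Wz W z q) has_vector_derivative
      ?f (W z q) *v Wzz W z q + frechet_derivative ?f (at (W z q)) (Wz W z q) *v Wz W z q) (at z)" .
  from has_vector_derivative_scaleR[OF DERIV_const this, of "1 / visc l q"]
  show ?thesis unfolding Wzz_eq[OF q, abs_def] Wzzz_def by (simp add: Wzz_eq[OF q] add.commute)
qed

lemma dAcal_cvec:
  assumes w: "w \<in> Us"
  shows "dAcal l A w \<sigma> (cvec h) = cmat (frechet_derivative (\<lambda>y. Acal l A y \<sigma>) (at w) h)"
proof -
  let ?D = "frechet_derivative (\<lambda>y. Acal l A y \<sigma>) (at w)"
  have lin: "linear ?D"
    using has_derivative_linear[OF Acal_has_derivative[OF w, of \<sigma>]] unfolding Acal_frechet[OF w] .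
  have "?D h = ?D (\<Sum>m\<in>UNIV. h $ m *\<^sub>R axis m 1)"
    by (simp add: basis_expansion flip: scalar_mult_eq_scaleR)
  also have "\<dots> = (\<Sum>m\<in>UNIV. h $ m *\<^sub>R ?D (axis m 1))"
    by (simp add: linear_sum[OF lin] linear_cmul[OF lin])
  finally show ?thesis by (simp add: dAcal_def cmat_def cvec_def vec_eq_iff)
qed

text \<open>Differentiating the profile equation: \<open>W'\<close> solves \<open>\<L> u = \<L>\<^sub>1\<close>.\<close>

lemma Lop_profile:
  assumes q: "q \<in> C"
  shows "Lop l A W q \<zeta> z (cvec (Wz W z q)) (cvec (Wzz W z q)) (cvec (Wzzz z q)) = L1 l A W q \<zeta> z"
proof -
  have v: "visc l q \<noteq> 0" using visc_pos[of l q] by simp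
  have "visc l q *\<^sub>R cvec (Wzzz z q) =
      dAcal l A (W z q) (sig q) (cvec (Wz W z q)) *v cvec (Wz W z q) + cmat (Acal l A (W z q) (sig q)) *v cvec (Wzz W z q)"
    using v by (simp add: Wzzz_def dAcal_cvec[OF W_in[OF q]] cmat_matvec cvec_scaleR cvec_add)
  then show ?thesis
    unfolding Lop_def L1_def Let_def visc_def by (simp add: algebra_simps)
qed

end

section \<open>The spaces of bounded solutions\<close>

lemma has_vector_derivative_dilate:
  fixes f :: "real \<Rightarrow> 'a::real_normed_vector"
  assumes "(f has_vector_derivative f') (at (s * z) within (*) s ` T)"
  shows "((\<lambda>z. f (s * z)) has_vector_derivative s *\<^sub>R f') (at z within T)"
proof -
  have "((*) s has_vector_derivative s) (at z within T)"
    unfolding has_vector_derivative_def by (auto intro!: derivative_eq_intros simp: mult.commute)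
  from vector_diff_chain_within[OF this assms] show ?thesis by (simp add: o_def)
qed

lemma cmat_mult: "cmat (M ** N) = cmat M ** cmat N"
  by (simp add: cmat_def matrix_matrix_mult_def vec_eq_iff)

lemma cmat_invertible:
  assumes "invertible (M :: real^'n^'n)"
  obtains N where "\<And>v. N *v (cmat M *v v) = v"
proof -
  from assms obtain M' where "M' ** M = mat 1" by (auto simp: invertible_def)
  then have "cmat M' ** cmat M = mat 1" by (simp add: cmat_mat flip: cmat_mult)
  then have "cmat M' *v (cmat M *v v) = v" for v by (simp add: matrix_vector_mul_assoc)
  then show ?thesis by (rule that)
qed

definition reflect :: "real \<Rightarrow> complex^('n::finite + 'n) \<Rightarrow> complex^('n + 'n)" where
  "reflect s x = vjoin (\<chi> i. x $ Inl i) (s *\<^sub>R (\<chi> i. x $ Inr i))"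

lemma reflect_vjoin: "reflect s (vjoin u v) = vjoin u (s *\<^sub>R v)"
  by (simp add: reflect_def)

lemma reflect_add: "reflect s (x + y) = reflect s x + reflect s y"
  unfolding reflect_def by (rule vec_eq_vjoin) (auto simp: scaleR_right_distrib)

lemma reflect_diff: "reflect s (x - y) = reflect s x - reflect s y"
  unfolding reflect_def by (rule vec_eq_vjoin) (auto simp: scaleR_right_diff_distrib)

lemma reflect_scale: "reflect s (c *s x) = c *s reflect s x"
  unfolding reflect_def by (rule vec_eq_vjoin) auto

lemma reflect_reflect: "s * s = 1 \<Longrightarrow> reflect s (reflect s x) = x"
  unfolding reflect_def by (rule vec_eq_vjoin) auto

lemma norm_reflect: assumes "s = 1 \<or> s = - 1" shows "norm (reflect s x) = norm x"
proof -
  obtain u v where x: "x = vjoin u v" by (rule vjoin_exhaust)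
  have "(norm (reflect s x))\<^sup>2 = (norm x)\<^sup>2" using assms by (auto simp: x reflect_vjoin norm_vjoin_sq)
  then show ?thesis by simp
qed

lemma has_vector_derivative_vjoin:
  fixes u v :: "real \<Rightarrow> complex^('n::finite)"
  assumes "(u has_vector_derivative u') F" "(v has_vector_derivative v') F"
  shows "((\<lambda>z. vjoin (u z) (v z)) has_vector_derivative vjoin u' v') F"
proof -
  have l: "bounded_linear (\<lambda>x :: complex^'n. vjoin x 0 :: complex^('n + 'n))"
    by (rule bounded_linear_intro[where K = 1])
      (auto simp: vjoin_add vjoin_scale scaleR_eq_scale intro: order_trans[OF norm_vjoin_le])
  have r: "bounded_linear (\<lambda>x :: complex^'n. vjoin 0 x :: complex^('n + 'n))"
    by (rule bounded_linear_intro[where K = 1])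
      (auto simp: vjoin_add vjoin_scale scaleR_eq_scale intro: order_trans[OF norm_vjoin_le])
  from has_vector_derivative_add[OF bounded_linear.has_vector_derivative[OF l assms(1)]
      bounded_linear.has_vector_derivative[OF r assms(2)]]
  show ?thesis by (simp add: vjoin_add)
qed

lemma has_vector_derivative_vjoinD:
  fixes u v :: "real \<Rightarrow> complex^('n::finite)"
  assumes "((\<lambda>z. vjoin (u z) (v z)) has_vector_derivative vjoin u' v') F"
  shows "(u has_vector_derivative u') F \<and> (v has_vector_derivative v') F"
proof -
  have "bounded_linear (\<lambda>x :: complex^('n + 'n). (\<chi> i. x $ Inl i) :: complex^'n)"
    unfolding linear_conv_bounded_linear[symmetric] by (rule linearI) (auto simp: vec_eq_iff)
  moreover have "bounded_linear (\<lambda>x :: complex^('n + 'n). (\<chi> i. x $ Inr i) :: complex^'n)"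
    unfolding linear_conv_bounded_linear[symmetric] by (rule linearI) (auto simp: vec_eq_iff)
  ultimately show ?thesis
    using bounded_linear.has_vector_derivative[OF _ assms] by fastforce
qed

definition side_matrix :: "'d::finite \<Rightarrow> ('d \<Rightarrow> real^'n \<Rightarrow> real^'n^'n) \<Rightarrow>
    (real \<Rightarrow> ('n, 'd) shock \<Rightarrow> real^'n) \<Rightarrow> ('n, 'd) shock \<Rightarrow> real \<Rightarrow> 'd freq \<Rightarrow> real \<Rightarrow> complex^('n + 'n)^('n + 'n)" where
  "side_matrix l A W q s \<zeta> z = comp2 (Kcoef l A W q \<zeta> (s * z)) (s *\<^sub>R Mcoef l A W q \<zeta> (s * z))"

text \<open>A point of the shock manifold together with one of the two half-lines; \<open>s\<close> is the sign of
  \<open>z\<close> on it.\<close>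

locale profile_side = shock_manifold l A Us Up Um k C W q0
  for l :: "'d::finite" and A :: "'d \<Rightarrow> real^'n \<Rightarrow> real^'n^'n" and Us Up Um k C W q0 +
  fixes q and s :: real
  assumes qC: "q \<in> C" and s: "s = 1 \<or> s = - 1"
begin

text \<open>The end state of the profile on the half-line.\<close>

definition p where "p = (if s = 1 then fst q else fst (snd q))"

lemma sign_square [simp]: "s * s = 1" using s by auto

lemma dilate_half_line: "(*) s ` {0..} = {z. 0 \<le> s * z}" "(*) s ` {z. 0 \<le> s * z} = {0..}"
proof -
  have twice: "s * (s * z) = z" for z using s by auto
  show "(*) s ` {0..} = {z. 0 \<le> s * z}"
  proof (intro equalityI subsetI)
    fix z assume "z \<in> {z. 0 \<le> s * z}"
    then show "z \<in> (*) s ` {0..}" using twice[of z] by (intro image_eqI[of _ _ "s * z"]) simp_all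
  next
    fix z assume "z \<in> (*) s ` {0..}"
    then obtain y where "y \<ge> 0" "z = s * y" by auto
    then have "s * z = y" using twice by metis
    then show "z \<in> {z. 0 \<le> s * z}" using \<open>y \<ge> 0\<close> by simp
  qed
  show "(*) s ` {z. 0 \<le> s * z} = {0..}"
  proof (intro equalityI subsetI)
    fix z :: real assume "z \<in> {0..}"
    then have "0 \<le> s * (s * z)" by (subst twice) simp
    then have "s * z \<in> {z. 0 \<le> s * z}" by blast
    then have "s * (s * z) \<in> (*) s ` {z. 0 \<le> s * z}" by (rule imageI)
    then show "z \<in> (*) s ` {z. 0 \<le> s * z}" by (simp only: twice)
  qed auto
qed

lemma cvec_W_deriv: "((\<lambda>z. cvec (W z q)) has_vector_derivative cvec (Wz W z q)) (at z within T)"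
  by (rule has_vector_derivative_at_within) (rule bounded_linear.has_vector_derivative[OF bounded_linear_cvec W_deriv[OF qC]])

lemma cvec_Wz_deriv: "((\<lambda>z. cvec (Wz W z q)) has_vector_derivative cvec (Wzz W z q)) (at z within T)"
  by (rule has_vector_derivative_at_within) (rule bounded_linear.has_vector_derivative[OF bounded_linear_cvec Wz_deriv[OF qC]])

lemma cvec_Wzz_deriv: "((\<lambda>z. cvec (Wzz W z q)) has_vector_derivative cvec (Wzzz z q)) (at z within T)"
  by (rule has_vector_derivative_at_within) (rule bounded_linear.has_vector_derivative[OF bounded_linear_cvec Wzz_deriv[OF qC]])

lemma p_cases: "p \<in> Up \<union> Um" "p \<in> Us"
proof -
  have "fst q \<in> Up" "fst (snd q) \<in> Um" using qC C_subset by (auto simp: mem_Times_iff)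
  then show "p \<in> Up \<union> Um" "p \<in> Us" using Up(3) Um(3) by (auto simp: p_def)
qed

lemma Acal_p_invertible: "invertible (Acal l A p (sig q))"
  using qC Acal_invertible[of "fst q" "fst (snd q)" "sig q"] by (auto simp: p_def)

lemma W_lim: "((\<lambda>z. W (s * z) q) \<longlongrightarrow> p) at_top"
proof -
  have lim: "((\<lambda>z. W z q) \<longlongrightarrow> fst q) at_top" "((\<lambda>z. W z q) \<longlongrightarrow> fst (snd q)) at_bot"
    using W_limits[of "fst q" "fst (snd q)" "sig q"] qC by auto
  show ?thesis
  proof (cases "s = 1")
    case True then show ?thesis unfolding p_def using lim by simp
  next
    case False
    then have "s = - 1" using s by auto
    then show ?thesis unfolding p_def
      using lim(2) filterlim_at_bot_mirror[of "\<lambda>z. W z q" "nhds (fst (snd q))"] by simp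
  qed
qed

lemma continuous_side:
  assumes "continuous_on UNIV f" shows "continuous_on {0..} (\<lambda>z. f (s * z))"
  by (rule continuous_on_compose2[OF assms]) (auto intro!: continuous_intros)

lemma continuous_W_side: "continuous_on Us f \<Longrightarrow> continuous_on {0..} (\<lambda>z. f (W (s * z) q))"
  by (rule continuous_on_compose2[where g = f and t = Us])
    (auto intro!: continuous_side continuous_W qC W_in)

lemma tendsto_W_side: assumes "continuous_on Us f" shows "((\<lambda>z. f (W (s * z) q)) \<longlongrightarrow> f p) at_top"
proof (rule isCont_tendsto_compose[OF _ W_lim])
  show "isCont f p" using assms Us(1) p_cases(2) continuous_on_eq_continuous_at by blast
qed

text \<open>In the variable \<open>s z\<close> the profile equation is the linear system \<open>v' = G v\<close> for \<open>v = W'\<close>; its limit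
  matrix is hyperbolic because \<open>\<A>\<^sub>d\<close> has real nonzero eigenvalues at the end state. This is where
  boundedness and exponential decay of \<open>W'\<close> come from.\<close>

definition G where "G z = (s / visc l q) *\<^sub>R cmat (Acal l A (W (s * z) q) (sig q))"
definition Ginf where "Ginf = (s / visc l q) *\<^sub>R cmat (Acal l A p (sig q))"

lemma continuous_G: "continuous_on {0..} G"
  unfolding G_def by (intro continuous_intros continuous_W_side continuous_Acal)

lemma G_lim: "(G \<longlongrightarrow> Ginf) at_top"
  unfolding G_def Ginf_def by (intro tendsto_intros tendsto_W_side continuous_Acal)

lemma Wz_sol: "sol G (\<lambda>z. cvec (Wz W (s * z) q))"
  unfolding ode_def
proof (intro allI impI)
  fix z :: real
  have "((\<lambda>z. cvec (Wz W (s * z) q)) has_vector_derivative s *\<^sub>R cvec (Wzz W (s * z) q)) (at z within {0..})"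
    by (rule has_vector_derivative_dilate[OF cvec_Wz_deriv])
  moreover have "s *\<^sub>R cvec (Wzz W (s * z) q) = G z *v cvec (Wz W (s * z) q)"
    by (simp add: G_def Wzz_eq[OF qC] matvec_scaleR cmat_matvec cvec_scaleR)
  ultimately show "((\<lambda>z. cvec (Wz W (s * z) q)) has_vector_derivative G z *v cvec (Wz W (s * z) q) + 0) (at z within {0..})"
    by simp
qed

lemma Wz_bounded: "bounded ((\<lambda>z. cvec (Wz W (s * z) q)) ` {0..})"
proof -
  let ?u = "\<lambda>z. cvec (W (s * z) q)" and ?v = "\<lambda>z. s *\<^sub>R cvec (Wz W (s * z) q)" and ?a = "\<lambda>z. cvec (Wzz W (s * z) q)"
  obtain L where L: "L \<ge> 0" "\<And>z. z \<ge> 0 \<Longrightarrow> norm (G z) \<le> L"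
    using bdd_cont_bound[OF bdd_cont_of_limit[OF continuous_G G_lim]] by blast
  have "bdd_cont (\<lambda>z. W (s * z) q)"
    by (intro bdd_cont_of_limit continuous_side continuous_W qC) (rule W_lim)
  then obtain M where M: "\<And>z. z \<ge> 0 \<Longrightarrow> norm (W (s * z) q) \<le> M" using bdd_cont_bound by blast
  have "norm (?v z) \<le> (8 * (L + 1) * (1 + exp 2) + 1) * M" if z: "z \<ge> 0" for z
  proof (rule derivative_bound[where u = ?u and a = ?a, OF _ _ _ L(1) _ z])
    fix z :: real assume z: "z \<ge> 0"
    show "(?u has_vector_derivative ?v z) (at z within {0..})"
      by (rule has_vector_derivative_dilate[OF cvec_W_deriv])
    have "((\<lambda>z. cvec (Wz W (s * z) q)) has_vector_derivative s *\<^sub>R cvec (Wzz W (s * z) q)) (at z within {0..})"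
      by (rule has_vector_derivative_dilate[OF cvec_Wz_deriv])
    from has_vector_derivative_scaleR[OF DERIV_const this, of s]
    show "(?v has_vector_derivative ?a z) (at z within {0..})" by simp
    have "?a z = G z *v ?v z"
      by (simp add: G_def Wzz_eq[OF qC] matvec_scaleR cmat_matvec cvec_scaleR)
    then have "norm (?a z) \<le> norm (G z) * norm (?v z)" using norm_matvec_le by metis
    also have "\<dots> \<le> L * norm (?v z)" by (intro mult_right_mono L z) simp
    also have "\<dots> \<le> L * (norm (?u z) + norm (?v z))" by (intro mult_left_mono L) simp
    finally show "norm (?a z) \<le> L * (norm (?u z) + norm (?v z))" .
    show "norm (?u z) \<le> M" using M[OF z] by simp
  qed
  moreover have "\<bar>s\<bar> = 1" using s by auto
  ultimately have "\<forall>z\<ge>0. norm (cvec (Wz W (s * z) q)) \<le> (8 * (L + 1) * (1 + exp 2) + 1) * M"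
    by (simp del: norm_cvec)
  then show ?thesis unfolding bounded_half_line_iff by blast
qed

lemma cmat_sum_A:
  "cmat (\<Sum>j\<in>UNIV. \<xi> $ j *\<^sub>R A j w) *v u =
    \<xi> $ l *\<^sub>R (cmat (A l w) *v u) + (\<Sum>j\<in>- {l}. \<xi> $ j *\<^sub>R (cmat (A j w) *v u))"
proof -
  have "(\<Sum>j\<in>UNIV. \<xi> $ j *\<^sub>R (cmat (A j w) *v u)) =
      \<xi> $ l *\<^sub>R (cmat (A l w) *v u) + (\<Sum>j\<in>UNIV - {l}. \<xi> $ j *\<^sub>R (cmat (A j w) *v u))"
    by (rule sum.remove) auto
  then show ?thesis by (simp add: cmat_sum cmat_scaleR sum_matvec matvec_scaleR Compl_eq_Diff_UNIV)
qed

lemma cmat_Acal: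
  "cmat (Acal l A w \<sigma>) *v u = cmat (A l w) *v u - \<sigma> $ l *\<^sub>R u - (\<Sum>j\<in>- {l}. \<sigma> $ j *\<^sub>R (cmat (A j w) *v u))"
  by (simp add: Acal_def A0_def cmat_diff cmat_scaleR cmat_sum cmat_mat matrix_vector_mult_diff_rdistrib
      matvec_scaleR sum_matvec mat_matvec)

lemma Ginf_eigenvalue: assumes "eigenvalue Ginf r" shows "r \<in> \<real>" "r \<noteq> 0"
proof -
  from assms obtain v where v: "v \<noteq> 0" "Ginf *v v = r *s v" by (auto simp: eigenvalue_def)
  have vis: "visc l q \<noteq> 0" using visc_pos[of l q] by simp
  define c where "c = complex_of_real (visc l q * s) * r"
  have Av: "cmat (Acal l A p (sig q)) *v v = c *s v"
  proof -
    have "cmat (Acal l A p (sig q)) *v v = (visc l q * s) *\<^sub>R (Ginf *v v)"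
      using vis by (simp add: Ginf_def matvec_scaleR)
    then show ?thesis by (simp add: v(2) c_def scaleR_eq_scale)
  qed
  have "(\<chi> j. if j = l then 1 else - sig q $ j) \<noteq> 0"
    by (metis (mono_tags, lifting) vec_lambda_beta zero_index zero_neq_one)
  moreover have "cmat (\<Sum>j\<in>UNIV. (\<chi> j. if j = l then 1 else - sig q $ j) $ j *\<^sub>R A j p) *v v = (c + complex_of_real (sig q $ l)) *s v"
  proof -
    have "(\<Sum>j\<in>- {l}. (\<chi> j. if j = l then 1 else - sig q $ j) $ j *\<^sub>R (cmat (A j p) *v v)) =
        - (\<Sum>j\<in>- {l}. sig q $ j *\<^sub>R (cmat (A j p) *v v))"
      unfolding sum_negf[symmetric] by (intro sum.cong) auto
    then have "cmat (\<Sum>j\<in>UNIV. (\<chi> j. if j = l then 1 else - sig q $ j) $ j *\<^sub>R A j p) *v v =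
        cmat (Acal l A p (sig q)) *v v + sig q $ l *\<^sub>R v"
      unfolding cmat_sum_A cmat_Acal by simp
    then show ?thesis by (simp add: Av vec.scale_left_distrib scaleR_eq_scale)
  qed
  then have "is_eigenvalue (\<Sum>j\<in>UNIV. (\<chi> j. if j = l then 1 else - sig q $ j) $ j *\<^sub>R A j p) (c + complex_of_real (sig q $ l))"
    unfolding is_eigenvalue_def using v(1) by blast
  ultimately have "c + complex_of_real (sig q $ l) \<in> \<real>" using A_hyperbolic p_cases(1) by blast
  then have "c \<in> \<real>" by (metis Reals_diff Reals_of_real add_diff_cancel_right')
  moreover have "r = complex_of_real (s / visc l q) * c"
  proof -
    have "(s / visc l q) * (visc l q * s) = 1" using vis by (simp add: mult.commute)
    then have "complex_of_real (s / visc l q) * complex_of_real (visc l q * s) = 1"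
      by (metis of_real_1 of_real_mult)
    then show ?thesis unfolding c_def mult.assoc[symmetric] by simp
  qed
  ultimately show "r \<in> \<real>" by simp
  show "r \<noteq> 0"
  proof
    assume "r = 0"
    then have "cmat (Acal l A p (sig q)) *v v = 0" using Av by (simp add: c_def)
    moreover obtain N where "\<And>v. N *v (cmat (Acal l A p (sig q)) *v v) = v"
      using cmat_invertible[OF Acal_p_invertible] by blast
    ultimately show False using v(1) by (metis matrix_vector_mult_0_right)
  qed
qed

lemma hyperbolic_Ginf: "hyperbolic Ginf"
  unfolding hyperbolic_def using Ginf_eigenvalue by (metis Reals_cases Re_complex_of_real of_real_0)

text \<open>The symbol on the imaginary axis. With \<open>X = s x\<close> and \<open>\<xi> = (\<eta> - X h, X)\<close>, an eigenvalue
  \<open>i x\<close> of the limit matrix would produce the eigenvalue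
  \<open>i (\<gamma> + X\<^sup>2 + \<bar>\<eta> - X h\<bar>\<^sup>2 + i \<tau>') / t\<close> of \<open>\<Sum> \<xi>\<^sub>j A\<^sub>j\<close>. It is not real for \<open>\<xi> \<noteq> 0\<close>,
  against hyperbolicity; and for \<open>\<xi> = 0\<close> or \<open>t = 0\<close> the equation forces \<open>\<zeta> = 0\<close>.\<close>

lemma hyperbolic_side:
  assumes \<zeta>: "\<zeta> \<noteq> 0" "fst \<zeta> \<ge> 0" and t: "0 \<le> t"
  defines "m \<equiv> complex_of_real (s / visc l q) * (2 * (\<Sum>j\<in>- {l}. sig q $ j * \<i> * snd \<zeta> $ j))"
    and "K' \<equiv> (1 / visc l q) *\<^sub>R (\<Sum>j\<in>- {l}. smat (\<i> * snd \<zeta> $ j) (cmat (A j p)))"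
  shows "hyperbolic (comp2 (mat (c0 l \<zeta> / visc l q) + t *\<^sub>R K') (mat m + t *\<^sub>R Ginf))"
proof (rule hyperbolic_comp2I, rule notI)
  fix u x assume u: "u \<noteq> 0"
    and eq: "(mat (c0 l \<zeta> / visc l q) + t *\<^sub>R K') *v u + (\<i> * complex_of_real x) *s ((mat m + t *\<^sub>R Ginf) *v u)
      = - complex_of_real (x\<^sup>2) *s u"
  define \<alpha> where "\<alpha> = visc l q"
  have \<alpha>: "\<alpha> \<noteq> 0" using visc_pos[of l q] by (simp add: \<alpha>_def)
  define X where "X = s * x"
  have XX: "X * X = x * x" unfolding X_def by (metis sign_square mult.assoc mult.commute mult_1)
  define \<sigma> \<eta> \<tau> \<gamma> where "\<sigma> = sig q" and "\<eta> = snd \<zeta>" and "\<tau> = snd \<zeta> $ l" and "\<gamma> = fst \<zeta>"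
  define a where "a j = cmat (A j p) *v u" for j
  define S\<sigma>\<eta> S\<sigma>\<sigma> S\<eta>\<eta> where "S\<sigma>\<eta> = (\<Sum>j\<in>- {l}. \<sigma> $ j * \<eta> $ j)" and "S\<sigma>\<sigma> = (\<Sum>j\<in>- {l}. (\<sigma> $ j)\<^sup>2)"
    and "S\<eta>\<eta> = (\<Sum>j\<in>- {l}. (\<eta> $ j)\<^sup>2)"
  define \<xi> where "\<xi> = (\<chi> j. if j = l then X else \<eta> $ j - X * \<sigma> $ j)"
  define N where "N = (\<Sum>j\<in>- {l}. (\<xi> $ j)\<^sup>2)"
  define R where "R = \<gamma> + X * X + N"
  define \<tau>' where "\<tau>' = \<tau> - t * X * \<sigma> $ l"
  have N_eq: "N = S\<eta>\<eta> - 2 * X * S\<sigma>\<eta> + X * X * S\<sigma>\<sigma>"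
  proof -
    have "N = (\<Sum>j\<in>- {l}. (\<eta> $ j)\<^sup>2 - 2 * X * (\<sigma> $ j * \<eta> $ j) + X * X * (\<sigma> $ j)\<^sup>2)"
      unfolding N_def by (intro sum.cong) (auto simp: \<xi>_def power2_eq_square algebra_simps)
    then show ?thesis
      by (simp add: S\<sigma>\<eta>_def S\<sigma>\<sigma>_def S\<eta>\<eta>_def sum.distrib sum_subtractf sum_distrib_left)
  qed
  have \<alpha>_eq: "\<alpha> = 1 + S\<sigma>\<sigma>" by (simp add: \<alpha>_def visc_def normsq_tan_def S\<sigma>\<sigma>_def \<sigma>_def)
  have c0_eq: "c0 l \<zeta> = \<i> * \<tau> + \<gamma> + S\<eta>\<eta>"
    by (simp add: c0_def normsq_tan_def S\<eta>\<eta>_def \<eta>_def \<tau>_def \<gamma>_def)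
  have S_i: "(\<Sum>j\<in>- {l}. sig q $ j * \<i> * snd \<zeta> $ j) = \<i> * complex_of_real S\<sigma>\<eta>"
    by (simp add: S\<sigma>\<eta>_def sum_distrib_left \<sigma>_def \<eta>_def mult_ac)
  have K'u: "K' *v u = (1 / \<alpha>) *\<^sub>R (\<Sum>j\<in>- {l}. (\<i> * \<eta> $ j) *s a j)"
    by (simp add: K'_def matvec_scaleR sum_matvec smat_matvec a_def \<eta>_def \<alpha>_def)
  have Gu: "Ginf *v u = (s / \<alpha>) *\<^sub>R (a l - \<sigma> $ l *\<^sub>R u - (\<Sum>j\<in>- {l}. \<sigma> $ j *\<^sub>R a j))"
    by (simp add: Ginf_def matvec_scaleR cmat_Acal a_def \<sigma>_def \<alpha>_def)
  \<comment> \<open>the equation multiplied by \<open>\<alpha>\<close>\<close>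
  have eq1: "c0 l \<zeta> *s u + complex_of_real t *s (\<Sum>j\<in>- {l}. (\<i> * \<eta> $ j) *s a j)
      + (\<i> * X * (2 * (\<i> * S\<sigma>\<eta>))) *s u
      + (\<i> * X * t) *s (a l - \<sigma> $ l *\<^sub>R u - (\<Sum>j\<in>- {l}. \<sigma> $ j *\<^sub>R a j))
      = - complex_of_real (\<alpha> * (X * X)) *s u"
  proof -
    have "complex_of_real \<alpha> *s ((mat (c0 l \<zeta> / visc l q) + t *\<^sub>R K') *v u + (\<i> * complex_of_real x) *s ((mat m + t *\<^sub>R Ginf) *v u))
        = complex_of_real \<alpha> *s (- complex_of_real (x\<^sup>2) *s u)" using eq by simp
    moreover have "complex_of_real \<alpha> *s ((mat (c0 l \<zeta> / visc l q) + t *\<^sub>R K') *v u + (\<i> * complex_of_real x) *s ((mat m + t *\<^sub>R Ginf) *v u))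
        = c0 l \<zeta> *s u + complex_of_real t *s (\<Sum>j\<in>- {l}. (\<i> * \<eta> $ j) *s a j)
      + (\<i> * X * (2 * (\<i> * S\<sigma>\<eta>))) *s u
      + (\<i> * X * t) *s (a l - \<sigma> $ l *\<^sub>R u - (\<Sum>j\<in>- {l}. \<sigma> $ j *\<^sub>R a j))"
      unfolding matrix_vector_mult_add_rdistrib mat_matvec matvec_scaleR K'u Gu m_def S_i \<alpha>_def[symmetric] scaleR_eq_scale
      using \<alpha> by (simp add: vec.scale_right_distrib X_def mult_ac)
    ultimately show ?thesis by (simp add: XX power2_eq_square)
  qed
  define S where "S = cmat (\<Sum>j\<in>UNIV. \<xi> $ j *\<^sub>R A j p) *v u"
  have S_eq: "S = X *\<^sub>R a l + (\<Sum>j\<in>- {l}. \<eta> $ j *\<^sub>R a j) - X *\<^sub>R (\<Sum>j\<in>- {l}. \<sigma> $ j *\<^sub>R a j)"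
  proof -
    have "(\<Sum>j\<in>- {l}. \<xi> $ j *\<^sub>R a j) = (\<Sum>j\<in>- {l}. \<eta> $ j *\<^sub>R a j - X *\<^sub>R (\<sigma> $ j *\<^sub>R a j))"
      by (intro sum.cong) (auto simp: \<xi>_def scaleR_left_diff_distrib)
    then show ?thesis
      unfolding S_def cmat_sum_A a_def[symmetric]
      by (simp add: sum_subtractf scaleR_sum_right) (simp add: \<xi>_def)
  qed
  have i_sum: "(\<Sum>j\<in>- {l}. (\<i> * \<eta> $ j) *s a j) = \<i> *s (\<Sum>j\<in>- {l}. \<eta> $ j *\<^sub>R a j)"
    by (simp add: vec.scale_sum_right scaleR_eq_scale)
  have "(\<i> * t) *s S = - (R + \<i> * \<tau>') *s u"
  proof -
    define e h where "e = (\<Sum>j\<in>- {l}. \<eta> $ j *\<^sub>R a j)" and "h = (\<Sum>j\<in>- {l}. \<sigma> $ j *\<^sub>R a j)"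
    note eq2 = eq1[unfolded i_sum, folded e_def h_def] and S_eq2 = S_eq[folded e_def h_def]
    have "((\<i> * t) *s S) $ i = (- (R + \<i> * \<tau>') *s u) $ i" for i
    proof -
      have "(c0 l \<zeta> * u $ i + complex_of_real t * (\<i> * e $ i)
          + (\<i> * X * (2 * (\<i> * S\<sigma>\<eta>))) * u $ i
          + (\<i> * X * t) * (a l $ i - \<sigma> $ l * u $ i - h $ i))
          = - complex_of_real (\<alpha> * (X * X)) * u $ i"
        using arg_cong[OF eq2, of "\<lambda>v. v $ i"] unfolding scaleR_eq_scale
        by (simp only: vector_add_component vector_minus_component vector_smult_component)
      moreover have L: "((\<i> * t) *s S) $ i = \<i> * t * (X * a l $ i + e $ i - X * h $ i)"
        unfolding S_eq2 scaleR_eq_scale by (simp only: vector_add_component vector_minus_component vector_smult_component)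
      moreover have "\<i> * (\<i> * y) = - y" for y by (simp flip: mult.assoc)
      ultimately show ?thesis
        unfolding L c0_eq \<alpha>_eq R_def N_eq \<tau>'_def by (simp add: algebra_simps)
    qed
    then show ?thesis by (simp add: vec_eq_iff)
  qed
  note S_u = this
  have N0: "N \<ge> 0" unfolding N_def by (intro sum_nonneg) auto
  have R0: "R \<ge> 0" using \<zeta>(2) N0 by (simp add: R_def \<gamma>_def)
  show False
  proof (cases "t = 0 \<or> \<xi> = 0")
    case True
    then have "(\<i> * t) *s S = 0" by (auto simp: S_def cmat_def matrix_vector_mult_def vec_eq_iff)
    then have "- (complex_of_real R + \<i> * \<tau>') *s u = 0" using S_u by metis
    then have "complex_of_real R + \<i> * \<tau>' = 0" using u by (simp only: vec.scale_eq_0_iff neg_equal_0_iff_equal simp_thms)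
    then have z: "R = 0" "\<tau>' = 0" by (auto simp: complex_eq_iff)
    then have "X * X = 0" "N = 0" "\<gamma> = 0"
      using N0 \<zeta>(2) zero_le_square[of X] unfolding R_def \<gamma>_def by linarith+
    then have X0: "X = 0" by simp
    have "\<tau> = 0" using z(2) X0 by (simp add: \<tau>'_def)
    have "(\<xi> $ j)\<^sup>2 = 0" if "j \<noteq> l" for j
      using \<open>N = 0\<close> that unfolding N_def by (subst (asm) sum_nonneg_eq_0_iff) auto
    then have "\<eta> $ j = 0" if "j \<noteq> l" for j using that X0 by (simp add: \<xi>_def)
    then have "snd \<zeta> $ j = 0" for j using \<open>\<tau> = 0\<close> by (cases "j = l") (auto simp: \<eta>_def \<tau>_def)
    then have "snd \<zeta> = 0" by (simp add: vec_eq_iff)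
    then show False using \<open>\<gamma> = 0\<close> \<zeta>(1) by (simp add: \<gamma>_def prod_eq_iff)
  next
    case False
    then have tpos: "t > 0" and \<xi>: "\<xi> \<noteq> 0" using t by auto
    have Rpos: "R > 0"
    proof (rule ccontr)
      assume "\<not> R > 0"
      then have "X * X = 0" "N = 0"
        using R0 N0 \<zeta>(2) zero_le_square[of X] unfolding R_def \<gamma>_def by linarith+
      then have "\<xi> $ j = 0" for j
        by (cases "j = l") (auto simp: \<xi>_def N_def sum_nonneg_eq_0_iff)
      then show False using \<xi> by (simp add: vec_eq_iff)
    qed
    define c where "c = \<i> * (R + \<i> * \<tau>') / t"
    have "S = c *s u"
    proof -
      have ti: "\<i> * complex_of_real t \<noteq> 0" using tpos by simp
      have "S = (1 / (\<i> * t)) *s ((\<i> * t) *s S)" using ti by simp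
      also have "\<dots> = (1 / (\<i> * t) * - (R + \<i> * \<tau>')) *s u" by (simp only: S_u vec.scale_scale)
      also have "1 / (\<i> * t) * - (R + \<i> * \<tau>') = c" using tpos by (simp add: c_def field_simps)
      finally show ?thesis .
    qed
    then have "is_eigenvalue (\<Sum>j\<in>UNIV. \<xi> $ j *\<^sub>R A j p) c"
      using u unfolding is_eigenvalue_def S_def by blast
    then have "c \<in> \<real>" using A_hyperbolic p_cases(1) \<xi> by blast
    moreover have "Im c = R / t" using tpos by (simp add: c_def)
    ultimately show False using Rpos tpos by (simp add: complex_is_Real_iff)
  qed
qed

lemma tendsto_dmat: "((\<lambda>z. dmat l A (W (s * z) q) (sig q) (Wz W (s * z) q)) \<longlongrightarrow> 0) at_top"
  if lim: "((\<lambda>z. Wz W (s * z) q) \<longlongrightarrow> 0) at_top"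
proof -
  let ?D = "\<lambda>w m. frechet_derivative (\<lambda>y. Acal l A y (sig q)) (at w) (axis m 1)"
  have "((\<lambda>z. dmat l A (W (s * z) q) (sig q) (Wz W (s * z) q)) \<longlongrightarrow>
      (\<chi> a m. \<Sum>b\<in>UNIV. complex_of_real (?D p m $ a $ b * 0 $ b))) at_top"
    unfolding dmat_def by (intro tendsto_intros tendsto_W_side continuous_dAcal lim)
  moreover have "(\<chi> a m. \<Sum>b\<in>UNIV. complex_of_real (?D p m $ a $ b * 0 $ b)) = 0"
    by (simp add: vec_eq_iff)
  ultimately show ?thesis by simp
qed

lemma continuous_Kcoef: "continuous_on {0..} (\<lambda>z. Kcoef l A W q \<zeta> (s * z))"
  unfolding Kcoef_def dmat_def
  by (intro continuous_intros continuous_W_side continuous_dAcal continuous_A continuous_side continuous_Wz qC)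

lemma continuous_Mcoef: "continuous_on {0..} (\<lambda>z. Mcoef l A W q \<zeta> (s * z))"
  unfolding Mcoef_def by (intro continuous_intros continuous_W_side continuous_Acal)

lemma Wz_decay:
  obtains d0 where "d0 > 0" "\<And>d. 0 < d \<Longrightarrow> d \<le> d0 \<Longrightarrow> \<exists>c. \<forall>z\<ge>0. norm (Wz W (s * z) q) \<le> c * exp (- d * z)"
proof -
  obtain d0 where d0: "d0 > 0" and dec: "\<And>d U. 0 < d \<Longrightarrow> d \<le> d0 \<Longrightarrow> sol G U \<Longrightarrow> bounded (U ` {0..}) \<Longrightarrow>
      \<exists>c. \<forall>z\<ge>0. norm (U z) \<le> c * exp (- d * z)"
    using bounded_solutions_decay[OF continuous_G G_lim hyperbolic_Ginf] by metis
  show ?thesis using that[OF d0] dec[OF _ _ Wz_sol Wz_bounded] by simp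
qed

lemma Wz_lim: "((\<lambda>z. Wz W (s * z) q) \<longlongrightarrow> 0) at_top"
proof -
  obtain d c where d: "d > 0" and c: "\<And>z. z \<ge> 0 \<Longrightarrow> norm (Wz W (s * z) q) \<le> c * exp (- d * z)"
    using Wz_decay by (metis order_refl)
  have "filterlim (\<lambda>z. - (d * z)) at_bot at_top"
    unfolding filterlim_uminus_at_bot minus_minus
    by (rule filterlim_tendsto_pos_mult_at_top[OF tendsto_const d filterlim_ident])
  then have "((\<lambda>z. exp (- d * z)) \<longlongrightarrow> 0) at_top"
    by (intro filterlim_compose[OF exp_at_bot]) simp
  then have "((\<lambda>z. c * exp (- d * z)) \<longlongrightarrow> 0) at_top" using tendsto_mult_right_zero by blast
  then show ?thesis
    by (rule Lim_null_comparison[rotated]) (use c in \<open>auto simp: eventually_at_top_linorder\<close>)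
qed

lemma Kcoef_lim:
  "((\<lambda>z. Kcoef l A W q \<zeta> (s * z)) \<longlongrightarrow> mat (c0 l \<zeta> / visc l q) +
     (1 / visc l q) *\<^sub>R (\<Sum>j\<in>- {l}. smat (\<i> * snd \<zeta> $ j) (cmat (A j p)))) at_top"
proof -
  have "((\<lambda>z. Kcoef l A W q \<zeta> (s * z)) \<longlongrightarrow> (1 / visc l q) *\<^sub>R (0 + mat (c0 l \<zeta>)
      + (\<Sum>j\<in>- {l}. smat (\<i> * snd \<zeta> $ j) (cmat (A j p))))) at_top"
    unfolding Kcoef_def by (intro tendsto_intros tendsto_dmat Wz_lim tendsto_W_side continuous_A)
  moreover have "(1 / visc l q) *\<^sub>R mat (c0 l \<zeta>) = (mat (c0 l \<zeta> / visc l q) :: complex^'n^'n)"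
    by (auto simp: vec_eq_iff mat_def scaleR_conv_of_real[of "1 / visc l q" "c :: complex" for c])
  ultimately show ?thesis by (simp add: scaleR_right_distrib)
qed

lemma Mcoef_lim:
  "((\<lambda>z. s *\<^sub>R Mcoef l A W q \<zeta> (s * z)) \<longlongrightarrow>
     mat (complex_of_real (s / visc l q) * (2 * (\<Sum>j\<in>- {l}. sig q $ j * \<i> * snd \<zeta> $ j))) + Ginf) at_top"
proof -
  let ?c = "2 * (\<Sum>j\<in>- {l}. sig q $ j * \<i> * snd \<zeta> $ j)"
  have "((\<lambda>z. s *\<^sub>R Mcoef l A W q \<zeta> (s * z)) \<longlongrightarrow>
      s *\<^sub>R ((1 / visc l q) *\<^sub>R (cmat (Acal l A p (sig q)) + mat ?c))) at_top"
    unfolding Mcoef_def by (intro tendsto_intros tendsto_W_side continuous_Acal)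
  moreover have "(s / visc l q) *\<^sub>R mat ?c = (mat (complex_of_real (s / visc l q) * ?c) :: complex^'n^'n)"
    by (auto simp: vec_eq_iff mat_def scaleR_conv_of_real[of "s / visc l q" "c :: complex" for c])
  ultimately show ?thesis by (simp add: scaleR_right_distrib Ginf_def add.commute)
qed

lemma dim_bounded_data_side:
  assumes \<zeta>: "\<zeta> \<noteq> 0" "fst \<zeta> \<ge> 0"
  shows "vec.dim (bounded_data (side_matrix l A W q s \<zeta>)) = CARD('n)"
proof -
  have "vec.dim (bounded_data (\<lambda>z. comp2 (Kcoef l A W q \<zeta> (s * z)) (s *\<^sub>R Mcoef l A W q \<zeta> (s * z)))) = CARD('n)"
  proof (rule bounded_data_dim_second_order[OF continuous_Kcoef _ Kcoef_lim Mcoef_lim])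
    show "continuous_on {0..} (\<lambda>z. s *\<^sub>R Mcoef l A W q \<zeta> (s * z))"
      by (intro continuous_intros continuous_Mcoef)
    show "Re (complex_of_real (s / visc l q) * (2 * (\<Sum>j\<in>- {l}. sig q $ j * \<i> * snd \<zeta> $ j))) = 0"
      by (simp add: Re_divide_of_real)
  qed (use hyperbolic_side[OF \<zeta>] in auto)
  then show ?thesis unfolding side_matrix_def .
qed

text \<open>The change of variable \<open>z \<mapsto> s z\<close> reverses the sign of \<open>u'\<close> on the left half-line. Boundedness of
  \<open>u\<close> alone, as required in \<open>Espace\<close>, implies that of \<open>u'\<close> by \<open>derivative_bound\<close>.\<close>

lemma Espace_eq: "Espace {z. 0 \<le> s * z} l A W q \<zeta>h \<rho> = reflect s ` bounded_data (side_matrix l A W q s (\<rho> *\<^sub>R \<zeta>h))"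
proof -
  let ?S = "{z. 0 \<le> s * z}" and ?\<zeta> = "\<rho> *\<^sub>R \<zeta>h"
  let ?K = "Kcoef l A W q ?\<zeta>" and ?M = "Mcoef l A W q ?\<zeta>" and ?B = "side_matrix l A W q s ?\<zeta>"
  have twice: "s * (s * z) = z" for z using s by auto
  have S: "s * z \<in> ?S" if "z \<ge> 0" for z using that twice[of z] by (metis mem_Collect_eq)
  show ?thesis
  proof (intro equalityI subsetI)
    fix x assume "x \<in> Espace ?S l A W q \<zeta>h \<rho>"
    then obtain u v where uv: "x = vjoin (u 0) (v 0)" "solves_on ?S l A W q ?\<zeta> (\<lambda>_. 0) u v" "bounded (u ` ?S)"
      unfolding Espace_def by blast
    then obtain a where a: "\<And>z. z \<in> ?S \<Longrightarrow> (u has_vector_derivative v z) (at z within ?S)"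
      "\<And>z. z \<in> ?S \<Longrightarrow> (v has_vector_derivative a z) (at z within ?S)"
      "\<And>z. z \<in> ?S \<Longrightarrow> a z = ?K z *v u z + ?M z *v v z"
      unfolding solves_on_def Lop_zero_iff by blast
    let ?u = "\<lambda>z. u (s * z)" and ?v = "\<lambda>z. s *\<^sub>R v (s * z)"
    have du: "(?u has_vector_derivative ?v z) (at z within {0..})" if "z \<ge> 0" for z
      by (rule has_vector_derivative_dilate) (use a(1)[OF S[OF that]] in \<open>simp add: dilate_half_line\<close>)
    have dv: "(?v has_vector_derivative a (s * z)) (at z within {0..})" if "z \<ge> 0" for z
    proof -
      have "((\<lambda>z. v (s * z)) has_vector_derivative s *\<^sub>R a (s * z)) (at z within {0..})"
        by (rule has_vector_derivative_dilate) (use a(2)[OF S[OF that]] in \<open>simp add: dilate_half_line\<close>)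
      from has_vector_derivative_scaleR[OF DERIV_const this, of s] show ?thesis by simp
    qed
    have eq: "a (s * z) = ?K (s * z) *v ?u z + (s *\<^sub>R ?M (s * z)) *v ?v z" if "z \<ge> 0" for z
      using a(3)[OF S[OF that]] by (simp add: matvec_scaleR)
    obtain L1' where L1': "L1' \<ge> 0" "\<And>z. z \<ge> 0 \<Longrightarrow> norm (?K (s * z)) \<le> L1'"
      using bdd_cont_bound[OF bdd_cont_of_limit[OF continuous_Kcoef Kcoef_lim]] by blast
    obtain L2' where L2': "L2' \<ge> 0" "\<And>z. z \<ge> 0 \<Longrightarrow> norm (s *\<^sub>R ?M (s * z)) \<le> L2'"
      using bdd_cont_bound[OF bdd_cont_of_limit[OF continuous_on_scaleR[OF continuous_on_const continuous_Mcoef] Mcoef_lim]] by blast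
    obtain M where M: "\<And>z. z \<ge> 0 \<Longrightarrow> norm (?u z) \<le> M"
      using uv(3) S unfolding bounded_iff by blast
    have v_le: "norm (?v z) \<le> (8 * ((L1' + L2') + 1) * (1 + exp 2) + 1) * M" if z: "z \<ge> 0" for z
    proof (rule derivative_bound[where u = ?u and a = "\<lambda>z. a (s * z)", OF du dv _ _ M z])
      fix z :: real assume z: "z \<ge> 0"
      have "norm (a (s * z)) \<le> L1' * norm (?u z) + L2' * norm (?v z)"
        unfolding eq[OF z]
      proof (intro norm_triangle_mono)
        show "norm (?K (s * z) *v ?u z) \<le> L1' * norm (?u z)"
          using norm_matvec_le mult_right_mono[OF L1'(2)[OF z] norm_ge_zero] by (rule order_trans)
        show "norm ((s *\<^sub>R ?M (s * z)) *v ?v z) \<le> L2' * norm (?v z)"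
          using norm_matvec_le mult_right_mono[OF L2'(2)[OF z] norm_ge_zero] by (rule order_trans)
      qed
      also have "\<dots> \<le> (L1' + L2') * (norm (?u z) + norm (?v z))"
        using L1'(1) L2'(1) by (simp add: algebra_simps)
      finally show "norm (a (s * z)) \<le> (L1' + L2') * (norm (?u z) + norm (?v z))" .
    qed (use L1' L2' in auto)
    have "sol ?B (\<lambda>z. vjoin (?u z) (?v z))"
      unfolding ode_def
    proof (intro allI impI)
      fix z :: real assume z: "z \<ge> 0"
      show "((\<lambda>z. vjoin (?u z) (?v z)) has_vector_derivative ?B z *v vjoin (?u z) (?v z) + 0) (at z within {0..})"
        using has_vector_derivative_vjoin[OF du[OF z] dv[OF z]] unfolding eq[OF z]
        by (simp add: side_matrix_def comp2_matvec)
    qed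
    moreover have "norm (vjoin (?u z) (?v z)) \<le> M + (8 * ((L1' + L2') + 1) * (1 + exp 2) + 1) * M" if "z \<ge> 0" for z
      using norm_vjoin_le[of "?u z" "?v z"] M[OF that] v_le[OF that] by linarith
    then have "bounded ((\<lambda>z. vjoin (?u z) (?v z)) ` {0..})" by (auto simp: bounded_iff intro!: exI)
    ultimately have "vjoin (?u 0) (?v 0) \<in> bounded_data ?B"
      unfolding bounded_data_def by (intro CollectI exI[of _ "\<lambda>z. vjoin (?u z) (?v z)"] conjI refl)
    moreover have "x = reflect s (vjoin (?u 0) (?v 0))" by (simp add: reflect_vjoin uv(1))
    ultimately show "x \<in> reflect s ` bounded_data ?B" by blast
  next
    fix x assume "x \<in> reflect s ` bounded_data ?B"
    then obtain U M where U: "sol ?B U" "\<And>z. z \<ge> 0 \<Longrightarrow> norm (U z) \<le> M" "x = reflect s (U 0)"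
      by (auto simp: bounded_data_def bounded_half_line_iff)
    define u v where "u z = (\<chi> i. U z $ Inl i)" and "v z = (\<chi> i. U z $ Inr i)" for z
    have Uuv: "U z = vjoin (u z) (v z)" for z by (rule vec_eq_vjoin) (auto simp: u_def v_def)
    have der: "(u has_vector_derivative v z) (at z within {0..})"
      "(v has_vector_derivative ?K (s * z) *v u z + (s *\<^sub>R ?M (s * z)) *v v z) (at z within {0..})" if "z \<ge> 0" for z
    proof -
      have "((\<lambda>z. vjoin (u z) (v z)) has_vector_derivative
          vjoin (v z) (?K (s * z) *v u z + (s *\<^sub>R ?M (s * z)) *v v z)) (at z within {0..})"
        using odeD[OF U(1) that] by (simp add: Uuv[abs_def] side_matrix_def comp2_matvec)
      from has_vector_derivative_vjoinD[OF this]
      show "(u has_vector_derivative v z) (at z within {0..})"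
        "(v has_vector_derivative ?K (s * z) *v u z + (s *\<^sub>R ?M (s * z)) *v v z) (at z within {0..})" by blast+
    qed
    let ?u = "\<lambda>z. u (s * z)" and ?v = "\<lambda>z. s *\<^sub>R v (s * z)"
    let ?a = "\<lambda>z. ?K z *v ?u z + ?M z *v ?v z"
    have "solves_on ?S l A W q ?\<zeta> (\<lambda>_. 0) ?u ?v"
      unfolding solves_on_def Lop_zero_iff
    proof (intro exI[of _ ?a] ballI conjI)
      fix z assume z: "z \<in> ?S"
      then have sz: "s * z \<ge> 0" by simp
      show "(?u has_vector_derivative ?v z) (at z within ?S)"
        by (rule has_vector_derivative_dilate) (use der(1)[OF sz] in \<open>simp add: dilate_half_line\<close>)
      have "((\<lambda>z. v (s * z)) has_vector_derivative s *\<^sub>R (?K (s * (s * z)) *v u (s * z) + (s *\<^sub>R ?M (s * (s * z))) *v v (s * z))) (at z within ?S)"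
        by (rule has_vector_derivative_dilate) (use der(2)[OF sz] in \<open>simp add: dilate_half_line\<close>)
      from has_vector_derivative_scaleR[OF DERIV_const this, of s]
      show "(?v has_vector_derivative ?a z) (at z within ?S)"
        unfolding twice by (simp add: matvec_scaleR scaleR_right_distrib)
    qed auto
    moreover have "norm (u z) \<le> M" if "z \<ge> 0" for z
      using U(2)[OF that] norm_le_vjoin(1)[of "u z" "v z"] by (simp add: Uuv)
    then have "bounded (?u ` ?S)" by (auto simp: bounded_iff intro!: exI[of _ M])
    moreover have "x = vjoin (?u 0) (?v 0)" by (simp add: U(3) Uuv reflect_vjoin)
    ultimately show "x \<in> Espace ?S l A W q \<zeta>h \<rho>"
      unfolding Espace_def by (intro CollectI exI[of _ ?u] exI[of _ ?v] conjI)
  qed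
qed

definition Xdata where "Xdata = vjoin (cvec (Wz W 0 q)) (cvec (Wzz W 0 q))"

lemma subspace_Espace: "vec.subspace (Espace {z. 0 \<le> s * z} l A W q \<zeta>h \<rho>)"
  unfolding Espace_eq using subspace_bounded_data[of "side_matrix l A W q s (\<rho> *\<^sub>R \<zeta>h)"]
  unfolding vec.subspace_def
  by (auto simp: image_iff) (metis reflect_scale vec.scale_zero_left, metis reflect_add, metis reflect_scale)

lemma dim_Espace:
  assumes "\<zeta>h \<in> half_sphere" "\<rho> > 0"
  shows "vec.dim (Espace {z. 0 \<le> s * z} l A W q \<zeta>h \<rho>) = CARD('n)"
proof -
  have \<zeta>: "\<rho> *\<^sub>R \<zeta>h \<noteq> 0" "fst (\<rho> *\<^sub>R \<zeta>h) \<ge> 0" using assms by (auto simp: half_sphere_def)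
  let ?D = "bounded_data (side_matrix l A W q s (\<rho> *\<^sub>R \<zeta>h))"
  interpret f: Vector_Spaces.linear "(*s)" "(*s)" "reflect s :: complex^('n + 'n) \<Rightarrow> _"
    by unfold_locales (auto simp: reflect_add reflect_scale vec.scale_right_distrib vec.scale_left_distrib)
  have "inj_on (reflect s) (vec.span ?D)" by (rule inj_on_inverseI[of _ "reflect s"]) (simp add: reflect_reflect)
  then have "vec.dim (reflect s ` ?D) = vec.dim ?D" by (intro vec.dim_image_eq f.linear_axioms)
  then show ?thesis unfolding Espace_eq using dim_bounded_data_side[OF \<zeta>] by simp
qed

lemma profile_sol:
  "sol (side_matrix l A W q s 0) (\<lambda>z. vjoin (cvec (Wz W (s * z) q)) (s *\<^sub>R cvec (Wzz W (s * z) q)))"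
  unfolding ode_def
proof (intro allI impI)
  fix z :: real assume "z \<ge> 0"
  have 1: "((\<lambda>z. cvec (Wz W (s * z) q)) has_vector_derivative s *\<^sub>R cvec (Wzz W (s * z) q)) (at z within {0..})"
    by (rule has_vector_derivative_dilate[OF cvec_Wz_deriv])
  have "((\<lambda>z. cvec (Wzz W (s * z) q)) has_vector_derivative s *\<^sub>R cvec (Wzzz (s * z) q)) (at z within {0..})"
    by (rule has_vector_derivative_dilate[OF cvec_Wzz_deriv])
  from has_vector_derivative_scaleR[OF DERIV_const this, of s]
  have 2: "((\<lambda>z. s *\<^sub>R cvec (Wzz W (s * z) q)) has_vector_derivative cvec (Wzzz (s * z) q)) (at z within {0..})"
    by simp
  have "L1 l A W q 0 (s * z) = 0" by (simp add: L1_def Let_def normsq_tan_def case_prod_beta)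
  then have "cvec (Wzzz (s * z) q) = Kcoef l A W q 0 (s * z) *v cvec (Wz W (s * z) q) + Mcoef l A W q 0 (s * z) *v cvec (Wzz W (s * z) q)"
    using Lop_profile[OF qC, of 0 "s * z"] by (simp add: Lop_zero_iff)
  then show "((\<lambda>z. vjoin (cvec (Wz W (s * z) q)) (s *\<^sub>R cvec (Wzz W (s * z) q))) has_vector_derivative
      side_matrix l A W q s 0 z *v vjoin (cvec (Wz W (s * z) q)) (s *\<^sub>R cvec (Wzz W (s * z) q)) + 0) (at z within {0..})"
    using has_vector_derivative_vjoin[OF 1 2] by (simp add: side_matrix_def comp2_matvec matvec_scaleR)
qed

text \<open>At zero frequency the eigenvalues of the limit matrix are \<open>0\<close> and those of \<open>Ginf\<close>, which are
  real and nonzero; a small exponential weight moves \<open>0\<close> off the imaginary axis and no other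
  eigenvalue onto it.\<close>

lemma hyperbolic_weighted:
  obtains d1 where "d1 > 0"
    "\<And>d. 0 < d \<Longrightarrow> d < d1 \<Longrightarrow> hyperbolic (comp2 0 Ginf + mat (complex_of_real d))"
proof -
  have vis: "visc l q \<noteq> 0" using visc_pos[of l q] by simp
  obtain N where N: "\<And>v. N *v (cmat (Acal l A p (sig q)) *v v) = v"
    using cmat_invertible[OF Acal_p_invertible] by blast
  define N' where "N' = (visc l q * s) *\<^sub>R N"
  have N': "N' *v (Ginf *v v) = v" for v using N[of v] vis by (simp add: N'_def Ginf_def matvec_scaleR)
  show ?thesis
  proof (rule that[of "1 / (norm N' + 1)"])
    show "1 / (norm N' + 1) > 0" by (simp add: add_nonneg_pos)
    fix d :: real assume d: "0 < d" "d < 1 / (norm N' + 1)"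
    show "hyperbolic (comp2 0 Ginf + mat (complex_of_real d))"
      unfolding hyperbolic_def
    proof (intro allI impI)
      fix r assume "eigenvalue (comp2 0 Ginf + mat (complex_of_real d)) r"
      then obtain w where w: "w \<noteq> 0" "comp2 0 Ginf *v w + complex_of_real d *s w = r *s w"
        by (auto simp: eigenvalue_def mat_matvec_add)
      then have "comp2 0 Ginf *v w = (r - d) *s w" by (simp add: vec.scale_left_diff_distrib eq_diff_eq)
      then have "eigenvalue (comp2 0 Ginf) (r - d)" unfolding eigenvalue_def using w(1) by blast
      then obtain u where u: "u \<noteq> 0" "0 *v u + (r - d) *s (Ginf *v u) = ((r - d) * (r - d)) *s u"
        by (rule eigenvalue_comp2)
      show "Re r \<noteq> 0"
      proof (cases "r - d = 0")
        case True
        then have "r = complex_of_real d" by simp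
        then show ?thesis using d by simp
      next
        case False
        have "(r - d) *s (Ginf *v u) = (r - d) *s ((r - d) *s u)"
          using u(2) by (simp only: matrix_vector_mult_0 add_0 vec.scale_scale)
        then have Gu: "Ginf *v u = (r - d) *s u" using False by (simp only: vec.scale_cancel_left simp_thms)
        then have ev: "eigenvalue Ginf (r - d)" unfolding eigenvalue_def using u(1) by blast
        then obtain x where x: "r - d = complex_of_real x" using Ginf_eigenvalue(1) by (auto elim: Reals_cases)
        have "norm u \<le> norm N' * norm (Ginf *v u)" using norm_matvec_le[of N' "Ginf *v u"] by (simp only: N')
        also have "\<dots> = norm N' * \<bar>x\<bar> * norm u" unfolding Gu x by (simp add: norm_scale)
        finally have "1 \<le> norm N' * \<bar>x\<bar>" using u(1) by simp
        show ?thesis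
        proof
          assume "Re r = 0"
          moreover have "Re (r - d) = x" using x by simp
          ultimately have "x = - d" by simp
          then have "1 \<le> norm N' * d" using \<open>1 \<le> norm N' * \<bar>x\<bar>\<close> d by simp
          also have "\<dots> \<le> (norm N' + 1) * d" using d by (simp add: distrib_right)
          also have "\<dots> < 1" using d(2) by (simp add: pos_less_divide_eq add_nonneg_pos mult.commute)
          finally show False by simp
        qed
      qed
    qed
  qed
qed

lemma normsq_tan_le: "normsq_tan l x \<le> (norm x)\<^sup>2"
proof -
  have "normsq_tan l x \<le> (\<Sum>j\<in>UNIV. (x $ j)\<^sup>2)" unfolding normsq_tan_def by (intro sum_mono2) auto
  also have "\<dots> = (norm x)\<^sup>2" by (simp add: norm_vec_def L2_set_def sum_nonneg)
  finally show ?thesis .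
qed

lemma cmod_c0_le: assumes "norm \<zeta> \<le> r" "r \<le> 1" shows "cmod (c0 l \<zeta>) \<le> 3 * r"
proof -
  have r0: "r \<ge> 0" using assms(1) norm_ge_zero order_trans by blast
  have f: "\<bar>fst \<zeta>\<bar> \<le> r" using norm_fst_le[of "fst \<zeta>" "snd \<zeta>"] assms by simp
  have n: "norm (snd \<zeta>) \<le> r" using norm_snd_le[of "snd \<zeta>" "fst \<zeta>"] assms by simp
  have "\<bar>snd \<zeta> $ l\<bar> \<le> r" using Finite_Cartesian_Product.norm_nth_le[of "snd \<zeta>" l] n by simp
  moreover have "normsq_tan l (snd \<zeta>) \<le> r"
  proof -
    have "normsq_tan l (snd \<zeta>) \<le> (norm (snd \<zeta>))\<^sup>2" by (rule normsq_tan_le)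
    also have "\<dots> \<le> r\<^sup>2" using n by (intro power_mono) auto
    also have "\<dots> \<le> r" using r0 assms(2) by (simp add: power2_eq_square mult_left_le)
    finally show ?thesis .
  qed
  moreover have "normsq_tan l (snd \<zeta>) \<ge> 0" unfolding normsq_tan_def by (intro sum_nonneg) auto
  moreover have "cmod (c0 l \<zeta>) \<le> \<bar>snd \<zeta> $ l\<bar> + \<bar>fst \<zeta>\<bar> + \<bar>normsq_tan l (snd \<zeta>)\<bar>"
    unfolding c0_def
    by (intro norm_triangle_le add_mono) (auto simp: norm_mult)
  ultimately show ?thesis using f by linarith
qed

lemma side_matrix_near:
  obtains C1 where "C1 \<ge> 0"
    "\<And>\<zeta> r z. norm \<zeta> \<le> r \<Longrightarrow> r \<le> 1 \<Longrightarrow> z \<ge> 0 \<Longrightarrow> norm (side_matrix l A W q s \<zeta> z - side_matrix l A W q s 0 z) \<le> C1 * r"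
proof -
  have "\<exists>La. La \<ge> 0 \<and> (\<forall>z\<ge>0. norm (cmat (A j (W (s * z) q))) \<le> La)" for j
    using bdd_cont_bound[OF bdd_cont_of_limit[OF continuous_on_cmat[OF continuous_W_side[OF continuous_A]]
        tendsto_cmat[OF tendsto_W_side[OF continuous_A]]], of j] by metis
  then obtain La where La: "\<And>j. La j \<ge> 0" "\<And>j z. z \<ge> 0 \<Longrightarrow> norm (cmat (A j (W (s * z) q))) \<le> La j" by metis
  define \<kappa> where "\<kappa> = norm (mat 1 :: complex^'n^'n)"
  have \<kappa>: "\<kappa> \<ge> 0" by (simp add: \<kappa>_def)
  have nm: "norm (mat c :: complex^'n^'n) = cmod c * \<kappa>" for c
  proof -
    have "(mat c :: complex^'n^'n) = smat c (mat 1)" by (auto simp: mat_def smat_def vec_eq_iff)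
    then show ?thesis by (simp add: norm_smat \<kappa>_def)
  qed
  have vis: "1 / visc l q \<le> 1" "1 / visc l q \<ge> 0"
    unfolding visc_def normsq_tan_def by (auto simp: divide_le_eq sum_nonneg add_nonneg_pos not_less add_nonneg_nonneg)
  define C1 where "C1 = (3 * \<kappa> + (\<Sum>j\<in>- {l}. La j)) + 2 * (\<Sum>j\<in>- {l}. \<bar>sig q $ j\<bar>) * \<kappa>"
  show ?thesis
  proof (rule that[of C1])
    show "C1 \<ge> 0" unfolding C1_def using \<kappa> La by (intro add_nonneg_nonneg mult_nonneg_nonneg sum_nonneg) auto
    fix \<zeta> :: "'d freq" and r z :: real assume \<zeta>: "norm \<zeta> \<le> r" "r \<le> 1" and z: "z \<ge> 0"
    have r0: "r \<ge> 0" using \<zeta>(1) norm_ge_zero order_trans by blast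
    have \<eta>: "\<bar>snd \<zeta> $ j\<bar> \<le> r" for j
      using Finite_Cartesian_Product.norm_nth_le[of "snd \<zeta>" j] norm_snd_le[of "snd \<zeta>" "fst \<zeta>"] \<zeta> by simp
    let ?E = "mat (c0 l \<zeta>) + (\<Sum>j\<in>- {l}. smat (\<i> * snd \<zeta> $ j) (cmat (A j (W (s * z) q))))"
    let ?c = "2 * (\<Sum>j\<in>- {l}. sig q $ j * \<i> * snd \<zeta> $ j)"
    have z0: "c0 l 0 = 0" "smat 0 M = 0" "mat 0 = (0 :: complex^'n^'n)" for M :: "complex^'n^'n"
      by (auto simp: c0_def normsq_tan_def smat_def mat_def vec_eq_iff)
    have K: "Kcoef l A W q \<zeta> (s * z) - Kcoef l A W q 0 (s * z) = (1 / visc l q) *\<^sub>R ?E"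
      unfolding Kcoef_def scaleR_right_diff_distrib[symmetric] by (simp add: z0)
    have M: "s *\<^sub>R Mcoef l A W q \<zeta> (s * z) - s *\<^sub>R Mcoef l A W q 0 (s * z) = s *\<^sub>R ((1 / visc l q) *\<^sub>R mat ?c)"
      unfolding Mcoef_def scaleR_right_diff_distrib[symmetric] by (simp add: z0)
    have E_le: "norm ?E \<le> (3 * \<kappa> + (\<Sum>j\<in>- {l}. La j)) * r"
    proof -
      have "norm ?E \<le> 3 * r * \<kappa> + (\<Sum>j\<in>- {l}. r * La j)"
      proof (intro norm_triangle_mono sum_norm_le)
        show "norm (mat (c0 l \<zeta>) :: complex^'n^'n) \<le> 3 * r * \<kappa>"
          unfolding nm by (intro mult_right_mono cmod_c0_le \<zeta> \<kappa>)
        show "norm (smat (\<i> * snd \<zeta> $ j) (cmat (A j (W (s * z) q)))) \<le> r * La j" for j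
          unfolding norm_smat using \<eta>[of j] La z r0 by (intro mult_mono) (auto simp: norm_mult)
      qed
      then show ?thesis by (simp add: sum_distrib_left algebra_simps)
    qed
    have c_le: "cmod ?c \<le> 2 * (\<Sum>j\<in>- {l}. \<bar>sig q $ j\<bar>) * r"
    proof -
      have "cmod (\<Sum>j\<in>- {l}. sig q $ j * \<i> * snd \<zeta> $ j) \<le> (\<Sum>j\<in>- {l}. \<bar>sig q $ j\<bar> * r)"
        by (intro sum_norm_le) (auto simp: norm_mult intro!: mult_left_mono \<eta>)
      then show ?thesis by (simp add: norm_mult sum_distrib_right)
    qed
    have "norm (side_matrix l A W q s \<zeta> z - side_matrix l A W q s 0 z) \<le> norm ((1 / visc l q) *\<^sub>R ?E) + norm (s *\<^sub>R ((1 / visc l q) *\<^sub>R (mat ?c :: complex^'n^'n)))"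
      unfolding side_matrix_def K[symmetric] M[symmetric] by (rule norm_comp2_diff_le)
    also have "\<dots> \<le> norm ?E + norm (mat ?c :: complex^'n^'n)"
    proof -
      have "norm ((1 / visc l q) *\<^sub>R Z) \<le> norm Z" for Z :: "complex^'n^'n"
        using mult_right_mono[OF vis(1) norm_ge_zero[of Z]] vis(2) by simp
      moreover have "\<bar>s\<bar> = 1" using s by auto
      ultimately show ?thesis by (intro add_mono) (simp_all only: norm_scaleR[of s] mult_1)
    qed
    also have "\<dots> \<le> (3 * \<kappa> + (\<Sum>j\<in>- {l}. La j)) * r + 2 * (\<Sum>j\<in>- {l}. \<bar>sig q $ j\<bar>) * r * \<kappa>"
      unfolding nm by (intro add_mono E_le mult_right_mono c_le \<kappa>)
    also have "\<dots> = C1 * r" by (simp add: C1_def algebra_simps)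
    finally show "norm (side_matrix l A W q s \<zeta> z - side_matrix l A W q s 0 z) \<le> C1 * r" .
  qed
qed

text \<open>\<open>W'\<close> is an exponentially decaying solution at frequency \<open>0\<close>, and at frequency \<open>\<rho> \<zeta>h\<close> the coefficients
  differ by \<open>O(\<rho>)\<close>, uniformly in \<open>\<zeta>h\<close>.\<close>

theorem Espace_near_profile:
  "\<exists>K \<rho>1. K \<ge> 0 \<and> \<rho>1 > 0 \<and> (\<forall>\<zeta>h\<in>half_sphere. \<forall>\<rho>. 0 < \<rho> \<and> \<rho> \<le> \<rho>1 \<longrightarrow>
     (\<exists>y\<in>Espace {z. 0 \<le> s * z} l A W q \<zeta>h \<rho>. norm (y - Xdata) \<le> K * \<rho>))"
proof -
  let ?B = "\<lambda>\<zeta> z. side_matrix l A W q s \<zeta> z"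
  let ?U0 = "\<lambda>z. vjoin (cvec (Wz W (s * z) q)) (s *\<^sub>R cvec (Wzz W (s * z) q))"
  have cB: "continuous_on {0..} (?B \<zeta>)" for \<zeta>
    unfolding side_matrix_def by (intro continuous_intros continuous_Kcoef continuous_Mcoef)
  have z0: "c0 l 0 = 0" "smat 0 M = 0" "mat 0 = (0 :: complex^'n^'n)" for M :: "complex^'n^'n"
    by (auto simp: c0_def normsq_tan_def smat_def mat_def vec_eq_iff)
  have limB: "(?B 0 \<longlongrightarrow> comp2 0 Ginf) at_top"
    using tendsto_comp2[OF Kcoef_lim[of 0] Mcoef_lim[of 0]] unfolding side_matrix_def by (simp add: z0)
  obtain d0 where d0: "d0 > 0" and dec: "\<And>d. 0 < d \<Longrightarrow> d \<le> d0 \<Longrightarrow> \<exists>c. \<forall>z\<ge>0. norm (Wz W (s * z) q) \<le> c * exp (- d * z)"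
    using Wz_decay by metis
  obtain d1 where d1: "d1 > 0" and hyp: "\<And>d. 0 < d \<Longrightarrow> d < d1 \<Longrightarrow> hyperbolic (comp2 0 Ginf + mat (complex_of_real d))"
    using hyperbolic_weighted by metis
  define d where "d = min d0 (d1 / 2)"
  have d: "0 < d" "d \<le> d0" "d < d1" using d0 d1 by (auto simp: d_def)
  obtain c where c: "\<And>z. z \<ge> 0 \<Longrightarrow> norm (Wz W (s * z) q) \<le> c * exp (- d * z)" using dec[OF d(1,2)] by blast
  obtain L where L: "L \<ge> 0" "\<And>z. z \<ge> 0 \<Longrightarrow> norm (G z) \<le> L"
    using bdd_cont_bound[OF bdd_cont_of_limit[OF continuous_G G_lim]] by blast
  have U0_le: "norm (?U0 z) \<le> ((1 + L) * c) * exp (- d * z)" if z: "z \<ge> 0" for z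
  proof -
    have "s *\<^sub>R cvec (Wzz W (s * z) q) = G z *v cvec (Wz W (s * z) q)"
      by (simp add: G_def Wzz_eq[OF qC] matvec_scaleR cmat_matvec cvec_scaleR)
    then have "norm (s *\<^sub>R cvec (Wzz W (s * z) q)) \<le> norm (G z) * norm (Wz W (s * z) q)"
      using norm_matvec_le[of "G z" "cvec (Wz W (s * z) q)"] by (simp del: norm_scaleR)
    also have "\<dots> \<le> L * (c * exp (- d * z))" using L z c[OF z] by (intro mult_mono) auto
    finally have "norm (s *\<^sub>R cvec (Wzz W (s * z) q)) \<le> L * (c * exp (- d * z))" .
    then show ?thesis
      using norm_vjoin_le[of "cvec (Wz W (s * z) q)" "s *\<^sub>R cvec (Wzz W (s * z) q)"] c[OF z]
      by (simp add: algebra_simps)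
  qed
  obtain C1 where C1: "C1 \<ge> 0"
    "\<And>\<zeta> r z. norm \<zeta> \<le> r \<Longrightarrow> r \<le> 1 \<Longrightarrow> z \<ge> 0 \<Longrightarrow> norm (?B \<zeta> z - ?B 0 z) \<le> C1 * r"
    using side_matrix_near by metis
  show ?thesis
  proof (rule bounded_solution_near[OF cB limB d(1) hyp[OF d(1,3)] profile_sol U0_le])
    fix K r
    assume K: "K \<ge> 0" "r > 0"
      "\<And>F t. continuous_on {0..} F \<Longrightarrow> (\<And>z. z \<ge> 0 \<Longrightarrow> norm (F z) \<le> t) \<Longrightarrow> t \<le> r \<Longrightarrow>
       \<exists>U. sol (\<lambda>z. ?B 0 z + F z) U \<and> bounded (U ` {0..}) \<and> norm (U 0 - ?U0 0) \<le> K * t"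
    show ?thesis
    proof (rule exI[of _ "K * C1"], rule exI[of _ "min 1 (r / (C1 + 1))"], intro conjI ballI allI impI)
      show "K * C1 \<ge> 0" using K C1 by simp
      show "min 1 (r / (C1 + 1)) > 0" using K C1 by simp
      fix \<zeta>h :: "'d freq" and \<rho> :: real
      assume \<zeta>h: "\<zeta>h \<in> half_sphere" and "0 < \<rho> \<and> \<rho> \<le> min 1 (r / (C1 + 1))"
      then have \<rho>: "0 < \<rho>" "\<rho> \<le> min 1 (r / (C1 + 1))" by auto
      let ?\<zeta> = "\<rho> *\<^sub>R \<zeta>h"
      have n: "norm ?\<zeta> \<le> \<rho>" using \<zeta>h \<rho> by (simp add: half_sphere_def)
      have t: "C1 * \<rho> \<le> r"
      proof -
        have "C1 * \<rho> \<le> (C1 + 1) * \<rho>" using \<rho> by (simp add: distrib_right)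
        also have "\<dots> \<le> r" using \<rho>(2) C1(1) by (simp add: pos_le_divide_eq add_nonneg_pos mult.commute)
        finally show ?thesis .
      qed
      have "\<exists>U. sol (\<lambda>z. ?B 0 z + (?B ?\<zeta> z - ?B 0 z)) U \<and> bounded (U ` {0..}) \<and> norm (U 0 - ?U0 0) \<le> K * (C1 * \<rho>)"
        using C1(2)[OF n] \<rho> t by (intro K(3) continuous_intros cB) auto
      then obtain U where U: "sol (?B ?\<zeta>) U" "bounded (U ` {0..})" "norm (U 0 - ?U0 0) \<le> K * (C1 * \<rho>)" by auto
      have "reflect s (U 0) \<in> Espace {z. 0 \<le> s * z} l A W q \<zeta>h \<rho>"
        unfolding Espace_eq bounded_data_def using U(1,2) by blast
      moreover have "reflect s (U 0) - Xdata = reflect s (U 0 - ?U0 0)"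
        by (simp add: reflect_diff reflect_vjoin Xdata_def)
      then have "norm (reflect s (U 0) - Xdata) = norm (U 0 - ?U0 0)"
        by (simp only: norm_reflect[OF s])
      then have "norm (reflect s (U 0) - Xdata) \<le> K * C1 * \<rho>" using U(3) by (simp only: mult.assoc)
      ultimately show "\<exists>y\<in>Espace {z. 0 \<le> s * z} l A W q \<zeta>h \<rho>. norm (y - Xdata) \<le> K * C1 * \<rho>" by blast
    qed
  qed
qed

end

section \<open>Comparison of the two Evans functions\<close>

lemma solves_on_add_scale:
  assumes "solves_on S l A W q \<zeta> f u v" "solves_on S l A W q \<zeta> g u' v'"
  shows "solves_on S l A W q \<zeta> (\<lambda>z. f z + c *s g z) (\<lambda>z. u z + c *s u' z) (\<lambda>z. v z + c *s v' z)"
proof -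
  from assms obtain a a' where a: "\<And>z. z \<in> S \<Longrightarrow> (u has_vector_derivative v z) (at z within S)"
      "\<And>z. z \<in> S \<Longrightarrow> (v has_vector_derivative a z) (at z within S)"
      "\<And>z. z \<in> S \<Longrightarrow> Lop l A W q \<zeta> z (u z) (v z) (a z) = f z"
    and a': "\<And>z. z \<in> S \<Longrightarrow> (u' has_vector_derivative v' z) (at z within S)"
      "\<And>z. z \<in> S \<Longrightarrow> (v' has_vector_derivative a' z) (at z within S)"
      "\<And>z. z \<in> S \<Longrightarrow> Lop l A W q \<zeta> z (u' z) (v' z) (a' z) = g z"
    unfolding solves_on_def by blast
  show ?thesis
    unfolding solves_on_def
    by (intro exI[of _ "\<lambda>z. a z + c *s a' z"] ballI conjI has_vector_derivative_add
        has_vector_derivative_const_scale a a') (simp_all add: Lop_add_scale a a')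
qed

context profile_side
begin

lemma Wz_bounded_half_line: "bounded ((\<lambda>z. cvec (Wz W z q)) ` {z. 0 \<le> s * z})"
  using Wz_bounded unfolding dilate_half_line(1)[symmetric] image_image .

lemma solves_on_profile:
  "solves_on T l A W q \<zeta> (L1 l A W q \<zeta>) (\<lambda>z. cvec (Wz W z q)) (\<lambda>z. cvec (Wzz W z q))"
  unfolding solves_on_def
  by (intro exI[of _ "\<lambda>z. cvec (Wzzz z q)"] ballI conjI cvec_Wz_deriv cvec_Wzz_deriv Lop_profile qC)

text \<open>Subtracting \<open>\<phi> W' / \<rho>\<close>, which solves the inhomogeneous equation, removes the forcing.\<close>

lemma inhomogeneous_data_iff:
  assumes \<rho>: "\<rho> > 0"
  shows "(\<exists>u v. x = vjoin (u 0) (v 0) \<and>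
      solves_on {z. 0 \<le> s * z} l A W q (\<rho> *\<^sub>R \<zeta>h) (\<lambda>z. \<phi> *s L1_check l A W q \<zeta>h \<rho> z) u v \<and>
      bounded (u ` {z. 0 \<le> s * z})) \<longleftrightarrow>
    x - (\<phi> / complex_of_real \<rho>) *s Xdata \<in> Espace {z. 0 \<le> s * z} l A W q \<zeta>h \<rho>"
    (is "?lhs \<longleftrightarrow> ?rhs")
proof -
  let ?S = "{z. 0 \<le> s * z}" and ?c = "\<phi> / complex_of_real \<rho>"
  let ?w = "\<lambda>z. cvec (Wz W z q)" and ?w' = "\<lambda>z. cvec (Wzz W z q)"
  have chk: "\<phi> *s L1_check l A W q \<zeta>h \<rho> z = ?c *s L1 l A W q (\<rho> *\<^sub>R \<zeta>h) z" for z
    by (simp add: L1_check_def scaleR_eq_scale)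
  note prof = solves_on_profile[of ?S "\<rho> *\<^sub>R \<zeta>h"]
  show ?thesis
  proof
    assume ?lhs
    then obtain u v where uv: "x = vjoin (u 0) (v 0)"
      "solves_on ?S l A W q (\<rho> *\<^sub>R \<zeta>h) (\<lambda>z. \<phi> *s L1_check l A W q \<zeta>h \<rho> z) u v" "bounded (u ` ?S)" by blast
    have "solves_on ?S l A W q (\<rho> *\<^sub>R \<zeta>h) (\<lambda>_. 0) (\<lambda>z. u z + (- ?c) *s ?w z) (\<lambda>z. v z + (- ?c) *s ?w' z)"
      using solves_on_add_scale[OF uv(2) prof, of "- ?c"] by (simp add: chk)
    moreover have "bounded ((\<lambda>z. u z + (- ?c) *s ?w z) ` ?S)"
      by (intro bounded_add_scale uv Wz_bounded_half_line)
    moreover have "x - ?c *s Xdata = vjoin (u 0 + (- ?c) *s ?w 0) (v 0 + (- ?c) *s ?w' 0)"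
      by (simp add: uv(1) Xdata_def vjoin_scale vjoin_diff)
    ultimately show ?rhs
      unfolding Espace_def
      by (intro CollectI exI[of _ "\<lambda>z. u z + (- ?c) *s ?w z"] exI[of _ "\<lambda>z. v z + (- ?c) *s ?w' z"] conjI)
  next
    assume ?rhs
    then obtain u v where uv: "x - ?c *s Xdata = vjoin (u 0) (v 0)"
      "solves_on ?S l A W q (\<rho> *\<^sub>R \<zeta>h) (\<lambda>_. 0) u v" "bounded (u ` ?S)" unfolding Espace_def by blast
    have "solves_on ?S l A W q (\<rho> *\<^sub>R \<zeta>h) (\<lambda>z. \<phi> *s L1_check l A W q \<zeta>h \<rho> z)
        (\<lambda>z. u z + ?c *s ?w z) (\<lambda>z. v z + ?c *s ?w' z)"
      using solves_on_add_scale[OF uv(2) prof, of ?c] by (simp add: chk)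
    moreover have "bounded ((\<lambda>z. u z + ?c *s ?w z) ` ?S)"
      by (intro bounded_add_scale uv Wz_bounded_half_line)
    moreover have "x = vjoin (u 0 + ?c *s ?w 0) (v 0 + ?c *s ?w' 0)"
    proof -
      have "x = vjoin (u 0) (v 0) + ?c *s Xdata" unfolding uv(1)[symmetric] by simp
      then show ?thesis by (simp add: Xdata_def vjoin_scale vjoin_add)
    qed
    ultimately show ?lhs
      by (intro exI[of _ "\<lambda>z. u z + ?c *s ?w z"] exI[of _ "\<lambda>z. v z + ?c *s ?w' z"] conjI)
  qed
qed

end

lemma half_lines: "{..0::real} = {z. 0 \<le> (- 1) * z}" "{0::real..} = {z. 0 \<le> 1 * z}"
  by auto

locale profile_point = shock_manifold l A Us Up Um k C W q0
  for l :: "'d::finite" and A :: "'d \<Rightarrow> real^'n \<Rightarrow> real^'n^'n" and Us Up Um k C W q0 +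
  fixes q
  assumes qC: "q \<in> C"
begin

sublocale R: profile_side l A Us Up Um k C W q0 q 1
  by unfold_locales (use qC in auto)

sublocale L: profile_side l A Us Up Um k C W q0 q "- 1"
  by unfold_locales (use qC in auto)

abbreviation "Em \<equiv> Espace {..0} l A W q"
abbreviation "Ep \<equiv> Espace {0..} l A W q"

definition "Epair \<zeta>h \<rho> = {vjoin x y | x y. x \<in> Em \<zeta>h \<rho> \<and> y \<in> Ep \<zeta>h \<rho>}"

text \<open>The direction that the modified space has in addition to \<open>E\<^sub>- \<times> E\<^sub>+ \<times> 0\<close>.\<close>

definition psi where "psi \<rho> = vjoin (vjoin R.Xdata R.Xdata) (vec (complex_of_real \<rho>) :: complex^unit)"

text \<open>The functional that cuts the kernel of the boundary operator out of the diagonal times \<open>\<complex>\<close>. On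
  the diagonal it could read either copy of \<open>u\<close>; it reads the right one.\<close>

definition bdry where
  "bdry \<zeta>h \<rho> x = (\<Sum>i\<in>UNIV. complex_of_real (Wz W 0 q0 $ i) * x $ Inl (Inr (Inl i)))
     + c0_check l \<zeta>h \<rho> * x $ Inr ()"

lemma subspace_Em: "vec.subspace (Em \<zeta>h \<rho>)" and subspace_Ep: "vec.subspace (Ep \<zeta>h \<rho>)"
  using L.subspace_Espace R.subspace_Espace unfolding half_lines by blast+

lemma Emod_eq:
  assumes \<rho>: "\<rho> > 0"
  shows "Emod l A W q \<zeta>h \<rho> = {e + c *s psi \<rho> | e c. e \<in> {vjoin e 0 | e. e \<in> Epair \<zeta>h \<rho>}}"
proof (intro equalityI subsetI)
  fix x assume "x \<in> Emod l A W q \<zeta>h \<rho>"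
  then obtain um vm up vp \<phi> where x: "x = vjoin (vjoin (vjoin (um 0) (vm 0)) (vjoin (up 0) (vp 0))) (vec \<phi>)"
    and m: "solves_on {..0} l A W q (\<rho> *\<^sub>R \<zeta>h) (\<lambda>z. \<phi> *s L1_check l A W q \<zeta>h \<rho> z) um vm" "bounded (um ` {..0})"
    and p: "solves_on {0..} l A W q (\<rho> *\<^sub>R \<zeta>h) (\<lambda>z. \<phi> *s L1_check l A W q \<zeta>h \<rho> z) up vp" "bounded (up ` {0..})"
    unfolding Emod_def by blast
  let ?c = "\<phi> / complex_of_real \<rho>"
  have "vjoin (um 0) (vm 0) - ?c *s R.Xdata \<in> Em \<zeta>h \<rho>"
    using L.inhomogeneous_data_iff[OF \<rho>, of "vjoin (um 0) (vm 0)" \<zeta>h \<phi>] m unfolding half_lines by blast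
  moreover have "vjoin (up 0) (vp 0) - ?c *s R.Xdata \<in> Ep \<zeta>h \<rho>"
    using R.inhomogeneous_data_iff[OF \<rho>, of "vjoin (up 0) (vp 0)" \<zeta>h \<phi>] p unfolding half_lines by blast
  moreover have "vec \<phi> = ?c *s (vec (complex_of_real \<rho>) :: complex^unit)"
    using \<rho> by (simp add: vec_eq_iff)
  then have "x = vjoin (vjoin (vjoin (um 0) (vm 0) - ?c *s R.Xdata) (vjoin (up 0) (vp 0) - ?c *s R.Xdata)) 0 + ?c *s psi \<rho>"
    by (simp add: x psi_def vjoin_scale vjoin_add)
  ultimately show "x \<in> {e + c *s psi \<rho> | e c. e \<in> {vjoin e 0 | e. e \<in> Epair \<zeta>h \<rho>}}"
    unfolding Epair_def by blast
next
  fix x assume "x \<in> {e + c *s psi \<rho> | e c. e \<in> {vjoin e 0 | e. e \<in> Epair \<zeta>h \<rho>}}"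
  then obtain a b c where x: "x = vjoin (vjoin a b) 0 + c *s psi \<rho>" and ab: "a \<in> Em \<zeta>h \<rho>" "b \<in> Ep \<zeta>h \<rho>"
    unfolding Epair_def by blast
  let ?\<phi> = "c * complex_of_real \<rho>"
  have c: "?\<phi> / complex_of_real \<rho> = c" using \<rho> by simp
  have "\<exists>u v. a + c *s R.Xdata = vjoin (u 0) (v 0) \<and>
      solves_on {..0} l A W q (\<rho> *\<^sub>R \<zeta>h) (\<lambda>z. ?\<phi> *s L1_check l A W q \<zeta>h \<rho> z) u v \<and> bounded (u ` {..0})"
    using L.inhomogeneous_data_iff[OF \<rho>, of "a + c *s R.Xdata" \<zeta>h ?\<phi>] ab unfolding half_lines c by simp
  then obtain um vm where m: "a + c *s R.Xdata = vjoin (um 0) (vm 0)"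
    "solves_on {..0} l A W q (\<rho> *\<^sub>R \<zeta>h) (\<lambda>z. ?\<phi> *s L1_check l A W q \<zeta>h \<rho> z) um vm" "bounded (um ` {..0})" by blast
  have "\<exists>u v. b + c *s R.Xdata = vjoin (u 0) (v 0) \<and>
      solves_on {0..} l A W q (\<rho> *\<^sub>R \<zeta>h) (\<lambda>z. ?\<phi> *s L1_check l A W q \<zeta>h \<rho> z) u v \<and> bounded (u ` {0..})"
    using R.inhomogeneous_data_iff[OF \<rho>, of "b + c *s R.Xdata" \<zeta>h ?\<phi>] ab unfolding half_lines c by simp
  then obtain up vp where p: "b + c *s R.Xdata = vjoin (up 0) (vp 0)"
    "solves_on {0..} l A W q (\<rho> *\<^sub>R \<zeta>h) (\<lambda>z. ?\<phi> *s L1_check l A W q \<zeta>h \<rho> z) up vp" "bounded (up ` {0..})" by blast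
  have "c *s (vec (complex_of_real \<rho>) :: complex^unit) = vec ?\<phi>" by (simp add: vec_eq_iff)
  then have "x = vjoin (vjoin (vjoin (um 0) (vm 0)) (vjoin (up 0) (vp 0))) (vec ?\<phi>)"
    unfolding x psi_def vjoin_scale vjoin_add m(1)[symmetric] p(1)[symmetric] by simp
  then show "x \<in> Emod l A W q \<zeta>h \<rho>" unfolding Emod_def using m(2,3) p(2,3) by blast
qed

lemma ker_Gamma_eq:
  "ker_Gamma_mod l W q0 \<zeta>h \<rho> = {g \<in> {vjoin f c | f c. f \<in> {vjoin U U | U :: complex^('n + 'n). True}}. bdry \<zeta>h \<rho> g = 0}"
proof (intro equalityI subsetI)
  fix x assume "x \<in> ker_Gamma_mod l W q0 \<zeta>h \<rho>"
  then show "x \<in> {g \<in> {vjoin f c | f c. f \<in> {vjoin U U | U :: complex^('n + 'n). True}}. bdry \<zeta>h \<rho> g = 0}"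
    unfolding ker_Gamma_mod_def bdry_def by auto
next
  fix x assume "x \<in> {g \<in> {vjoin f c | f c. f \<in> {vjoin U U | U :: complex^('n + 'n). True}}. bdry \<zeta>h \<rho> g = 0}"
  then obtain U c where x: "x = vjoin (vjoin U U) c" "bdry \<zeta>h \<rho> x = 0" by auto
  obtain u v where U: "U = vjoin u v" by (rule vjoin_exhaust)
  have "c = vec (c $ ())" by (simp add: vec_eq_iff)
  then have "x = vjoin (vjoin (vjoin u v) (vjoin u v)) (vec (c $ ()))" using x(1) U by simp
  moreover have "(\<Sum>i\<in>UNIV. complex_of_real (Wz W 0 q0 $ i) * u $ i) + c0_check l \<zeta>h \<rho> * (c $ ()) = 0"
    using x(2) unfolding x(1) U bdry_def by simp
  ultimately show "x \<in> ker_Gamma_mod l W q0 \<zeta>h \<rho>" unfolding ker_Gamma_mod_def by blast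
qed

lemma bdry_psi:
  assumes "\<rho> > 0"
  shows "bdry \<zeta>h \<rho> (psi \<rho>) = complex_of_real (Wz W 0 q0 \<bullet> Wz W 0 q) + c0 l (\<rho> *\<^sub>R \<zeta>h)"
  using assms by (simp add: bdry_def psi_def R.Xdata_def cvec_def c0_check_def inner_vec_def)

lemma cmod_bdry_le: "cmod (bdry \<zeta>h \<rho> g) \<le> (norm (Wz W 0 q0) + cmod (c0_check l \<zeta>h \<rho>)) * norm g"
proof -
  obtain U c where g: "g = vjoin U c" by (rule vjoin_exhaust)
  obtain U1 U2 where U: "U = vjoin U1 U2" by (rule vjoin_exhaust)
  obtain u v where U2: "U2 = vjoin u v" by (rule vjoin_exhaust)
  have nu: "norm u \<le> norm g"
    using norm_le_vjoin(1)[of u v] norm_le_vjoin(2)[of U2 U1] norm_le_vjoin(1)[of U c]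
    unfolding g U U2 by linarith
  have nc: "cmod (c $ ()) \<le> norm g"
    using Finite_Cartesian_Product.norm_nth_le[of c "()"] norm_le_vjoin(2)[of c U] unfolding g by linarith
  have "cmod (\<Sum>i\<in>UNIV. complex_of_real (Wz W 0 q0 $ i) * u $ i) \<le>
      (\<Sum>i\<in>UNIV. \<bar>Wz W 0 q0 $ i\<bar> * \<bar>cmod (u $ i)\<bar>)"
    by (intro sum_norm_le) (auto simp: norm_mult)
  also have "\<dots> \<le> L2_set (\<lambda>i. Wz W 0 q0 $ i) UNIV * L2_set (\<lambda>i. cmod (u $ i)) UNIV"
    by (rule L2_set_mult_ineq)
  also have "\<dots> = norm (Wz W 0 q0) * norm u"
    by (simp add: norm_vec_def L2_set_def)
  also have "\<dots> \<le> norm (Wz W 0 q0) * norm g" by (intro mult_left_mono nu) auto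
  finally have "cmod (\<Sum>i\<in>UNIV. complex_of_real (Wz W 0 q0 $ i) * u $ i) \<le> norm (Wz W 0 q0) * norm g" .
  moreover have "cmod (c0_check l \<zeta>h \<rho> * c $ ()) \<le> cmod (c0_check l \<zeta>h \<rho>) * norm g"
    unfolding norm_mult by (intro mult_left_mono nc) auto
  ultimately have "cmod ((\<Sum>i\<in>UNIV. complex_of_real (Wz W 0 q0 $ i) * u $ i) + c0_check l \<zeta>h \<rho> * c $ ()) \<le>
      norm (Wz W 0 q0) * norm g + cmod (c0_check l \<zeta>h \<rho>) * norm g"
    by (intro norm_triangle_mono)
  then show ?thesis by (simp add: bdry_def g U U2 distrib_right)
qed

lemma subspace_diag: "vec.subspace {vjoin U U | U. True}"
  unfolding vec.subspace_def
proof (intro conjI ballI allI)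
  show "0 \<in> {vjoin U U | U. True}" by (metis (mono_tags, lifting) mem_Collect_eq vjoin_zero)
qed (auto simp: vjoin_add vjoin_scale)

lemma dim_diag: "vec.dim {vjoin U U | U :: complex^'m. True} = CARD('m)"
proof -
  have "vec.dim {vjoin U U | U :: complex^'m. True} = vec.dim (UNIV :: (complex^'m) set)"
  proof (rule antisym)
    show "vec.dim {vjoin U U | U :: complex^'m. True} \<le> vec.dim (UNIV :: (complex^'m) set)"
      by (rule dim_le_by_relation[where R = "\<lambda>x U. x = vjoin U U", OF subspace_diag])
        (auto simp: vjoin_add vjoin_scale)
    show "vec.dim (UNIV :: (complex^'m) set) \<le> vec.dim {vjoin U U | U :: complex^'m. True}"
    proof (rule dim_le_by_relation[where R = "\<lambda>U x. x = vjoin U U", OF vec.subspace_UNIV subspace_diag])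
      show "U = 0" if "0 = vjoin U U" for U :: "complex^'m"
        using that by (metis vjoin_eq_iff vjoin_zero)
    qed (auto simp: vjoin_add vjoin_scale)
  qed
  then show ?thesis by (simp add: vec_dim_card card_cart_basis)
qed

text \<open>The pair of the standard Evans function, with the coordinate \<open>\<phi>\<close> adjoined to the diagonal, and the
  pair of the modified one are related as in \<open>det_pair_hyperplane\<close>.\<close>

theorem Evans_comparison:
  assumes \<zeta>h: "\<zeta>h \<in> half_sphere" and \<rho>: "\<rho> > 0" and e: "e \<in> Epair \<zeta>h \<rho>"
  shows "cmod (complex_of_real (Wz W 0 q0 \<bullet> Wz W 0 q) + c0 l (\<rho> *\<^sub>R \<zeta>h)) * cmod (Ds l A W q \<zeta>h \<rho>) \<le>
    (norm (Wz W 0 q0) + cmod (c0_check l \<zeta>h \<rho>)) * norm (psi \<rho> - vjoin e 0) * cmod (Dmod l A W q0 q \<zeta>h \<rho>)"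
proof (cases "bdry \<zeta>h \<rho> (psi \<rho>) = 0")
  case True
  then show ?thesis unfolding bdry_psi[OF \<rho>] by simp
next
  case False
  let ?E = "Epair \<zeta>h \<rho>" and ?Dg = "{vjoin U U | U :: complex^('n + 'n). True}"
  let ?E1 = "{vjoin e (0 :: complex^unit) | e. e \<in> ?E}" and ?G = "{vjoin f (c :: complex^unit) | f c. f \<in> ?Dg}"
  have sE: "vec.subspace ?E" unfolding Epair_def by (intro subspace_vjoin subspace_Em subspace_Ep)
  have dE: "vec.dim ?E = CARD('n) + CARD('n)"
    unfolding Epair_def using L.dim_Espace[OF \<zeta>h \<rho>] R.dim_Espace[OF \<zeta>h \<rho>]
    by (subst dim_vjoin[OF subspace_Em subspace_Ep]) (simp add: half_lines)
  have "vec.dim ?E + vec.dim ?Dg = CARD(('n + 'n) + ('n + 'n))" unfolding dE dim_diag by simp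
  then obtain M I where MI: "cols_onb M I ?E" "cols_onb M (- I) ?Dg"
    using cols_onb_exists[OF sE subspace_diag] by blast
  have DsM: "cmod (Ds l A W q \<zeta>h \<rho>) = cmod (det_pair ?E1 ?G)"
  proof -
    have "cmod (Ds l A W q \<zeta>h \<rho>) = cmod (det M)"
      unfolding Ds_def Epair_def[symmetric] by (rule cmod_det_pair[OF MI])
    also have "\<dots> = cmod (det (bordered M))" by (simp add: det_bordered)
    also have "\<dots> = cmod (det_pair ?E1 ?G)" by (rule cmod_det_pair[OF cols_onb_bordered[OF MI], symmetric])
    finally show ?thesis .
  qed
  have E1: "?E1 = {vjoin x y | x y. x \<in> ?E \<and> y \<in> {0}}" by auto
  have G: "?G = {vjoin x y | x y. x \<in> ?Dg \<and> y \<in> UNIV}" by auto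
  have s1: "vec.subspace ?E1" unfolding E1 by (intro subspace_vjoin sE vec.subspace_single_0)
  have s2: "vec.subspace ?G" unfolding G by (intro subspace_vjoin subspace_diag vec.subspace_UNIV)
  have d: "vec.dim ?E1 + vec.dim ?G = CARD((('n + 'n) + ('n + 'n)) + unit)"
    unfolding E1 G dim_vjoin[OF sE vec.subspace_single_0] dim_vjoin[OF subspace_diag vec.subspace_UNIV] dE dim_diag
    by (simp add: vec_dim_card card_cart_basis)
  have add: "bdry \<zeta>h \<rho> (x + y) = bdry \<zeta>h \<rho> x + bdry \<zeta>h \<rho> y" for x y
    by (simp add: bdry_def sum.distrib algebra_simps)
  have scale: "bdry \<zeta>h \<rho> (c *s x) = c * bdry \<zeta>h \<rho> x" for c x
    by (simp add: bdry_def sum_distrib_left algebra_simps)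
  have "psi \<rho> \<in> ?G" unfolding psi_def by blast
  from det_pair_hyperplane[OF s1 s2 d this False _ add scale cmod_bdry_le, of "vjoin e 0"] e
  show ?thesis
    unfolding Dmod_def Emod_eq[OF \<rho>] ker_Gamma_eq DsM bdry_psi[OF \<rho>] by blast
qed

text \<open>The factor \<open>\<bar>\<beta> \<psi>\<bar>\<close> of the comparison is at least its real part, which is bounded below by
  \<open>\<delta>\<close>; and \<open>Epair\<close> comes within \<open>O(\<rho>)\<close> of \<open>\<psi>\<close>, which cancels the factor \<open>\<rho>\<close> in the standard Evans
  condition.\<close>

theorem modified_of_standard:
  assumes pos: "Wz W 0 q0 \<bullet> Wz W 0 q > 0" and std: "standard_uniform_evans l A W q"
  shows "modified_uniform_evans l A W q0 q"
proof -
  define \<delta> where "\<delta> = Wz W 0 q0 \<bullet> Wz W 0 q"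
  have num: "\<delta> \<le> cmod (complex_of_real (Wz W 0 q0 \<bullet> Wz W 0 q) + c0 l (\<rho> *\<^sub>R \<zeta>h))"
    if "\<zeta>h \<in> half_sphere" "\<rho> > 0" for \<zeta>h \<rho>
  proof -
    have "normsq_tan l (snd (\<rho> *\<^sub>R \<zeta>h)) \<ge> 0" unfolding normsq_tan_def by (intro sum_nonneg) auto
    moreover have "\<rho> * fst \<zeta>h \<ge> 0" using that by (simp add: half_sphere_def)
    ultimately have "\<delta> \<le> Re (complex_of_real (Wz W 0 q0 \<bullet> Wz W 0 q) + c0 l (\<rho> *\<^sub>R \<zeta>h))"
      by (simp add: c0_def \<delta>_def)
    then show ?thesis using complex_Re_le_cmod order_trans by blast
  qed
  from std[unfolded standard_uniform_evans_def]
  obtain c \<rho>0 where c: "c > 0" "\<rho>0 > 0"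
    and c': "\<forall>\<zeta>h\<in>half_sphere. \<forall>\<rho>. 0 < \<rho> \<and> \<rho> \<le> \<rho>0 \<longrightarrow> cmod (Ds l A W q \<zeta>h \<rho>) \<ge> c * \<rho>"
    and nz: "\<forall>\<zeta>h\<in>half_sphere. \<forall>\<rho>>0. Ds l A W q \<zeta>h \<rho> \<noteq> 0"
    by (elim exE conjE)
  from R.Espace_near_profile[folded half_lines]
  obtain Kp \<rho>p where Kp: "Kp \<ge> 0" "\<rho>p > 0" "\<forall>\<zeta>h\<in>half_sphere. \<forall>\<rho>. 0 < \<rho> \<and> \<rho> \<le> \<rho>p \<longrightarrow>
      (\<exists>y\<in>Ep \<zeta>h \<rho>. norm (y - R.Xdata) \<le> Kp * \<rho>)"
    by (elim exE conjE)
  from L.Espace_near_profile[folded half_lines]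
  obtain Km \<rho>m where Km: "Km \<ge> 0" "\<rho>m > 0" "\<forall>\<zeta>h\<in>half_sphere. \<forall>\<rho>. 0 < \<rho> \<and> \<rho> \<le> \<rho>m \<longrightarrow>
      (\<exists>y\<in>Em \<zeta>h \<rho>. norm (y - R.Xdata) \<le> Km * \<rho>)"
    by (elim exE conjE)
  define Q where "Q = (norm (Wz W 0 q0) + 3) * (Km + Kp + 1)"
  have Q: "Q > 0" unfolding Q_def using Kp(1) Km(1) by (intro mult_pos_pos) (auto intro: add_nonneg_pos)
  define \<rho>1 where "\<rho>1 = min (min \<rho>0 1) (min \<rho>p \<rho>m)"
  have "\<rho>1 > 0" using c Kp Km by (simp add: \<rho>1_def)
  have small: "cmod (Dmod l A W q0 q \<zeta>h \<rho>) \<ge> \<delta> * c / Q" if \<zeta>h: "\<zeta>h \<in> half_sphere" and \<rho>: "0 < \<rho>" "\<rho> \<le> \<rho>1" for \<zeta>h \<rho>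
  proof -
    obtain yp where yp: "yp \<in> Ep \<zeta>h \<rho>" "norm (yp - R.Xdata) \<le> Kp * \<rho>" using Kp(3) \<zeta>h \<rho> by (auto simp: \<rho>1_def)
    obtain ym where ym: "ym \<in> Em \<zeta>h \<rho>" "norm (ym - R.Xdata) \<le> Km * \<rho>" using Km(3) \<zeta>h \<rho> by (auto simp: \<rho>1_def)
    let ?e = "vjoin ym yp"
    have e: "?e \<in> Epair \<zeta>h \<rho>" unfolding Epair_def using yp ym by blast
    have nv: "norm (vec (complex_of_real \<rho>) :: complex^unit) = \<rho>" using \<rho> by (simp add: norm_vec_def L2_set_def)
    have "psi \<rho> - vjoin ?e 0 = vjoin (vjoin (R.Xdata - ym) (R.Xdata - yp)) (vec (complex_of_real \<rho>))"
      by (simp add: psi_def vjoin_diff)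
    then have "norm (psi \<rho> - vjoin ?e 0) \<le> norm (R.Xdata - ym) + norm (R.Xdata - yp) + \<rho>"
      using norm_vjoin_le[of "vjoin (R.Xdata - ym) (R.Xdata - yp)" "vec (complex_of_real \<rho>) :: complex^unit"]
        norm_vjoin_le[of "R.Xdata - ym" "R.Xdata - yp"] nv by simp
    also have "\<dots> \<le> Km * \<rho> + Kp * \<rho> + \<rho>"
      using yp(2) ym(2) by (intro add_mono) (auto simp: norm_minus_commute)
    finally have ne: "norm (psi \<rho> - vjoin ?e 0) \<le> (Km + Kp + 1) * \<rho>" by (simp add: algebra_simps)
    have "cmod (c0 l (\<rho> *\<^sub>R \<zeta>h)) \<le> 3 * \<rho>"
      using \<zeta>h \<rho> by (intro R.cmod_c0_le) (auto simp: half_sphere_def \<rho>1_def)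
    then have ck: "cmod (c0_check l \<zeta>h \<rho>) \<le> 3"
      using \<rho> by (simp add: c0_check_def norm_divide pos_divide_le_eq)
    have "\<delta> * (c * \<rho>) \<le> cmod (complex_of_real (Wz W 0 q0 \<bullet> Wz W 0 q) + c0 l (\<rho> *\<^sub>R \<zeta>h)) * cmod (Ds l A W q \<zeta>h \<rho>)"
    proof (rule mult_mono[OF num[OF \<zeta>h \<rho>(1)]])
      show "c * \<rho> \<le> cmod (Ds l A W q \<zeta>h \<rho>)" using c' \<zeta>h \<rho> by (simp add: \<rho>1_def)
    qed (use c(1) \<rho> in auto)
    also have "\<dots> \<le> (norm (Wz W 0 q0) + cmod (c0_check l \<zeta>h \<rho>)) * norm (psi \<rho> - vjoin ?e 0) * cmod (Dmod l A W q0 q \<zeta>h \<rho>)"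
      by (rule Evans_comparison[OF \<zeta>h \<rho>(1) e])
    also have "\<dots> \<le> (norm (Wz W 0 q0) + 3) * ((Km + Kp + 1) * \<rho>) * cmod (Dmod l A W q0 q \<zeta>h \<rho>)"
      by (intro mult_right_mono mult_mono ne add_left_mono ck) auto
    also have "\<dots> = \<rho> * (Q * cmod (Dmod l A W q0 q \<zeta>h \<rho>))" by (simp add: Q_def)
    finally have "\<rho> * (\<delta> * c) \<le> \<rho> * (Q * cmod (Dmod l A W q0 q \<zeta>h \<rho>))" by (simp add: mult_ac)
    then have "\<delta> * c \<le> Q * cmod (Dmod l A W q0 q \<zeta>h \<rho>)" using \<rho> by simp
    then show ?thesis using Q by (simp add: pos_divide_le_eq mult.commute)
  qed
  have "Dmod l A W q0 q \<zeta>h \<rho> \<noteq> 0" if \<zeta>h: "\<zeta>h \<in> half_sphere" and \<rho>: "\<rho> > 0" for \<zeta>h \<rho>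
  proof
    assume z: "Dmod l A W q0 q \<zeta>h \<rho> = 0"
    have "0 \<in> Epair \<zeta>h \<rho>"
      using vec.subspace_0[OF subspace_vjoin[OF subspace_Em subspace_Ep]] unfolding Epair_def by blast
    from Evans_comparison[OF \<zeta>h \<rho> this] z
    have "cmod (complex_of_real (Wz W 0 q0 \<bullet> Wz W 0 q) + c0 l (\<rho> *\<^sub>R \<zeta>h)) * cmod (Ds l A W q \<zeta>h \<rho>) \<le> 0" by simp
    moreover have "cmod (complex_of_real (Wz W 0 q0 \<bullet> Wz W 0 q) + c0 l (\<rho> *\<^sub>R \<zeta>h)) > 0"
      using num[OF \<zeta>h \<rho>] pos unfolding \<delta>_def by linarith
    moreover have "cmod (Ds l A W q \<zeta>h \<rho>) > 0" using nz \<zeta>h \<rho> by simp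
    ultimately show False by (metis mult_pos_pos not_le)
  qed
  moreover have "\<delta> * c / Q > 0" using pos c Q by (simp add: \<delta>_def)
  ultimately show ?thesis
    unfolding modified_uniform_evans_def using small \<open>\<rho>1 > 0\<close> by blast
qed

end

context shock_manifold
begin

text \<open>By uniqueness for \<open>v' = G v\<close> a zero of \<open>W'\<close> would make the profile constant.\<close>

lemma Wz_nonzero: assumes q: "q \<in> C" shows "Wz W 0 q \<noteq> 0"
proof
  assume z: "Wz W 0 q = 0"
  interpret profile_point l A Us Up Um k C W q0 q by unfold_locales (rule q)
  have "cvec (Wz W (1 * z) q) = 0" if "z \<ge> 0" for z
    using sol_zero_propagates[OF R.Wz_sol R.continuous_G order_refl _ that] z by (simp add: cvec_def vec_eq_iff)
  moreover have "cvec (Wz W (- 1 * z) q) = 0" if "z \<ge> 0" for z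
    using sol_zero_propagates[OF L.Wz_sol L.continuous_G order_refl _ that] z by (simp add: cvec_def vec_eq_iff)
  ultimately have right: "cvec (Wz W z q) = 0" and left: "cvec (Wz W (- z) q) = 0" if "z \<ge> 0" for z
    using that by simp_all
  have "norm (cvec (Wz W y q)) = 0" for y
    using right[of y] left[of "- y"] by (cases "y \<ge> 0") (simp_all del: norm_cvec)
  then have "Wz W y q = 0" for y by simp
  then have "((\<lambda>y. W y q) has_vector_derivative 0) (at y within UNIV)" for y using W_deriv[OF q, of y] by simp
  then obtain c where "\<And>y. W y q = c"
    using has_vector_derivative_zero_constant[of UNIV "\<lambda>y. W y q"] by auto
  then show False using W_nonconst[OF q] by (auto simp: constant_on_def)
qed

text \<open>\<open>W'(0, q)\<close> is continuous along the shock manifold and does not vanish at the base point.\<close>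

lemma Wz_near_base:
  obtains V where "open V" "q0 \<in> V" "\<And>q. q \<in> C \<inter> V \<Longrightarrow> Wz W 0 q0 \<bullet> Wz W 0 q > 0"
proof -
  obtain V G where V: "open V" "(0, q0) \<in> V" "\<And>x. x \<in> V \<Longrightarrow> G differentiable (at x)"
    and G: "\<And>y p. (y, p) \<in> V \<Longrightarrow> p \<in> C \<Longrightarrow> Wz W y p = G (y, p)"
    using Wz_local[OF q0(1), of 0] by metis
  define f where "f p = Wz W 0 q0 \<bullet> G (0, p)" for p
  have "isCont G (0, q0)" by (rule differentiable_imp_continuous_within[OF V(3)[OF V(2)]])
  moreover have "isCont (\<lambda>p. (0 :: real, p)) q0" by (intro continuous_intros)
  ultimately have "isCont (\<lambda>p. G (0, p)) q0" using isCont_o2[of q0 "\<lambda>p. (0, p)" G] by simp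
  then have "isCont f q0" unfolding f_def by (intro continuous_intros)
  then have t: "(f \<longlongrightarrow> f q0) (nhds q0)" by (simp add: isCont_def tendsto_at_iff_tendsto_nhds)
  have "f q0 > 0" using G[OF V(2) q0(1)] Wz_nonzero[OF q0(1)] by (simp add: f_def)
  then have "eventually (\<lambda>p. f p > 0) (nhds q0)" by (rule order_tendstoD(1)[OF t])
  moreover have "open ((\<lambda>p. (0, p)) -` V)" using V(1) by (intro open_vimage continuous_intros)
  then have "eventually (\<lambda>p. p \<in> (\<lambda>p. (0, p)) -` V) (nhds q0)"
    using V(2) by (intro eventually_nhds_in_open) auto
  then have "eventually (\<lambda>p. (0, p) \<in> V) (nhds q0)" by simp
  ultimately have "eventually (\<lambda>p. f p > 0 \<and> (0, p) \<in> V) (nhds q0)" by eventually_elim simp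
  then obtain T where T: "open T" "q0 \<in> T" "\<And>p. p \<in> T \<Longrightarrow> f p > 0 \<and> (0, p) \<in> V"
    unfolding eventually_nhds by blast
  show ?thesis
  proof (rule that[OF T(1,2)])
    show "Wz W 0 q0 \<bullet> Wz W 0 q > 0" if "q \<in> C \<inter> T" for q
      using T(3)[of q] G[of 0 q] that by (auto simp: f_def)
  qed
qed

end

theorem theorem1p20:
  fixes l :: "'d::finite"
    and A :: "'d \<Rightarrow> real^'n \<Rightarrow> real^'n^'n"
    and Us Up Um :: "(real^'n) set"
    and k :: nat
    and C :: "('n, 'd) shock set"
    and W :: "real \<Rightarrow> ('n, 'd) shock \<Rightarrow> real^'n"
    and q0 :: "('n, 'd) shock"
  assumes "shock_manifold l A Us Up Um k C W q0"
  shows "\<exists>V. open V \<and> q0 \<in> V \<and>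
           (\<forall>q\<in>C \<inter> V. standard_uniform_evans l A W q \<longrightarrow> modified_uniform_evans l A W q0 q)"
proof -
  interpret shock_manifold l A Us Up Um k C W q0 by (rule assms)
  obtain V where V: "open V" "q0 \<in> V" "\<And>q. q \<in> C \<inter> V \<Longrightarrow> Wz W 0 q0 \<bullet> Wz W 0 q > 0"
    using Wz_near_base by blast
  have "modified_uniform_evans l A W q0 q" if q: "q \<in> C \<inter> V" and std: "standard_uniform_evans l A W q" for q
  proof -
    interpret profile_point l A Us Up Um k C W q0 q by unfold_locales (use q in auto)
    show ?thesis by (rule modified_of_standard[OF V(3)[OF q] std])
  qed
  then show ?thesis using V by blast
qed

end
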